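(* Let $s\in(0,1)$, let $\delta$ satisfy $s<\delta\le 2-s$ and $\delta<3/2$, let $0<k\le k_0$ be the quadrature spacing and let $c_I$ be the inverse constant and $\gamma(k)$ the quadrature consistency bound given in the context. Let the quadrature parameters be $$N^+=\Big\lceil\frac{4\pi\mathsf d}{k^2(\delta-s)}\Big\rceil,\qquad N^-=\Big\lceil\frac{2\pi\mathsf d}{sk^2}\Big\rceil,$$ and assume that $k$ is chosen sufficiently small so that $$c_I\,\gamma(k)\,h^{s-\delta}<1.$$ Then there is a constant $c>0$ independent of $h$, $k$ and $M$ such that $$a_h^{k,M}(\eta_h,\eta_h)\ge c\,\|\eta_h\|^2_{\widetilde H^s(D)}\qquad\text{for all }\eta_h\in\mathbb V_h(D).$$
   Context: $k_0>0$ is a fixed upper bound for the quadrature spacings considered and $\mathsf d\in(0,\pi)$ is fixed. $D\subset\mathbb R^d$ is a bounded polygonal domain with Lipschitz boundary; $\widetilde\eta$ is the extension by zero of $\eta$ outside $D$; $(\cdot,\cdot)_\omega$ is the $L^2(\omega)$ inner product; $d_\omega(\eta,\phi)=\int_\omega\nabla\eta\cdot\nabla\phi\,dx$. For $r\in(0,2)$, $\widetilde H^r(D)$ is the set of functions on $D$ whose extension by zero is in $H^r(\mathbb R^d)$, with norm $\|\widetilde\phi\|_{H^r(\mathbb R^d)}$ for $r\in[1,2)$ and, for $r\in(0,1)$, norm $$\|\phi\|_{\widetilde H^r(D)}=\Big(\frac{c_{d,r}}2\int_{\mathbb R^d}\int_{\mathbb R^d}\frac{(\widetilde\phi(x)-\widetilde\phi(y))^2}{|x-y|^{d+2r}}dx\,dy\Big)^{1/2}=\|(-\Delta)^{r/2}\widetilde\phi\|_{L^2(\mathbb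 R^d)},$$ where $(-\Delta)^\sigma$ has Fourier multiplier $|\zeta|^{2\sigma}$ and $c_{d,r}$ is the constant in its principal value representation $(-\Delta)^r\eta(x)=c_{d,r}\mathrm{PV}\!\int\frac{\eta(x)-\eta(y)}{|x-y|^{d+2r}}dy$. Truncated domains: $\Omega$ is a convex bounded polygonal domain of diameter $1$ containing $D$ and the origin. For $M>0$, $t>0$, $\Omega^M(t)=\{(1+t(1+M))x:x\in\Omega\}$ if $t\ge1$ and $\Omega^M(t)=\{(2+M)x:x\in\Omega\}$ if $t<1$. Quadrature: $c_s=2\sin(\pi s)/\pi$, $y_j=jk$, $t_j=e^{-y_j/2}$, $j=-N^-,\dots,N^+$. Finite elements: $\mathcal T_h(D)$ and $\mathcal T_h(\Omega^M(t_j))$ are conforming simplicial subdivisions of maximal diameter $h\le1$, shape-regular ($\operatorname{diam}(T)/r(T)\le\sigma$ for every element $T$, $r(T)$ the radius of the largest ball in $T$) and quasi-uniform ($\max_T\operatorname{diam}(T)/\min_T\operatorname{diam}(T)\le\rho$) with constants $\sigma,\rho$ independent of $h$ and $j$, and $\mathcal T_h(D)\subset\mathcal T_h(\Omega^M(t_j))$ for each $j$. $\mathbb V_h(D)\subset H_0^1(D)$ and $\mathbb V_h^M(t_j)\subset H_0^1(\Omega^M(t_j))$ are the corresponding spaces of continuous piecewise linear functions vanishing on the boundary. Discrete form: for $\eta_h,\theta_h\in\mathbb V_h(D)$, $$a_h^{k,M}(\eta_h,\theta_h)=\frac{c_sk}{2}\sum_{j=-N^-}^{N^+}e^{sy_j}(w_h^M(\widetilde\eta_h,t_j),\theta_h)_D,\qquad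 w_h^M(\widetilde\eta_h,t)=\widetilde\eta_h|_{\Omega^M(t)}+v_h^M(t),$$ where $v_h^M(t)\in\mathbb V_h^M(t)$ solves $(v_h^M(t),\phi_h)_{\Omega^M(t)}+t^2d_{\Omega^M(t)}(v_h^M(t),\phi_h)=-(\widetilde\eta_h,\phi_h)_{\Omega^M(t)}$ for all $\phi_h\in\mathbb V_h^M(t)$. Constants: $c_I$ is a constant independent of $h$ with $\|v_h\|_{\widetilde H^{\delta}(D)}\le c_Ih^{s-\delta}\|v_h\|_{\widetilde H^{s}(D)}$ for all $v_h\in\mathbb V_h(D)$ (inverse inequality). $\gamma(k)=C_0e^{-2\pi\mathsf d/k}$, where $C_0$ is a constant depending only on $\delta,s,\mathsf d,D,k_0$ such that, with $N^+=\big\lceil\frac{4\pi\mathsf d}{k^2(\delta-s)}\big\rceil$ and $N^-=\big\lceil\frac{2\pi\mathsf d}{sk^2}\big\rceil$, for all $0<k\le k_0$, $|a(\eta,\theta)-a^k(\eta,\theta)|\le\gamma(k)\|\eta\|_{\widetilde H^\delta(D)}\|\theta\|_{\widetilde H^s(D)}$ for all $\eta\in\widetilde H^\delta(D)$, $\theta\in\widetilde H^s(D)$. Here $a(\eta,\theta)=\int_{\mathbb R^d}[(-\Delta)^{s/2}\widetilde\eta][(-\Delta)^{s/2}\widetilde\theta]dx$ and $a^k(\eta,\theta)=\frac{c_sk}2\sum_{j=-N^-}^{N^+}e^{sy_j}(-t_j^2\Delta(I-t_j^2\Delta)^{-1}\widetilde\eta,\theta)_D$. *)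

theory Defs
  imports "HOL-Analysis.Analysis"
begin

section \<open>Domains\<close>

text \<open>A domain is polygonal (polyhedral) if its closure is a finite union of convex polytopes.\<close>

definition polygonal_domain :: "'a::euclidean_space set \<Rightarrow> bool" where
  "polygonal_domain D \<longleftrightarrow>
     open D \<and> connected D \<and> D \<noteq> {} \<and> bounded D \<and>
     (\<exists>P. finite P \<and> (\<forall>p\<in>P. polytope p) \<and> closure D = \<Union>P)"

text \<open>Near each boundary point, in suitable orthonormal coordinates with vertical direction
  \<open>e\<close>, the set \<open>D\<close> is the strict epigraph of a Lipschitz function of the horizontal part.\<close>

definition lipschitz_boundary :: "'a::euclidean_space set \<Rightarrow> bool" where
  "lipschitz_boundary D \<longleftrightarrow>
     (\<forall>x\<in>frontier D. \<exists>e r L. \<exists>g :: 'a \<Rightarrow> real.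
        norm e = 1 \<and> 0 < r \<and> L-lipschitz_on {y. y \<bullet> e = 0} g \<and>
        (\<forall>y\<in>ball x r. y \<in> D \<longleftrightarrow> g (y - (y \<bullet> e) *\<^sub>R e) < y \<bullet> e))"

definition truncated_domain :: "'a::euclidean_space set \<Rightarrow> real \<Rightarrow> real \<Rightarrow> 'a set" where
  "truncated_domain Om M t = (\<lambda>x. (if t \<ge> 1 then 1 + t * (1 + M) else 2 + M) *\<^sub>R x) ` Om"

section \<open>Fourier multipliers and Sobolev spaces\<close>

text \<open>A function on \<open>D\<close> is represented by a function on the whole space whose values outside
  \<open>D\<close> are ignored.\<close>

definition zext :: "'a set \<Rightarrow> ('a \<Rightarrow> real) \<Rightarrow> 'a \<Rightarrow> real" where
  "zext D f = (\<lambda>x. if x \<in> D then f x else 0)"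

definition L2_inner :: "'a::euclidean_space set \<Rightarrow> ('a \<Rightarrow> real) \<Rightarrow> ('a \<Rightarrow> real) \<Rightarrow> real" where
  "L2_inner A f g = (LINT x:A|lebesgue. f x * g x)"

definition L2_function :: "('a::euclidean_space \<Rightarrow> real) \<Rightarrow> bool" where
  "L2_function f \<longleftrightarrow> f \<in> borel_measurable lebesgue \<and> integrable lebesgue (\<lambda>x. (f x)\<^sup>2)"

text \<open>Unitary normalization of the Fourier transform.\<close>

definition fourier_L1 :: "('a::euclidean_space \<Rightarrow> real) \<Rightarrow> 'a \<Rightarrow> complex" where
  "fourier_L1 f z =
     complex_of_real ((2 * pi) powr (- real DIM('a) / 2)) *
     (LINT x|lebesgue. complex_of_real (f x) * cis (- (z \<bullet> x)))"

text \<open>The Fourier-Plancherel transform on \<open>L\<^sup>2\<close>, as the \<open>L\<^sup>2\<close>-limit of the transforms of the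
  truncations of \<open>f\<close> to balls; it is unique up to null sets.\<close>

definition is_fourier :: "('a::euclidean_space \<Rightarrow> real) \<Rightarrow> ('a \<Rightarrow> complex) \<Rightarrow> bool" where
  "is_fourier f F \<longleftrightarrow>
     L2_function f \<and> F \<in> borel_measurable lebesgue \<and>
     (\<lambda>n. \<integral>\<^sup>+ z. ennreal ((norm (F z - fourier_L1 (zext (ball 0 (real n)) f) z))\<^sup>2) \<partial>lebesgue)
       \<longlonglongrightarrow> 0"

definition fourier :: "('a::euclidean_space \<Rightarrow> real) \<Rightarrow> 'a \<Rightarrow> complex" where
  "fourier f = (SOME F. is_fourier f F)"

definition fourier_multiplier ::
    "('a::euclidean_space \<Rightarrow> real) \<Rightarrow> ('a \<Rightarrow> real) \<Rightarrow> 'a \<Rightarrow> real" where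
  "fourier_multiplier m f = (SOME g. is_fourier g (\<lambda>z. complex_of_real (m z) * fourier f z))"

definition frac_laplacian :: "real \<Rightarrow> ('a::euclidean_space \<Rightarrow> real) \<Rightarrow> 'a \<Rightarrow> real" where
  "frac_laplacian \<sigma> = fourier_multiplier (\<lambda>z. norm z powr (2 * \<sigma>))"

text \<open>The operator \<open>(I - t\<^sup>2 \<Delta>)\<^sup>-\<^sup>1\<close> on the whole space.\<close>

definition resolvent :: "real \<Rightarrow> ('a::euclidean_space \<Rightarrow> real) \<Rightarrow> 'a \<Rightarrow> real" where
  "resolvent t = fourier_multiplier (\<lambda>z. 1 / (1 + t\<^sup>2 * (norm z)\<^sup>2))"

definition sobolev_energy :: "real \<Rightarrow> ('a::euclidean_space \<Rightarrow> real) \<Rightarrow> ennreal" where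
  "sobolev_energy r f =
     (\<integral>\<^sup>+ z. ennreal ((1 + (norm z)\<^sup>2) powr r * (norm (fourier f z))\<^sup>2) \<partial>lebesgue)"

definition sobolev_space :: "real \<Rightarrow> ('a::euclidean_space \<Rightarrow> real) set" where
  "sobolev_space r = {f. L2_function f \<and> sobolev_energy r f < \<infinity>}"

definition sobolev_norm :: "real \<Rightarrow> ('a::euclidean_space \<Rightarrow> real) \<Rightarrow> real" where
  "sobolev_norm r f = sqrt (enn2real (sobolev_energy r f))"

text \<open>The explicit value of the constant \<open>c\<^bsub>d,r\<^esub>\<close>, \<open>0 < r < 1\<close>, for which the principal value
  integral of \<open>(\<eta>(x) - \<eta>(y)) / |x - y|\<^bsup>d+2r\<^esup>\<close> represents the Fourier multiplier \<open>|\<zeta>|\<^bsup>2r\<^esup>\<close>.\<close>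

definition frac_const :: "nat \<Rightarrow> real \<Rightarrow> real" where
  "frac_const d r =
     4 powr r * r * Gamma (real d / 2 + r) / (pi powr (real d / 2) * Gamma (1 - r))"

definition Htilde :: "'a::euclidean_space set \<Rightarrow> real \<Rightarrow> ('a \<Rightarrow> real) set" where
  "Htilde D r = {f. zext D f \<in> sobolev_space r}"

definition Htilde_norm :: "'a::euclidean_space set \<Rightarrow> real \<Rightarrow> ('a \<Rightarrow> real) \<Rightarrow> real" where
  "Htilde_norm D r f =
     (if r < 1
      then sqrt (frac_const DIM('a) r / 2 *
             enn2real (\<integral>\<^sup>+ x. (\<integral>\<^sup>+ y.
               ennreal ((zext D f x - zext D f y)\<^sup>2 / norm (x - y) powr (real DIM('a) + 2 * r))
               \<partial>lebesgue) \<partial>lebesgue))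
      else sobolev_norm r (zext D f))"

section \<open>Finite elements\<close>

text \<open>On closed sets of full dimension, \<open>inradius\<close> is the radius of the largest ball contained
  in \<open>T\<close>.\<close>

definition inradius :: "'a::euclidean_space set \<Rightarrow> real" where
  "inradius T = Sup {r. 0 \<le> r \<and> (\<exists>x. cball x r \<subseteq> T)}"

definition simplicial_subdivision :: "'a::euclidean_space set \<Rightarrow> 'a set set \<Rightarrow> bool" where
  "simplicial_subdivision A \<T> \<longleftrightarrow>
     triangulation \<T> \<and> (\<forall>T\<in>\<T>. int DIM('a) simplex T) \<and> \<Union>\<T> = closure A"

definition fe_mesh ::
    "real \<Rightarrow> real \<Rightarrow> 'a::euclidean_space set \<Rightarrow> real \<Rightarrow> 'a set set \<Rightarrow> bool" where
  "fe_mesh \<sigma> \<rho> A h \<T> \<longleftrightarrow>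
     simplicial_subdivision A \<T> \<and>
     Max (diameter ` \<T>) = h \<and>
     (\<forall>T\<in>\<T>. diameter T / inradius T \<le> \<sigma>) \<and>
     Max (diameter ` \<T>) / Min (diameter ` \<T>) \<le> \<rho>"

text \<open>The finite element space on an open set \<open>A\<close>; its members are represented by functions that
  are zero outside \<open>A\<close>, in particular on the boundary.\<close>

definition fe_space :: "'a::euclidean_space set \<Rightarrow> 'a set set \<Rightarrow> ('a \<Rightarrow> real) set" where
  "fe_space A \<T> = {v. continuous_on (closure A) v \<and>
                      (\<forall>T\<in>\<T>. \<exists>p b. \<forall>x\<in>T. v x = p \<bullet> x + b) \<and>
                      (\<forall>x. x \<notin> A \<longrightarrow> v x = 0)}"

text \<open>The classical gradient. Piecewise linear functions are differentiable almost everywhere,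
  and there it agrees with the weak gradient of a continuous one. Integrals are taken with
  respect to the complete measure \<open>lebesgue\<close>, so that the unspecified value of \<open>THE\<close> on the
  remaining null set is harmless.\<close>

definition gradient :: "('a::euclidean_space \<Rightarrow> real) \<Rightarrow> 'a \<Rightarrow> 'a" where
  "gradient f x = (THE g. GDERIV f x :> g)"

definition dirichlet_form ::
    "'a::euclidean_space set \<Rightarrow> ('a \<Rightarrow> real) \<Rightarrow> ('a \<Rightarrow> real) \<Rightarrow> real" where
  "dirichlet_form A f g = (LINT x:A|lebesgue. gradient f x \<bullet> gradient g x)"

section \<open>Bilinear forms\<close>

definition form_a ::
    "real \<Rightarrow> 'a::euclidean_space set \<Rightarrow> ('a \<Rightarrow> real) \<Rightarrow> ('a \<Rightarrow> real) \<Rightarrow> real" where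
  "form_a s D \<eta> \<theta> =
     (LINT x|lebesgue. frac_laplacian (s / 2) (zext D \<eta>) x * frac_laplacian (s / 2) (zext D \<theta>) x)"

definition c_quad :: "real \<Rightarrow> real" where
  "c_quad s = 2 * sin (pi * s) / pi"

definition y_node :: "real \<Rightarrow> int \<Rightarrow> real" where
  "y_node k j = of_int j * k"

definition t_node :: "real \<Rightarrow> int \<Rightarrow> real" where
  "t_node k j = exp (- y_node k j / 2)"

definition N_plus :: "real \<Rightarrow> real \<Rightarrow> real \<Rightarrow> real \<Rightarrow> int" where
  "N_plus s \<delta> dd k = \<lceil>4 * pi * dd / (k\<^sup>2 * (\<delta> - s))\<rceil>"

definition N_minus :: "real \<Rightarrow> real \<Rightarrow> real \<Rightarrow> int" where
  "N_minus s dd k = \<lceil>2 * pi * dd / (s * k\<^sup>2)\<rceil>"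

definition form_ak ::
    "real \<Rightarrow> real \<Rightarrow> int \<Rightarrow> int \<Rightarrow> 'a::euclidean_space set \<Rightarrow> ('a \<Rightarrow> real) \<Rightarrow> ('a \<Rightarrow> real) \<Rightarrow> real"
  where
  "form_ak s k Nm Np D \<eta> \<theta> =
     c_quad s * k / 2 *
     (\<Sum>j\<in>{- Nm..Np}. exp (s * y_node k j) *
        L2_inner D
          (\<lambda>x. (t_node k j)\<^sup>2 * frac_laplacian 1 (resolvent (t_node k j) (zext D \<eta>)) x) \<theta>)"

definition fe_solution ::
    "'a::euclidean_space set \<Rightarrow> 'a set set \<Rightarrow> real \<Rightarrow> ('a \<Rightarrow> real) \<Rightarrow> 'a \<Rightarrow> real" where
  "fe_solution A \<T> t f =
     (THE v. v \<in> fe_space A \<T> \<and>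
        (\<forall>\<phi>\<in>fe_space A \<T>. L2_inner A v \<phi> + t\<^sup>2 * dirichlet_form A v \<phi> = - L2_inner A f \<phi>))"

text \<open>Here \<open>TO j\<close> is the mesh of the truncated domain belonging to the quadrature node \<open>t\<^sub>j\<close>.\<close>

definition form_ah ::
    "real \<Rightarrow> real \<Rightarrow> int \<Rightarrow> int \<Rightarrow> 'a::euclidean_space set \<Rightarrow> 'a set \<Rightarrow> real \<Rightarrow> (int \<Rightarrow> 'a set set) \<Rightarrow>
     ('a \<Rightarrow> real) \<Rightarrow> ('a \<Rightarrow> real) \<Rightarrow> real" where
  "form_ah s k Nm Np D Om M TO \<eta> \<theta> =
     c_quad s * k / 2 *
     (\<Sum>j\<in>{- Nm..Np}. exp (s * y_node k j) *
        L2_inner D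
          (\<lambda>x. zext D \<eta> x +
               fe_solution (truncated_domain Om M (t_node k j)) (TO j) (t_node k j) (zext D \<eta>) x)
          \<theta>)"

definition gamma_quad :: "real \<Rightarrow> real \<Rightarrow> real \<Rightarrow> real" where
  "gamma_quad C0 dd k = C0 * exp (- 2 * pi * dd / k)"

end

(* The quadrature form is a discretized interpolation norm. The node t contributes the minimum K(t)^2
   of |eta + v|^2 + t^2 |grad v|^2 over the finite element functions v, and
   |eta(. + z) - eta|^2 <= 8 K(t)^2 for |z| <= t. Cutting the Gagliardo integral
   int |z|^(-d-2s) |eta(. + z) - eta|^2 dz along the shells t_{j+1} < |z| <= t_j therefore bounds its
   middle part by the discrete form. For |z| above the largest node use
   |eta(. + z) - eta|^2 <= 4 |eta|^2 <= 16 K(1)^2, and the factor exp(-2 pi dd / k) <= k / (2 pi dd).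
   For |z| below the smallest node use |z|^2 |grad eta|^2: the smallness condition on k makes the
   smallest node at most C h, so that the elementwise inverse estimate for eta + v gives
   t^2 |grad eta|^2 <= C K(t)^2 for nodes t of that size. This yields a constant that does not degenerate
   as cI * gamma(k) * h^(s - delta) tends to 1, unlike a perturbation of the form a by its
   quadrature error. *)

theory Submission
  imports Defs "HOL-Probability.Characteristic_Functions"
begin

text \<open>A single node carries only the weight \<open>k\<close>, so each estimate must recover a
  factor \<open>k\<close>; otherwise the constant degenerates as \<open>k\<close> tends to 0. The
  shells do so by their relative thickness, about \<open>k / 2\<close>. The far part is bounded
  through the node t = 1 alone, hence by \<open>S / k\<close>, and exp(-2 pi dd / k) returns the
  lost \<open>k\<close>. The near part is spread over the nodes within a fixed factor of the
  smallest one, about \<open>b / k\<close> of them. As \<open>t_node\<close> is exp(-y / 2),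
  \<open>N_plus\<close> puts the smallest node below exp(-2 pi dd / k) to the power 1 / (\<delta> -
  s), which the smallness condition makes a multiple of h. The truncation M drops out because
  functions are extended by zero and compared on the whole space, where the gradient norm of \<eta>
  is the same for all truncated domains. \<open>cI\<close> is an arbitrary real. If it is not
  positive, the smallness condition says nothing about k; instead the inverse inequality makes the
  norm of order \<delta> vanish, and the norm of order s must be shown to vanish with it. For
  \<delta> \<ge> 1 the former is defined by the Fourier transform, and the two sections on Fourier
  analysis and Sobolev regularity serve this case.\<close>

section \<open>Preliminaries\<close>

text \<open>Induction on \<open>P\<close>: the functions in \<open>V\<close> vanishing at a point \<open>p\<close> form \<open>V\<close> itself or a
  hyperplane, and the \<open>B\<close>-orthogonal complement \<open>w\<close> of that hyperplane is normalized by \<open>w p = 1\<close>.\<close>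

lemma riesz_representation_determined_by_points:
  fixes V :: "('b \<Rightarrow> real) set" and B :: "('b \<Rightarrow> real) \<Rightarrow> ('b \<Rightarrow> real) \<Rightarrow> real"
  assumes "finite P"
    and zero: "(\<lambda>_. 0) \<in> V"
    and lin: "\<And>f g a b. f \<in> V \<Longrightarrow> g \<in> V \<Longrightarrow> (\<lambda>x. a * f x + b * g x) \<in> V"
    and det: "\<And>f. f \<in> V \<Longrightarrow> \<forall>x\<in>P. f x = 0 \<Longrightarrow> f = (\<lambda>_. 0)"
    and Blin: "\<And>f g h a b. f \<in> V \<Longrightarrow> g \<in> V \<Longrightarrow> h \<in> V \<Longrightarrow>
                 B (\<lambda>x. a * f x + b * g x) h = a * B f h + b * B g h"
    and Bsym: "\<And>f g. f \<in> V \<Longrightarrow> g \<in> V \<Longrightarrow> B f g = B g f"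
    and Bpos: "\<And>f. f \<in> V \<Longrightarrow> f \<noteq> (\<lambda>_. 0) \<Longrightarrow> B f f \<noteq> 0"
    and llin: "\<And>f g a b. f \<in> V \<Longrightarrow> g \<in> V \<Longrightarrow> l (\<lambda>x. a * f x + b * g x) = a * l f + b * l g"
  shows "\<exists>u\<in>V. \<forall>\<phi>\<in>V. B u \<phi> = l \<phi>"
  using assms
proof (induction P arbitrary: V l rule: finite_induct)
  case empty
  have V: "f = (\<lambda>_. 0)" if "f \<in> V" for f using empty.prems(3) that by blast
  have l0: "l (\<lambda>_. 0) = 0"
    using empty.prems(7)[OF empty.prems(1) empty.prems(1), of 0 0] by simp
  have B0: "B (\<lambda>_. 0) (\<lambda>_. 0) = 0"
    using empty.prems(4)[OF empty.prems(1) empty.prems(1) empty.prems(1), of 0 0] by simp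
  show ?case
  proof (intro bexI[of _ "\<lambda>_. 0"] ballI)
    fix \<phi> assume "\<phi> \<in> V"
    then have "\<phi> = (\<lambda>_. 0)" by (rule V)
    then show "B (\<lambda>_. 0) \<phi> = l \<phi>" by (simp only: l0 B0)
  qed (rule empty.prems(1))
next
  case (insert p P)
  note lin = insert.prems(2) and Blin = insert.prems(4) and Bsym = insert.prems(5)
    and Bpos = insert.prems(6) and llin = insert.prems(7)
  define V' where "V' = {f\<in>V. f p = 0}"
  have V'V: "f \<in> V" if "f \<in> V'" for f using that by (simp add: V'_def)
  have IH: "\<exists>u\<in>V'. \<forall>\<phi>\<in>V'. B u \<phi> = m \<phi>"
    if "\<And>f g a b. f \<in> V' \<Longrightarrow> g \<in> V' \<Longrightarrow> m (\<lambda>x. a * f x + b * g x) = a * m f + b * m g" for m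
    apply (rule insert.IH)
    subgoal using insert.prems(1) by (simp add: V'_def)
    subgoal using lin by (simp add: V'_def)
    subgoal using insert.prems(3) by (simp add: V'_def)
    subgoal using Blin V'V by blast
    subgoal using Bsym V'V by blast
    subgoal using Bpos V'V by blast
    subgoal using that by blast
    done
  obtain u' where u': "u' \<in> V'" "\<And>\<phi>. \<phi> \<in> V' \<Longrightarrow> B u' \<phi> = l \<phi>"
    using IH[of l] llin V'V by blast
  show ?case
  proof (cases "V' = V")
    case True then show ?thesis using u' by blast
  next
    case False
    then obtain v1 where v1: "v1 \<in> V" "v1 p \<noteq> 0" by (auto simp: V'_def)
    have BlinR: "B h (\<lambda>x. a * f x + b * g x) = a * B h f + b * B h g"
      if "f \<in> V" "g \<in> V" "h \<in> V" for f g h a b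
      using Blin[OF that] Bsym lin that by metis
    obtain q where q: "q \<in> V'" "\<And>\<phi>. \<phi> \<in> V' \<Longrightarrow> B q \<phi> = B v1 \<phi>"
      using IH[of "B v1"] BlinR V'V v1(1) by blast
    define w where "w = (\<lambda>x. (1 / v1 p) * v1 x + (- 1 / v1 p) * q x)"
    have wV: "w \<in> V" unfolding w_def using lin v1 q V'V by blast
    have wp: "w p = 1" using v1 q by (simp add: w_def V'_def)
    have worth: "B w \<phi> = 0" if "\<phi> \<in> V'" for \<phi>
      unfolding w_def using Blin[OF v1(1) V'V[OF q(1)] V'V[OF that], of "1 / v1 p" "- 1 / v1 p"]
        q(2)[OF that] by (simp add: field_simps)
    have ww: "B w w \<noteq> 0" using Bpos[OF wV] wp by (metis zero_neq_one)
    define u where "u = (\<lambda>x. 1 * u' x + (l w / B w w) * w x)"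
    have uV: "u \<in> V" unfolding u_def using lin u'(1) wV V'V by blast
    have "B u \<phi> = l \<phi>" if "\<phi> \<in> V" for \<phi>
    proof -
      define \<psi> where "\<psi> = (\<lambda>x. 1 * \<phi> x + (- \<phi> p) * w x)"
      have \<psi>V: "\<psi> \<in> V" unfolding \<psi>_def using lin that wV by blast
      have \<psi>: "\<psi> \<in> V'" using \<psi>V wp by (simp add: V'_def \<psi>_def)
      have \<phi>: "\<phi> = (\<lambda>x. 1 * \<psi> x + \<phi> p * w x)" by (auto simp: \<psi>_def)
      have lphi: "l \<phi> = l \<psi> + \<phi> p * l w"
        using trans[OF arg_cong[OF \<phi>, where f=l] llin[OF \<psi>V wV]] by simp
      have 1: "B u \<phi> = B u \<psi> + \<phi> p * B u w"
        using trans[OF arg_cong[OF \<phi>, where f="B u"] BlinR[OF \<psi>V wV uV]] by simp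
      have 2: "B u h = B u' h + (l w / B w w) * B w h" if "h \<in> V" for h
        unfolding u_def using Blin[OF V'V[OF u'(1)] wV that, of 1 "l w / B w w"] by simp
      have "B u' w = 0" using Bsym[OF V'V[OF u'(1)] wV] worth[OF u'(1)] by simp
      then show ?thesis using 1 2[OF \<psi>V] 2[OF wV] worth[OF \<psi>] u'(2)[OF \<psi>] lphi ww by simp
    qed
    then show ?thesis using uV by blast
  qed
qed

section \<open>Translation invariance of Lebesgue measure\<close>

lemma nn_integral_lborel_translate:
  fixes a :: "'a::euclidean_space"
  assumes [measurable]: "f \<in> borel_measurable borel"
  shows "(\<integral>\<^sup>+x. f (x + a) \<partial>lborel) = (\<integral>\<^sup>+x. f x \<partial>lborel)"
proof -
  have "(\<integral>\<^sup>+x. f x \<partial>lborel) = (\<integral>\<^sup>+x. f x \<partial>distr lborel borel ((+) a))"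
    by (simp add: lborel_distr_plus)
  also have "\<dots> = (\<integral>\<^sup>+x. f (a + x) \<partial>lborel)" by (subst nn_integral_distr) auto
  finally show ?thesis by (simp add: add.commute)
qed

lemma integral_lborel_translate:
  fixes a :: "'a::euclidean_space" and f :: "'a \<Rightarrow> 'b::{banach, second_countable_topology}"
  assumes [measurable]: "f \<in> borel_measurable borel"
  shows "(LINT x|lborel. f (x + a)) = (LINT x|lborel. f x)"
proof -
  have "(LINT x|lborel. f x) = (LINT x|distr lborel borel ((+) a). f x)"
    by (simp add: lborel_distr_plus)
  also have "\<dots> = (LINT x|lborel. f (a + x))" by (subst integral_distr) auto
  finally show ?thesis by (simp add: add.commute)
qed

lemma integrable_lborel_translate:
  fixes a :: "'a::euclidean_space" and f :: "'a \<Rightarrow> 'b::{banach, second_countable_topology}"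
  assumes "integrable lborel f"
  shows "integrable lborel (\<lambda>x. f (x + a))"
proof -
  have "integrable (distr lborel borel ((+) a)) f" using assms by (simp add: lborel_distr_plus)
  then have "integrable lborel (\<lambda>x. f (a + x))" by (rule integrable_distr[rotated]) auto
  then show ?thesis by (simp add: add.commute)
qed

text \<open>The point is the convex combination, with weights \<open>1 - l\<close> and
  \<open>l\<close>, of \<open>y\<close> and \<open>x0 + (1 / l) *\<^sub>R w\<close>; the bound on
  \<open>w\<close> keeps the latter in the ball.\<close>

lemma convex_shrink_translate_mem:
  fixes T :: "'a::real_normed_vector set"
  assumes "convex T" "cball x0 r \<subseteq> T" "0 < r" "norm w \<le> l * r" "0 < l" "l \<le> 1" "y \<in> T"
  shows "(1 - l) *\<^sub>R y + l *\<^sub>R x0 + w \<in> T"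
proof -
  have "norm ((1 / l) *\<^sub>R w) \<le> r" using assms by (simp add: field_simps)
  then have "x0 + (1 / l) *\<^sub>R w \<in> cball x0 r" by (simp add: dist_norm)
  then have "x0 + (1 / l) *\<^sub>R w \<in> T" using assms by blast
  then have "(1 - l) *\<^sub>R y + l *\<^sub>R (x0 + (1 / l) *\<^sub>R w) \<in> T"
    using assms by (intro convexD) auto
  then show ?thesis using assms by (simp add: algebra_simps)
qed

lemma measure_shrink:
  fixes T :: "'a::euclidean_space set"
  assumes "l \<le> 1"
  shows "measure lebesgue ((\<lambda>y. (1 - l) *\<^sub>R y + l *\<^sub>R x0) ` T) = (1 - l) ^ DIM('a) * measure lebesgue T"
  using measure_lebesgue_affine[of "1 - l" "l *\<^sub>R x0" T] assms by (simp add: add.commute)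

lemma Collect_translate_notin:
  fixes T :: "'a::ab_group_add set"
  shows "{x \<in> T. x + w \<notin> T} = T - (\<lambda>x. x + (-w)) ` T"
proof -
  have "x + w \<in> T \<longleftrightarrow> x \<in> (\<lambda>x. x + (-w)) ` T" for x
    by (auto intro!: image_eqI[where x="x + w"])
  then show ?thesis by auto
qed

text \<open>With \<open>l = norm w / r\<close>, the shrunk copy \<open>(1 - l) T + l x\<^sub>0\<close> stays in \<open>T\<close> when it is
  translated by \<open>w\<close>.\<close>

lemma measure_convex_Diff_translate_le:
  fixes T :: "'a::euclidean_space set"
  assumes T: "convex T" "compact T" and r: "cball x0 r \<subseteq> T" "0 < r"
  shows "measure lborel {x \<in> T. x + w \<notin> T} \<le> DIM('a) * norm w / r * measure lborel T"
proof (cases "norm w \<le> r")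
  \<comment> \<open>For shifts longer than \<open>r\<close> the factor in front of the measure of
    \<open>T\<close> is at least 1.\<close>
  case False
  have "{x \<in> T. x + w \<notin> T} = T - (\<lambda>x. x + (-w)) ` T"
    by (rule Collect_translate_notin)
  moreover have "compact ((\<lambda>x. x + (-w)) ` T)" by (intro compact_continuous_image continuous_intros T)
  ultimately have m: "{x \<in> T. x + w \<notin> T} \<in> sets borel"
    using T by (simp add: borel_compact[unfolded sets_lborel] sets.Diff del: add_uminus_conv_diff)
  have "measure lborel {x \<in> T. x + w \<notin> T} \<le> measure lborel T"
    by (rule measure_mono_fmeasurable) (use T m in \<open>auto intro: fmeasurable_compact\<close>)
  also have "\<dots> \<le> DIM('a) * norm w / r * measure lborel T"
  proof -
    have "1 * 1 \<le> DIM('a) * (norm w / r)" using False r DIM_positive[where 'a='a]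
      by (intro mult_mono) (auto simp: field_simps Suc_le_eq)
    then have "1 * measure lborel T \<le> (DIM('a) * (norm w / r)) * measure lborel T"
      by (intro mult_right_mono) auto
    then show ?thesis by simp
  qed
  finally show ?thesis .
next
  case True
  show ?thesis
  proof (cases "w = 0")
    case True then show ?thesis by (simp add: set_eq_iff cong: conj_cong)
  next
    case False
    define l where "l = norm w / r"
    have l: "0 < l" "l \<le> 1" "norm w \<le> l * r" using True False r by (auto simp: l_def field_simps)
    define S where "S = (\<lambda>y. (1 - l) *\<^sub>R y + l *\<^sub>R x0) ` T"
    have cS: "compact S" unfolding S_def by (intro compact_continuous_image continuous_intros T)
    have "S \<subseteq> T" using convex_shrink_translate_mem[OF T(1) r, of 0 l] l r by (auto simp: S_def)
    moreover have "x + w \<in> T" if "x \<in> S" for x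
      using convex_shrink_translate_mem[OF T(1) r, of w l] l that by (auto simp: S_def)
    ultimately have sub: "{x \<in> T. x + w \<notin> T} \<subseteq> T - S" by auto
    have eq: "{x \<in> T. x + w \<notin> T} = T - (\<lambda>x. x + (-w)) ` T"
      by (rule Collect_translate_notin)
    have c2: "compact ((\<lambda>x. x + (-w)) ` T)" by (intro compact_continuous_image continuous_intros T)
    have "measure lborel {x \<in> T. x + w \<notin> T} \<le> measure lborel (T - S)"
      by (rule measure_mono_fmeasurable[OF sub])
        (use T cS c2 eq in \<open>simp_all add: borel_compact[unfolded sets_lborel] sets.Diff fmeasurable_compact
            fmeasurable_Diff del: add_uminus_conv_diff\<close>)
    also have "\<dots> = measure lborel T - measure lborel S"
      using \<open>S \<subseteq> T\<close> T cS by (intro measurable_measure_Diff) (auto intro: fmeasurable_compact borel_compact)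
    also have "measure lborel S = (1 - l) ^ DIM('a) * measure lborel T"
      using measure_shrink[of l x0 T] l cS T by (simp add: S_def borel_compact)
    also have "measure lborel T - (1 - l) ^ DIM('a) * measure lborel T \<le> DIM('a) * l * measure lborel T"
    proof -
      \<comment> \<open>Bernoulli's inequality makes the lost volume linear in \<open>l\<close>,
        hence in the length of the shift.\<close>
      have "1 - DIM('a) * l \<le> (1 - l) ^ DIM('a)"
        using Bernoulli_inequality[of "-l" "DIM('a)"] l by simp
      then have "(1 - (1 - l) ^ DIM('a)) * measure lborel T \<le> (DIM('a) * l) * measure lborel T"
        by (intro mult_right_mono) auto
      then show ?thesis by (simp add: algebra_simps)
    qed
    finally show ?thesis by (simp add: l_def)
  qed
qed

lemma affine_inverse_estimate:
  fixes T :: "'a::euclidean_space set" and g :: 'a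
  assumes T: "convex T" "compact T" and r: "cball x0 r \<subseteq> T" "0 < r"
  shows "r\<^sup>2 * (norm g)\<^sup>2 * measure lborel T \<le>
           16 * 2 ^ DIM('a) * (LINT x|lborel. indicator T x * (g \<bullet> x + b)\<^sup>2)"
proof (cases "g = 0")
  case True then show ?thesis by (auto intro!: integral_nonneg_AE)
next
  case False
  \<comment> \<open>On the copy of \<open>T\<close> shrunk by \<open>1/2\<close>, compare the values at \<open>x\<close> and at \<open>x + w\<close>, where \<open>w\<close> is
    parallel to \<open>g\<close> and has length \<open>r / 2\<close>.\<close>
  define p where "p x = g \<bullet> x + b" for x
  define w where "w = (r / 2 / norm g) *\<^sub>R g"
  have nw: "norm w \<le> 1 / 2 * r" using False r by (simp add: w_def)
  define S where "S = (\<lambda>y. (1 - 1/2) *\<^sub>R y + (1/2) *\<^sub>R x0) ` T"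
  have cS: "compact S" unfolding S_def by (intro compact_continuous_image continuous_intros T)
  have ST: "S \<subseteq> T" using convex_shrink_translate_mem[OF T(1) r, of 0 "1/2"] r by (auto simp: S_def)
  have SwT: "x + w \<in> T" if "x \<in> S" for x
    using convex_shrink_translate_mem[OF T(1) r nw] that by (auto simp: S_def)
  have mS: "measure lborel S = measure lborel T / 2 ^ DIM('a)"
    using measure_shrink[of "1/2" x0 T] cS T by (simp add: S_def borel_compact field_simps)
  have [measurable]: "T \<in> sets borel" "S \<in> sets borel" using T cS by (auto intro: borel_compact)
  have [measurable]: "p \<in> borel_measurable borel" unfolding p_def by measurable
  have contp: "continuous_on T (\<lambda>x. (p x)\<^sup>2)" unfolding p_def by (intro continuous_intros)
  have intT: "integrable lborel (\<lambda>x. indicator T x * (p x)\<^sup>2)"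
    using borel_integrable_compact[OF T(2) contp] by (simp add: indicator_def if_distrib cong: if_cong)
  have key: "(r * norm g / 2)\<^sup>2 / 2 * indicator S x \<le>
     indicator T x * (p x)\<^sup>2 + indicator T (x + w) * (p (x + w))\<^sup>2" for x
  proof (cases "x \<in> S")
    case True
    have "g \<bullet> w = r * norm g / 2" using False by (simp add: w_def dot_square_norm power2_eq_square)
    then have "p (x + w) - p x = r * norm g / 2" by (simp add: p_def inner_add_right)
    then have "(r * norm g / 2)\<^sup>2 = (p (x + w) - p x)\<^sup>2" by (simp only:)
    also have "\<dots> \<le> 2 * ((p x)\<^sup>2 + (p (x + w))\<^sup>2)"
      using sum_squares_bound[of "p (x+w)" "- p x"] by (auto simp: power2_diff)
    finally have "(r * norm g / 2)\<^sup>2 \<le> 2 * ((p x)\<^sup>2 + (p (x + w))\<^sup>2)" .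
    then show ?thesis using True ST SwT by auto
  qed auto
  have "(LINT x|lborel. (r * norm g / 2)\<^sup>2 / 2 * indicator S x) \<le>
        (LINT x|lborel. indicator T x * (p x)\<^sup>2 + indicator T (x + w) * (p (x + w))\<^sup>2)"
    using integrable_lborel_translate[OF intT, of w] intT key emeasure_compact_finite[OF cS]
    by (intro integral_mono integrable_mult_right) simp_all
  also have "\<dots> = 2 * (LINT x|lborel. indicator T x * (p x)\<^sup>2)"
    using integrable_lborel_translate[OF intT, of w] intT
      integral_lborel_translate[of "\<lambda>x. indicator T x * (p x)\<^sup>2" w]
    by (subst Bochner_Integration.integral_add) auto
  finally have "(r * norm g / 2)\<^sup>2 / 2 * measure lborel S \<le> 2 * (LINT x|lborel. indicator T x * (p x)\<^sup>2)"
    using cS by simp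
  \<comment> \<open>The left side is r^2 |g|^2 / 8 times the measure of \<open>T\<close> over 2^d;
    clearing denominators gives 16 * 2^d.\<close>
  then show ?thesis unfolding mS p_def[symmetric] by (simp add: field_simps power2_eq_square)
qed

abbreviation norm2_sq :: "('a::euclidean_space \<Rightarrow> real) \<Rightarrow> real" where
  "norm2_sq v \<equiv> LINT x|lborel. (v x)\<^sup>2"

lemma continuous_compact_support_integrable:
  fixes f :: "'a::euclidean_space \<Rightarrow> real"
  assumes "continuous_on UNIV f" "compact K" "\<And>x. x \<notin> K \<Longrightarrow> f x = 0"
  shows "integrable lborel f"
proof -
  have "integrable lborel (\<lambda>x. indicator K x *\<^sub>R f x)"
    by (intro borel_integrable_compact[OF assms(2)] continuous_on_subset[OF assms(1)]) simp
  moreover have "(\<lambda>x. indicator K x *\<^sub>R f x) = f" using assms(3) by (force simp: indicator_def)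
  ultimately show ?thesis by simp
qed

lemma gradient_eqI:
  assumes "GDERIV f x :> g"
  shows "gradient f x = g"
  unfolding gradient_def
proof (rule the_equality)
  fix g' assume "GDERIV f x :> g'"
  then have "(\<lambda>h. h \<bullet> g') = (\<lambda>h. h \<bullet> g)"
    using assms has_derivative_unique unfolding gderiv_def by blast
  then show "g' = g" by (metis inner_commute vector_eq_rdot)
qed (rule assms)

lemma affine_eq_on_interior:
  fixes p q :: "'a::euclidean_space"
  assumes "interior T \<noteq> {}" and eq: "\<And>x. x \<in> T \<Longrightarrow> p \<bullet> x + b = q \<bullet> x + c"
  shows "p = q"
proof -
  obtain x where "x \<in> interior T" using assms by blast
  then obtain e where e: "e > 0" "cball x e \<subseteq> T" by (meson mem_interior_cball)
  \<comment> \<open>The added 1 keeps the quotient defined when \<open>p = q\<close>.\<close>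
  define c where "c = e / (norm (p - q) + 1)"
  have c: "0 < c" using e by (simp add: c_def add_nonneg_pos)
  define u where "u = c *\<^sub>R (p - q)"
  have "c * norm (p - q) \<le> e" using e by (simp add: c_def divide_le_eq add_nonneg_pos)
  then have "norm u \<le> e" using c by (simp add: u_def)
  then have "x + u \<in> T" "x \<in> T" using e by (auto simp: dist_norm)
  then have "(p - q) \<bullet> u = 0" using eq[of x] eq[of "x + u"] by (simp add: algebra_simps)
  then show ?thesis using c by (simp add: u_def)
qed

section \<open>Finite element functions\<close>

text \<open>The gradient of the affine piece on \<open>T\<close>. The choice is unique once
  \<open>T\<close> has interior points, and only then is \<open>slope\<close> linear in
  \<open>v\<close>.\<close>

definition slope :: "('a::euclidean_space \<Rightarrow> real) \<Rightarrow> 'a set \<Rightarrow> 'a" where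
  "slope v T = (SOME p. \<exists>b. \<forall>x\<in>T. v x = p \<bullet> x + b)"

lemma slopeE:
  assumes "\<exists>p b. \<forall>x\<in>T. v x = p \<bullet> x + b"
  obtains b where "\<And>x. x \<in> T \<Longrightarrow> v x = slope v T \<bullet> x + b"
  using someI_ex[OF assms] that unfolding slope_def by blast

lemma slope_eqI:
  assumes "interior T \<noteq> {}" "\<And>x. x \<in> T \<Longrightarrow> v x = p \<bullet> x + b"
  shows "slope v T = p"
proof -
  obtain c where "\<And>x. x \<in> T \<Longrightarrow> v x = slope v T \<bullet> x + c"
    using slopeE[of T v] assms(2) by blast
  then show ?thesis using affine_eq_on_interior[OF assms(1)] assms(2) by metis
qed

lemma fe_space_continuous:
  assumes "open A" "v \<in> fe_space A TT"
  shows "continuous_on UNIV v"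
proof -
  have "continuous_on (closure A \<union> - A) v"
  proof (rule continuous_on_closed_Un)
    show "continuous_on (- A) v" using assms(2)
      by (subst continuous_on_cong[of _ "-A" _ "\<lambda>_. 0"]) (auto simp: fe_space_def)
  qed (use assms in \<open>auto simp: fe_space_def\<close>)
  moreover have "closure A \<union> - A = UNIV" using closure_subset by auto
  ultimately show ?thesis by simp
qed

text \<open>The facts about a meshed domain on which the integration below rests. It is instantiated
  by the truncated domains, where convexity makes the frontier null; functions on \<open>D\<close>
  are regarded as functions on these.\<close>

locale fe_domain =
  fixes A :: "'a::euclidean_space set" and TT :: "'a set set"
  assumes open_A: "open A" and bounded_A: "bounded A"
    and null_frontier: "negligible (frontier A)"
    and finite_TT: "finite TT" and Union_TT: "\<Union>TT = closure A"
    and hull_TT: "\<And>T. T \<in> TT \<Longrightarrow> \<exists>C. finite C \<and> T = convex hull C"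
    and interior_TT: "\<And>T. T \<in> TT \<Longrightarrow> interior T \<noteq> {}"
    and disjoint_TT: "\<And>T T'. T \<in> TT \<Longrightarrow> T' \<in> TT \<Longrightarrow> T \<noteq> T' \<Longrightarrow> interior T \<inter> interior T' = {}"
begin

lemma TT_convex: "T \<in> TT \<Longrightarrow> convex T" using hull_TT convex_convex_hull by metis

lemma TT_compact: "T \<in> TT \<Longrightarrow> compact T"
  using hull_TT finite_imp_compact_convex_hull by metis

lemma compact_closure_A: "compact (closure A)" using bounded_A by simp

lemma TT_subset: "T \<in> TT \<Longrightarrow> T \<subseteq> closure A" using Union_TT by blast

abbreviation "V \<equiv> fe_space A TT"

lemma V_zero: "v \<in> V \<Longrightarrow> x \<notin> A \<Longrightarrow> v x = 0" by (simp add: fe_space_def)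

lemma V_affine: "v \<in> V \<Longrightarrow> T \<in> TT \<Longrightarrow> \<exists>p b. \<forall>x\<in>T. v x = p \<bullet> x + b"
  by (simp add: fe_space_def)

lemma V_lin:
  assumes "v \<in> V" "w \<in> V"
  shows "(\<lambda>x. a * v x + b * w x) \<in> V"
proof -
  have "\<exists>p c. \<forall>x\<in>T. a * v x + b * w x = p \<bullet> x + c" if T: "T \<in> TT" for T
  proof -
    obtain p c where "\<forall>x\<in>T. v x = p \<bullet> x + c" using V_affine[OF assms(1) T] by blast
    moreover obtain p' c' where "\<forall>x\<in>T. w x = p' \<bullet> x + c'" using V_affine[OF assms(2) T] by blast
    ultimately
    show ?thesis
      by (intro exI[of _ "a *\<^sub>R p + b *\<^sub>R p'"] exI[of _ "a * c + b * c'"]) (simp add: algebra_simps)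
  qed
  then show ?thesis using assms by (simp add: fe_space_def continuous_on_add continuous_on_mult_left)
qed

lemma V_const0: "(\<lambda>_. 0) \<in> V"
proof -
  have "\<exists>p b. \<forall>x\<in>T. 0 = p \<bullet> x + b" for T :: "'a set"
    by (intro exI[of _ 0]) simp
  then show ?thesis by (simp add: fe_space_def)
qed

lemma V_add: "v \<in> V \<Longrightarrow> w \<in> V \<Longrightarrow> (\<lambda>x. v x + w x) \<in> V"
  using V_lin[of v w 1 1] by simp

lemma V_continuous: "v \<in> V \<Longrightarrow> continuous_on UNIV v"
  by (rule fe_space_continuous[OF open_A])

lemma V_measurable [measurable]: "v \<in> V \<Longrightarrow> v \<in> borel_measurable borel"
  using V_continuous borel_measurable_continuous_onI by blast

lemma V_slope:
  assumes "v \<in> V" "T \<in> TT"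
  obtains b where "\<And>x. x \<in> T \<Longrightarrow> v x = slope v T \<bullet> x + b"
  using slopeE[of T v] assms unfolding fe_space_def by blast

lemma slope_lin:
  assumes "v \<in> V" "w \<in> V" "T \<in> TT"
  shows "slope (\<lambda>x. a * v x + b * w x) T = a *\<^sub>R slope v T + b *\<^sub>R slope w T"
proof -
  obtain c where c: "\<And>x. x \<in> T \<Longrightarrow> v x = slope v T \<bullet> x + c" using V_slope assms by blast
  obtain d where d: "\<And>x. x \<in> T \<Longrightarrow> w x = slope w T \<bullet> x + d" using V_slope assms by blast
  show ?thesis
    by (rule slope_eqI[where b="a * c + b * d", OF interior_TT[OF assms(3)]]) (simp add: c d algebra_simps)
qed

lemma V_GDERIV:
  assumes "v \<in> V" "T \<in> TT" "x \<in> interior T"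
  shows "GDERIV v x :> slope v T"
proof -
  obtain b where b: "\<And>x. x \<in> T \<Longrightarrow> v x = slope v T \<bullet> x + b" using V_slope assms by blast
  have "((\<lambda>x. slope v T \<bullet> x + b) has_derivative (\<lambda>h. slope v T \<bullet> h)) (at x)"
    by (auto intro!: derivative_eq_intros)
  then have "(v has_derivative (\<lambda>h. slope v T \<bullet> h)) (at x)"
    by (rule has_derivative_transform_within_open[OF _ open_interior assms(3)])
      (use b interior_subset in fastforce)
  then show ?thesis by (simp add: gderiv_def inner_commute)
qed

lemma V_GDERIV_outside:
  assumes "v \<in> V" "x \<notin> closure A"
  shows "GDERIV v x :> 0"
proof -
  have "((\<lambda>x. 0 :: real) has_derivative (\<lambda>h. 0)) (at x)" by simp
  moreover have "open (- closure A)" "x \<in> - closure A" using assms by auto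
  ultimately have "(v has_derivative (\<lambda>h. 0)) (at x)"
    by (rule has_derivative_transform_within_open)
      (use V_zero[OF assms(1)] closure_subset in fastforce)
  then show ?thesis by (simp add: gderiv_def)
qed

text \<open>Finitely many frontiers of convex sets form a null set. Off this set, integrands made of
  classical gradients can be evaluated element by element.\<close>

lemma AE_interior:
  "AE x in lborel. x \<notin> frontier A \<and> (\<forall>T\<in>TT. x \<in> T \<longrightarrow> x \<in> interior T) \<and>
     (x \<in> closure A \<longrightarrow> (\<exists>T\<in>TT. x \<in> interior T))"
proof -
  have "negligible (\<Union>T\<in>TT. frontier T)"
    by (intro negligible_Union) (use finite_TT TT_convex negligible_convex_frontier in auto)
  then have "AE x in lebesgue. x \<notin> (\<Union>T\<in>TT. frontier T)"
    unfolding negligible_iff_null_sets by (rule AE_not_in)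
  moreover have "AE x in lebesgue. x \<notin> frontier A"
    using null_frontier by (simp add: negligible_iff_null_sets AE_not_in)
  ultimately have "AE x in lebesgue. x \<notin> frontier A \<and> (\<forall>T\<in>TT. x \<in> T \<longrightarrow> x \<in> interior T) \<and>
     (x \<in> closure A \<longrightarrow> (\<exists>T\<in>TT. x \<in> interior T))"
  proof eventually_elim
    case (elim x)
    have *: "x \<in> interior T" if T: "T \<in> TT" "x \<in> T" for T
    proof -
      have "x \<in> closure T" using T(2) closure_subset by (rule subsetD[rotated])
      moreover have "x \<notin> frontier T" using elim(1) T(1) by simp
      ultimately show ?thesis by (simp add: frontier_def)
    qed
    moreover have "\<exists>T\<in>TT. x \<in> interior T" if "x \<in> closure A"
    proof -
      have "x \<in> \<Union>TT" using that Union_TT by simp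
      then obtain T where "T \<in> TT" "x \<in> T" by (elim UnionE)
      then show ?thesis using * by (intro bexI[of _ T])
    qed
    ultimately show ?case using elim(2) by simp
  qed
  then show ?thesis by (simp add: AE_completion_iff)
qed

text \<open>Any \<open>B\<close> above \<open>A\<close> gives the same value, because gradients
  vanish outside the closure of \<open>A\<close> and the frontier is null. The case
  \<open>B = UNIV\<close> is what makes the energy independent of the mesh representing a
  function.\<close>

lemma dirichlet_eq_sum:
  assumes "v \<in> V" "w \<in> V" "A \<subseteq> B" "B \<in> sets lebesgue"
  shows "dirichlet_form B v w = (\<Sum>T\<in>TT. measure lborel T * (slope v T \<bullet> slope w T))"
proof -
  let ?g = "\<lambda>x. \<Sum>T\<in>TT. indicator (interior T) x * (slope v T \<bullet> slope w T)"
  have m: "measure lborel (interior T) = measure lborel T" if "T \<in> TT" for T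
  proof -
    have "measure lebesgue (interior T) = measure lebesgue T"
      by (rule measure_interior)
        (use that TT_compact TT_convex negligible_convex_frontier compact_imp_bounded in auto)
    then show ?thesis using TT_compact[OF that] by (simp add: borel_compact)
  qed
  have int: "integrable lebesgue (\<lambda>x. indicator (interior T) x * (slope v T \<bullet> slope w T))" if "T \<in> TT" for T
  proof -
    have "emeasure lborel (interior T) < \<infinity>"
      by (intro emeasure_bounded_finite) (use that TT_compact compact_imp_bounded bounded_interior in blast)
    then show ?thesis
      by (intro integrable_mult_left) (auto simp: integrable_indicator_iff)
  qed
  have ae: "AE x in lebesgue. ?g x = indicator B x *\<^sub>R (gradient v x \<bullet> gradient w x)"
    using AE_completion[OF AE_interior]
  proof eventually_elim
    case (elim x)
    show ?case
    proof (cases "x \<in> closure A")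
      case True
      then obtain T where T: "T \<in> TT" "x \<in> interior T" using elim by blast
      have "x \<in> A" using True elim open_A by (auto simp: frontier_def interior_open)
      have "?g x = (\<Sum>T'\<in>TT. if T' = T then slope v T \<bullet> slope w T else 0)"
        by (rule sum.cong) (use T disjoint_TT in \<open>auto simp: indicator_def\<close>)
      also have "\<dots> = slope v T \<bullet> slope w T" using T finite_TT by simp
      also have "\<dots> = gradient v x \<bullet> gradient w x"
        using gradient_eqI[OF V_GDERIV[OF assms(1) T]] gradient_eqI[OF V_GDERIV[OF assms(2) T]] by simp
      finally show ?thesis using \<open>x \<in> A\<close> assms by auto
    next
      case False
      then have "x \<notin> interior T" if "T \<in> TT" for T using TT_subset[OF that] interior_subset by blast
      then have "?g x = 0" by (intro sum.neutral) auto
      then show ?thesis using gradient_eqI[OF V_GDERIV_outside[OF assms(1) False]] by simp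
    qed
  qed
  have gm: "?g \<in> borel_measurable lebesgue"
    using int by (intro borel_measurable_integrable Bochner_Integration.integrable_sum) auto
  have "dirichlet_form B v w = (LINT x|lebesgue. indicator B x *\<^sub>R (gradient v x \<bullet> gradient w x))"
    by (simp add: dirichlet_form_def set_lebesgue_integral_def)
  also have "\<dots> = (LINT x|lebesgue. ?g x)"
    by (rule integral_cong_AE[symmetric, OF gm borel_measurable_AE[OF gm ae] ae])
  also have "\<dots> = (\<Sum>T\<in>TT. LINT x|lebesgue. indicator (interior T) x * (slope v T \<bullet> slope w T))"
    by (rule Bochner_Integration.integral_sum) (rule int)
  also have "\<dots> = (\<Sum>T\<in>TT. measure lborel T * (slope v T \<bullet> slope w T))"
    by (intro sum.cong refl) (simp add: m)
  finally show ?thesis .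
qed

text \<open>Two points may lie in different elements, so the elementwise constants are joined along
  the segment between them: the preimages of the elements and of the complement of \<open>A\<close>
  are finitely many closed sets covering the unit interval, and a function Lipschitz on each of them
  is Lipschitz on the interval.\<close>

lemma V_Lipschitz:
  assumes "v \<in> V"
  obtains L where "0 \<le> L" "\<And>x y. \<bar>v x - v y\<bar> \<le> L * norm (x - y)"
proof -
  define L where "L = (\<Sum>T\<in>TT. norm (slope v T))"
  have L0: "0 \<le> L" by (simp add: L_def sum_nonneg)
  have lipT: "L-lipschitz_on T v" if T: "T \<in> TT" for T
  proof (rule lipschitz_onI[OF _ L0])
    fix x y assume xy: "x \<in> T" "y \<in> T"
    obtain b where b: "\<And>x. x \<in> T \<Longrightarrow> v x = slope v T \<bullet> x + b" using V_slope assms T by blast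
    have "dist (v x) (v y) = \<bar>slope v T \<bullet> (x - y)\<bar>" using b xy by (simp add: dist_real_def inner_diff_right)
    also have "\<dots> \<le> norm (slope v T) * norm (x - y)" by (rule Cauchy_Schwarz_ineq2)
    also have "\<dots> \<le> L * norm (x - y)" unfolding L_def
      by (intro mult_right_mono member_le_sum) (use T finite_TT in auto)
    finally show "dist (v x) (v y) \<le> L * dist x y" by (simp add: dist_norm)
  qed
  have lipA: "L-lipschitz_on (- A) v"
    using V_zero[OF assms] L0 by (intro lipschitz_onI) auto
  have "\<bar>v x - v y\<bar> \<le> L * norm (x - y)" for x y
  proof -
    define g where "g t = x + t *\<^sub>R (y - x)" for t :: real
    define U where "U i = g -` i" for i
    have cg: "continuous_on UNIV g" unfolding g_def by (intro continuous_intros)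
    have glip: "(norm (y - x))-lipschitz_on S g" for S
      by (intro lipschitz_onI) (simp_all add: g_def dist_norm mult.commute flip: scaleR_left_diff_distrib)
    have "(L * norm (y - x))-lipschitz_on {0..1} (v \<circ> g)"
    proof (rule lipschitz_on_closed_Union[where I="insert (-A) TT" and U=U])
      fix i assume i: "i \<in> insert (- A) TT"
      then have "L-lipschitz_on i v" "closed i"
        using lipA lipT open_A TT_compact compact_imp_closed by auto
      then have "L-lipschitz_on (g ` U i) v"
        by (auto simp: U_def intro: lipschitz_on_subset)
      then show "(L * norm (y - x))-lipschitz_on (U i) (v \<circ> g)"
        by (rule lipschitz_on_compose[OF glip])
      show "closed (U i)" unfolding U_def
        using continuous_closed_vimage[OF \<open>closed i\<close>, of g] cg by (simp add: continuous_on_eq_continuous_at)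
    next
      show "{0..1} \<subseteq> (\<Union>i\<in>insert (- A) TT. U i)"
        using Union_TT closure_subset by (fastforce simp: U_def)
    qed (use finite_TT L0 in auto)
    from lipschitz_onD[OF this, of 0 1]
    show ?thesis by (simp add: g_def dist_real_def norm_minus_commute)
  qed
  then show ?thesis using that L0 by blast
qed

text \<open>An affine function that vanishes at the vertices of a polytope vanishes on it. This
  provides the finite point set of \<open>riesz_representation_determined_by_points\<close> and
  replaces a nodal basis.\<close>

lemma V_determined_by_vertices:
  "\<exists>P. finite P \<and> (\<forall>v\<in>V. (\<forall>x\<in>P. v x = 0) \<longrightarrow> v = (\<lambda>_. 0))"
proof -
  obtain C where C: "\<And>T. T \<in> TT \<Longrightarrow> finite (C T) \<and> T = convex hull (C T)"
    using hull_TT by metis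
  have "v = (\<lambda>_. 0)" if v: "v \<in> V" "\<forall>x\<in>(\<Union>T\<in>TT. C T). v x = 0" for v
  proof
    fix x show "v x = 0"
    proof (cases "x \<in> A")
      case True
      then obtain T where T: "T \<in> TT" "x \<in> T" using Union_TT closure_subset by blast
      obtain b where b: "\<And>x. x \<in> T \<Longrightarrow> v x = slope v T \<bullet> x + b" using V_slope v T by blast
      have "C T \<subseteq> T" using C[OF T(1)] hull_subset by metis
      then have "C T \<subseteq> {x. slope v T \<bullet> x = - b}" using b v T by fastforce
      then have "convex hull (C T) \<subseteq> {x. slope v T \<bullet> x = - b}"
        by (rule hull_minimal) (rule convex_hyperplane)
      then show ?thesis using C[OF T(1)] T(2) b by auto
    qed (use V_zero v in auto)
  qed
  then show ?thesis using finite_TT C by (intro exI[of _ "\<Union>T\<in>TT. C T"]) auto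
qed

lemma V_integrable_mult:
  assumes "v \<in> V" "w \<in> V"
  shows "integrable lborel (\<lambda>x. v x * w x)"
proof (rule continuous_compact_support_integrable[OF _ compact_closure_A])
  show "continuous_on UNIV (\<lambda>x. v x * w x)"
    using V_continuous assms by (intro continuous_intros) auto
  show "v x * w x = 0" if "x \<notin> closure A" for x
    using V_zero[OF assms(1), of x] that closure_subset by auto
qed

lemma V_integrable_sq: "v \<in> V \<Longrightarrow> integrable lborel (\<lambda>x. (v x)\<^sup>2)"
  using V_integrable_mult[of v v] by (simp add: power2_eq_square)

lemma L2_inner_eq:
  assumes "v \<in> V" "w \<in> V" "\<And>x. x \<in> A - B \<Longrightarrow> v x * w x = 0"
  shows "L2_inner B v w = (LINT x|lborel. v x * w x)"
proof -
  have "(\<lambda>x. indicator B x *\<^sub>R (v x * w x)) = (\<lambda>x. v x * w x)"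
  proof
    fix x show "indicator B x *\<^sub>R (v x * w x) = v x * w x"
      using V_zero[OF assms(1), of x] assms(3)[of x] by (cases "x \<in> A"; cases "x \<in> B") simp_all
  qed
  then show ?thesis using assms
    by (simp add: L2_inner_def set_lebesgue_integral_def integral_completion)
qed

text \<open>A continuous function that is nonzero somewhere is nonzero on an open set, which is not
  negligible.\<close>

lemma V_eq_0I:
  assumes "v \<in> V" "norm2_sq v = 0"
  shows "v = (\<lambda>_. 0)"
proof -
  have "AE x in lborel. (v x)\<^sup>2 = 0"
    using integral_nonneg_eq_0_iff_AE[OF V_integrable_sq[OF assms(1)]] assms(2) by simp
  then have "AE x in lebesgue. v x = 0" by (intro AE_completion) auto
  then have "negligible {x. v x \<noteq> 0}"
    by (simp add: eventually_ae_filter_negligible) (meson negligible_subset)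
  moreover have "open {x. v x \<noteq> 0}"
    using V_continuous[OF assms(1)] by (intro open_Collect_neq continuous_intros)
  ultimately have "{x. v x \<noteq> 0} = {}" using open_not_negligible by blast
  then show ?thesis by auto
qed

end

section \<open>Dirichlet energy, Galerkin solution and inverse estimate\<close>

lemma power2_diff_le: "(a - b)\<^sup>2 \<le> 2 * (a\<^sup>2 + b\<^sup>2)" for a b :: real
  using sum_squares_bound[of a "- b"] by (simp add: power2_diff)

context fe_domain begin

text \<open>The squared norm of the gradient as a finite sum, so that its algebra involves no
  measurability.\<close>

definition energy :: "('a \<Rightarrow> real) \<Rightarrow> real" where
  "energy v = (\<Sum>T\<in>TT. measure lborel T * (norm (slope v T))\<^sup>2)"

lemma energy_nonneg: "0 \<le> energy v"
  unfolding energy_def by (intro sum_nonneg) simp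

lemma dirichlet_energy: "v \<in> V \<Longrightarrow> dirichlet_form A v v = energy v"
  using open_A by (simp add: dirichlet_eq_sum energy_def dot_square_norm)

lemma energy_UNIV: "v \<in> V \<Longrightarrow> energy v = dirichlet_form UNIV v v"
  by (simp add: dirichlet_eq_sum energy_def dot_square_norm)

lemma energy_diff_le:
  assumes "v \<in> V" "w \<in> V"
  shows "energy (\<lambda>x. v x - w x) \<le> 2 * energy v + 2 * energy w"
proof -
  have "energy (\<lambda>x. v x - w x) \<le>
    (\<Sum>T\<in>TT. 2 * (measure lborel T * (norm (slope v T))\<^sup>2) + 2 * (measure lborel T * (norm (slope w T))\<^sup>2))"
    unfolding energy_def
  proof (rule sum_mono)
    fix T assume T: "T \<in> TT"
    have "slope (\<lambda>x. v x - w x) T = slope v T - slope w T"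
      using slope_lin[OF assms T, of 1 "-1"] by simp
    moreover have "(norm (slope v T - slope w T))\<^sup>2 \<le> (norm (slope v T) - - norm (slope w T))\<^sup>2"
      by (intro power_mono) (simp_all add: norm_triangle_ineq4)
    then have "(norm (slope v T - slope w T))\<^sup>2 \<le> 2 * (norm (slope v T))\<^sup>2 + 2 * (norm (slope w T))\<^sup>2"
      using order_trans[OF _ power2_diff_le[of "norm (slope v T)" "- norm (slope w T)"]] by simp
    ultimately have "measure lborel T * (norm (slope (\<lambda>x. v x - w x) T))\<^sup>2
        \<le> measure lborel T * (2 * (norm (slope v T))\<^sup>2 + 2 * (norm (slope w T))\<^sup>2)"
      by (intro mult_left_mono) auto
    then show "measure lborel T * (norm (slope (\<lambda>x. v x - w x) T))\<^sup>2
        \<le> 2 * (measure lborel T * (norm (slope v T))\<^sup>2) + 2 * (measure lborel T * (norm (slope w T))\<^sup>2)"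
      by (simp add: algebra_simps)
  qed
  then show ?thesis by (simp add: energy_def sum.distrib sum_distrib_left)
qed

text \<open>\<open>fe_solution\<close> is a definite description, so nothing is known about it
  before existence and uniqueness are proved. Both rest on the L2 part of the form, which is
  definite by itself; hence \<open>t\<close> is arbitrary.\<close>

lemma
  assumes f: "f \<in> V"
  shows fe_solution_mem: "fe_solution A TT t f \<in> V"
    and fe_solution_eq: "\<phi> \<in> V \<Longrightarrow>
      (LINT x|lborel. fe_solution A TT t f x * \<phi> x) + t\<^sup>2 * dirichlet_form A (fe_solution A TT t f) \<phi>
        = - (LINT x|lborel. f x * \<phi> x)"
proof -
  define B where "B v w = L2_inner A v w + t\<^sup>2 * dirichlet_form A v w" for v w
  have L2: "L2_inner A v w = (LINT x|lborel. v x * w x)" if "v \<in> V" "w \<in> V" for v w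
    using L2_inner_eq[OF that, of A] by simp
  have L2_lin: "L2_inner A (\<lambda>x. a * v x + b * w x) u = a * L2_inner A v u + b * L2_inner A w u"
    if "v \<in> V" "w \<in> V" "u \<in> V" for v w u a b
    using that V_integrable_mult[of v u] V_integrable_mult[of w u]
    by (simp add: L2 V_lin algebra_simps)
  have L2_sym: "L2_inner A v w = L2_inner A w v" for v w
    by (simp add: L2_inner_def mult.commute)
  have D: "dirichlet_form A v w = (\<Sum>T\<in>TT. measure lborel T * (slope v T \<bullet> slope w T))"
    if "v \<in> V" "w \<in> V" for v w
    using dirichlet_eq_sum[OF that] open_A by simp
  have D_lin: "dirichlet_form A (\<lambda>x. a * v x + b * w x) u = a * dirichlet_form A v u + b * dirichlet_form A w u"
    if "v \<in> V" "w \<in> V" "u \<in> V" for v w u a b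
    using that by (simp add: D V_lin slope_lin algebra_simps sum.distrib sum_distrib_left)
  have D_sym: "dirichlet_form A v w = dirichlet_form A w v" for v w
    by (simp add: dirichlet_form_def inner_commute)
  have B_lin: "B (\<lambda>x. a * v x + b * w x) u = a * B v u + b * B w u"
    if "v \<in> V" "w \<in> V" "u \<in> V" for v w u a b
    using that by (simp add: B_def L2_lin D_lin algebra_simps)
  have B_pos: "v = (\<lambda>_. 0)" if "v \<in> V" "B v v = 0" for v
  proof (rule V_eq_0I[OF that(1)])
    have "0 \<le> norm2_sq v" by simp
    moreover have "0 \<le> t\<^sup>2 * energy v" using energy_nonneg by simp
    moreover have "norm2_sq v + t\<^sup>2 * energy v = 0"
      using that by (simp add: B_def L2 dirichlet_energy power2_eq_square)
    ultimately show "norm2_sq v = 0" by linarith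
  qed
  obtain P where P: "finite P" "\<And>v. v \<in> V \<Longrightarrow> \<forall>x\<in>P. v x = 0 \<Longrightarrow> v = (\<lambda>_. 0)"
    using V_determined_by_vertices by blast
  have "\<exists>u\<in>V. \<forall>\<phi>\<in>V. B u \<phi> = - L2_inner A f \<phi>"
  proof (rule riesz_representation_determined_by_points[OF P(1)])
    fix v w a b assume vw: "v \<in> V" "w \<in> V"
    show "- L2_inner A f (\<lambda>x. a * v x + b * w x) = a * - L2_inner A f v + b * - L2_inner A f w"
      using L2_lin[OF vw f] L2_sym by simp
    show "B v w = B w v" unfolding B_def using L2_sym D_sym by metis
  qed (use V_const0 V_lin P(2) B_lin B_pos in \<open>blast+\<close>)
  then obtain u where u: "u \<in> V" "\<And>\<phi>. \<phi> \<in> V \<Longrightarrow> B u \<phi> = - L2_inner A f \<phi>" by blast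
  have "u' = u" if u': "u' \<in> V" "\<And>\<phi>. \<phi> \<in> V \<Longrightarrow> B u' \<phi> = - L2_inner A f \<phi>" for u'
  proof -
    define d where "d = (\<lambda>x. 1 * u' x + (-1) * u x)"
    have dV: "d \<in> V" unfolding d_def using V_lin u'(1) u(1) by blast
    have "B d d = 1 * B u' d + (-1) * B u d" unfolding d_def[of] using B_lin[OF u'(1) u(1) dV] d_def by metis
    then have "B d d = 0" using u(2)[OF dV] u'(2)[OF dV] by simp
    then have "d = (\<lambda>_. 0)" using B_pos dV by blast
    then show ?thesis by (auto simp: d_def fun_eq_iff)
  qed
  then have "fe_solution A TT t f = u"
    unfolding fe_solution_def using u unfolding B_def by (intro the_equality) blast+
  then show "fe_solution A TT t f \<in> V"
    and "\<phi> \<in> V \<Longrightarrow>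
      (LINT x|lborel. fe_solution A TT t f x * \<phi> x) + t\<^sup>2 * dirichlet_form A (fe_solution A TT t f) \<phi>
        = - (LINT x|lborel. f x * \<phi> x)"
    using u f by (auto simp: B_def L2)
qed

text \<open>Testing the Galerkin equation with \<open>v\<close> itself gives |v|^2 + t^2 |grad v|^2
  = -(f, v). This turns the contribution of a node to the discrete form into a sum of
  squares.\<close>

lemma fe_solution_energy:
  fixes t :: real
  assumes f: "f \<in> V"
  defines "v \<equiv> fe_solution A TT t f"
  shows "(LINT x|lborel. (f x + v x) * f x) = (LINT x|lborel. (f x + v x)\<^sup>2) + t\<^sup>2 * energy v"
proof -
  have v: "v \<in> V" unfolding v_def by (rule fe_solution_mem[OF f])
  have "(LINT x|lborel. v x * v x) + t\<^sup>2 * energy v = - (LINT x|lborel. f x * v x)"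
    using fe_solution_eq[OF f v[unfolded v_def], of t] v dirichlet_energy[OF v] by (simp add: v_def)
  moreover have "(LINT x|lborel. (f x + v x) * f x) = (LINT x|lborel. f x * f x) + (LINT x|lborel. f x * v x)"
    using V_integrable_mult[OF f f] V_integrable_mult[OF f v] by (simp add: algebra_simps)
  moreover have "(LINT x|lborel. (f x + v x)\<^sup>2) =
      (LINT x|lborel. f x * f x) + 2 * (LINT x|lborel. f x * v x) + (LINT x|lborel. v x * v x)"
  proof -
    have "(\<lambda>x. (f x + v x)\<^sup>2) = (\<lambda>x. f x * f x + 2 * (f x * v x) + v x * v x)"
      by (auto simp: power2_eq_square algebra_simps)
    then show ?thesis
      using V_integrable_mult[OF f f] V_integrable_mult[OF f v] V_integrable_mult[OF v v] by simp
  qed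
  ultimately show ?thesis by simp
qed

text \<open>Elements overlap in null sets only, so \<open>affine_inverse_estimate\<close> can be
  summed over the mesh. On a shape-regular, quasi-uniform mesh the common radius \<open>r\<close> is
  comparable to the mesh size.\<close>

lemma inverse_estimate:
  assumes v: "v \<in> V" and r: "0 < r" "\<And>T. T \<in> TT \<Longrightarrow> \<exists>x0. cball x0 r \<subseteq> T"
  shows "r\<^sup>2 * energy v \<le> 16 * 2 ^ DIM('a) * norm2_sq v"
proof -
  have int: "integrable lborel (\<lambda>x. indicator T x * (v x)\<^sup>2)" if "T \<in> TT" for T
    using V_integrable_sq[OF v] TT_compact[OF that]
    by (subst mult.commute) (intro integrable_real_mult_indicator, simp_all add: borel_compact)
  have "r\<^sup>2 * energy v = (\<Sum>T\<in>TT. r\<^sup>2 * (norm (slope v T))\<^sup>2 * measure lborel T)"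
    by (simp add: energy_def sum_distrib_left algebra_simps)
  also have "\<dots> \<le> (\<Sum>T\<in>TT. 16 * 2 ^ DIM('a) * (LINT x|lborel. indicator T x * (v x)\<^sup>2))"
  proof (rule sum_mono)
    fix T assume T: "T \<in> TT"
    obtain b where b: "\<And>x. x \<in> T \<Longrightarrow> v x = slope v T \<bullet> x + b" using V_slope[OF v T] by blast
    obtain x0 where x0: "cball x0 r \<subseteq> T" using r(2)[OF T] by blast
    have "(\<lambda>x. indicator T x * (slope v T \<bullet> x + b)\<^sup>2) = (\<lambda>x. indicator T x * (v x)\<^sup>2)"
      using b by (auto simp: indicator_def)
    then show "r\<^sup>2 * (norm (slope v T))\<^sup>2 * measure lborel T \<le>
        16 * 2 ^ DIM('a) * (LINT x|lborel. indicator T x * (v x)\<^sup>2)"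
      using affine_inverse_estimate[OF TT_convex[OF T] TT_compact[OF T] x0 r(1), of "slope v T" b] by simp
  qed
  also have "\<dots> = 16 * 2 ^ DIM('a) * (LINT x|lborel. (\<Sum>T\<in>TT. indicator T x * (v x)\<^sup>2))"
    using int by (simp add: sum_distrib_left)
  also have "(LINT x|lborel. (\<Sum>T\<in>TT. indicator T x * (v x)\<^sup>2)) \<le> norm2_sq v"
  proof (rule integral_mono_AE)
    show "AE x in lborel. (\<Sum>T\<in>TT. indicator T x * (v x)\<^sup>2) \<le> (v x)\<^sup>2"
      using AE_interior
    proof eventually_elim
      case (elim x)
      show ?case
      proof (cases "\<exists>T\<in>TT. x \<in> T")
        case True
        then obtain T where T: "T \<in> TT" "x \<in> T" by blast
        have "x \<notin> T'" if "T' \<in> TT" "T' \<noteq> T" for T'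
          using disjoint_TT[OF T(1) that(1)] elim T that by blast
        then have "(\<Sum>T'\<in>TT. indicator T' x * (v x)\<^sup>2) = (\<Sum>T'\<in>TT. if T' = T then (v x)\<^sup>2 else 0)"
          using T by (intro sum.cong) (auto simp: indicator_def)
        also have "\<dots> = (v x)\<^sup>2" using T finite_TT by (simp del: of_bool_eq)
        finally show ?thesis by (rule eq_refl)
      next
        case False
        then have "(\<Sum>T\<in>TT. indicator T x * (v x)\<^sup>2) = 0" by (intro sum.neutral) auto
        then show ?thesis by simp
      qed
    qed
  qed (use int V_integrable_sq[OF v] in auto)
  finally show ?thesis by simp
qed

lemma V_translate_diff_integrable:
  assumes v: "v \<in> V"
  shows "integrable lborel (\<lambda>x. (v (x + z) - v (x + y))\<^sup>2)"
proof -
  have i: "integrable lborel (\<lambda>x. 2 * ((v (x + z))\<^sup>2 + (v (x + y))\<^sup>2))"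
    using integrable_lborel_translate[OF V_integrable_sq[OF v], of z]
      integrable_lborel_translate[OF V_integrable_sq[OF v], of y] by simp
  note [measurable] = V_measurable[OF v]
  show ?thesis
  proof (rule Bochner_Integration.integrable_bound[OF i])
    show "AE x in lborel. norm ((v (x + z) - v (x + y))\<^sup>2) \<le> norm (2 * ((v (x + z))\<^sup>2 + (v (x + y))\<^sup>2))"
      using power2_diff_le by (intro AE_I2) simp
  qed measurable
qed

text \<open>Replacing the translation by \<open>z\<close> with \<open>n\<close> translations by \<open>z / n\<close> reduces the bound by the
  energy to the limit of difference quotients.\<close>

lemma translate_diff_subdivide:
  assumes v: "v \<in> V"
  shows "(LINT x|lborel. (v (x + real n *\<^sub>R u) - v x)\<^sup>2) \<le> (real n)\<^sup>2 * (LINT x|lborel. (v (x + u) - v x)\<^sup>2)"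
proof -
  let ?d = "\<lambda>i x. v (x + real (Suc i) *\<^sub>R u) - v (x + real i *\<^sub>R u)"
  note [measurable] = V_measurable[OF v]
  have tele: "v (x + real n *\<^sub>R u) - v x = (\<Sum>i<n. ?d i x)" for x
    using sum_lessThan_telescope[of "\<lambda>i. v (x + real i *\<^sub>R u)" n] by simp
  have "(v (x + real n *\<^sub>R u) - v x)\<^sup>2 \<le> real n * (\<Sum>i<n. (?d i x)\<^sup>2)" for x
    unfolding tele using Cauchy_Schwarz_ineq_sum[of "\<lambda>_. 1" "\<lambda>i. ?d i x" "{..<n}"] by simp
  moreover have id: "integrable lborel (\<lambda>x. (?d i x)\<^sup>2)" for i by (rule V_translate_diff_integrable[OF v])
  ultimately have "(LINT x|lborel. (v (x + real n *\<^sub>R u) - v x)\<^sup>2) \<le> (LINT x|lborel. real n * (\<Sum>i<n. (?d i x)\<^sup>2))"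
    using V_translate_diff_integrable[OF v, of "real n *\<^sub>R u" 0]
    by (intro integral_mono) auto
  also have "\<dots> = real n * (\<Sum>i<n. LINT x|lborel. (?d i x)\<^sup>2)" using id by simp
  also have "\<dots> = real n * (\<Sum>i<n. LINT x|lborel. (v (x + u) - v x)\<^sup>2)"
  proof -
    have "(LINT x|lborel. (?d i x)\<^sup>2) = (LINT x|lborel. (v (x + u) - v x)\<^sup>2)" for i
      using integral_lborel_translate[of "\<lambda>x. (v (x + u) - v x)\<^sup>2" "real i *\<^sub>R u"]
      by (simp add: algebra_simps)
    then show ?thesis by simp
  qed
  finally show ?thesis by (simp add: power2_eq_square)
qed

end

lemma has_derivative_directional_LIMSEQ:
  fixes v :: "'a::real_normed_vector \<Rightarrow> real"
  assumes "(v has_derivative v') (at x)"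
  shows "(\<lambda>n. real (Suc n) * (v (x + (1 / real (Suc n)) *\<^sub>R z) - v x)) \<longlonglongrightarrow> v' z"
proof -
  have "((\<lambda>t. x + t *\<^sub>R z) has_derivative (\<lambda>t. t *\<^sub>R z)) (at 0)"
    by (auto intro!: derivative_eq_intros)
  then have "((\<lambda>t. v (x + t *\<^sub>R z)) has_derivative (\<lambda>t. v' (t *\<^sub>R z))) (at 0)"
    by (rule has_derivative_compose) (simp add: assms)
  moreover have "v' (t *\<^sub>R z) = v' z * t" for t
    using linear_scale[OF has_derivative_linear[OF assms]] by simp
  ultimately have "((\<lambda>t. v (x + t *\<^sub>R z)) has_field_derivative v' z) (at 0)"
    by (simp add: has_field_derivative_def)
  then have "(\<lambda>t. (v (x + t *\<^sub>R z) - v x) / t) \<midarrow>0\<rightarrow> v' z" by (simp add: DERIV_def)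
  moreover have "filterlim (\<lambda>n. 1 / real (Suc n)) (at 0) sequentially"
    unfolding filterlim_at using LIMSEQ_inverse_real_of_nat by (simp add: inverse_eq_divide)
  ultimately have "(\<lambda>n. (v (x + (1 / real (Suc n)) *\<^sub>R z) - v x) / (1 / real (Suc n))) \<longlonglongrightarrow> v' z"
    by (rule filterlim_compose)
  then show ?thesis by (simp add: mult.commute)
qed

context fe_domain begin

text \<open>By \<open>translate_diff_subdivide\<close> with n + 1 steps, the left side is at most
  the integral of \<open>q n\<close> for every n. The integrands converge to the squared directional
  derivative off the element boundaries, and the Lipschitz constant together with the bounded
  support gives the majorant for dominated convergence.\<close>

lemma translate_diff_le_energy:
  assumes v: "v \<in> V"
  shows "(LINT x|lborel. (v (x + z) - v x)\<^sup>2) \<le> (norm z)\<^sup>2 * energy v"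
proof -
  note [measurable] = V_measurable[OF v]
  obtain L where L: "0 \<le> L" "\<And>x y. \<bar>v x - v y\<bar> \<le> L * norm (x - y)" using V_Lipschitz[OF v] by blast
  obtain R where R: "closure A \<subseteq> cball 0 R"
    using bounded_subset_ballD[OF compact_imp_bounded[OF compact_closure_A], of 0] ball_subset_cball by blast
  \<comment> \<open>Enlarging the radius by \<open>norm z\<close> ensures that outside
    \<open>K\<close> both \<open>x\<close> and its translate miss the support.\<close>
  define K where "K = cball (0::'a) (R + norm z)"
  define g where "g x = (\<Sum>T\<in>TT. indicator (interior T) x * (slope v T \<bullet> z)\<^sup>2)" for x
  define q where "q n x = (real (Suc n) * (v (x + (1 / real (Suc n)) *\<^sub>R z) - v x))\<^sup>2" for n x
  have emK: "emeasure lborel (interior T) < \<infinity>" if "T \<in> TT" for T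
    by (intro emeasure_bounded_finite) (use that TT_compact compact_imp_bounded bounded_interior in blast)
  have gm [measurable]: "g \<in> borel_measurable borel" unfolding g_def by measurable
  have qm: "q n \<in> borel_measurable borel" for n unfolding q_def by measurable
  have "(\<lambda>n. LINT x|lborel. q n x) \<longlonglongrightarrow> (LINT x|lborel. g x)"
  proof (rule integral_dominated_convergence[where w="\<lambda>x. indicator K x * (L * norm z)\<^sup>2"])
    show "integrable lborel (\<lambda>x. indicator K x * (L * norm z)\<^sup>2)"
      unfolding K_def by (intro integrable_mult_left) (simp add: integrable_indicator_iff emeasure_bounded_finite[OF bounded_cball, simplified])
    show "AE x in lborel. (\<lambda>n. q n x) \<longlonglongrightarrow> g x"
      using AE_interior
    proof eventually_elim
      case (elim x)
      show ?case
      proof (cases "x \<in> closure A")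
        case True
        then obtain T where T: "T \<in> TT" "x \<in> interior T" using elim by blast
        have "g x = (\<Sum>T'\<in>TT. if T' = T then (slope v T \<bullet> z)\<^sup>2 else 0)"
          unfolding g_def by (rule sum.cong) (use T disjoint_TT in \<open>auto simp: indicator_def\<close>)
        then have "g x = (z \<bullet> slope v T)\<^sup>2" using T finite_TT by (simp add: inner_commute)
        then show ?thesis unfolding q_def using V_GDERIV[OF v T, unfolded gderiv_def]
          by (simp only:) (intro tendsto_power has_derivative_directional_LIMSEQ)
      next
        case False
        then have "x \<notin> interior T" if "T \<in> TT" for T using TT_subset[OF that] interior_subset by blast
        then have "g x = 0" unfolding g_def by (intro sum.neutral) auto
        then have "g x = (z \<bullet> 0)\<^sup>2" by simp
        then show ?thesis unfolding q_def using V_GDERIV_outside[OF v False, unfolded gderiv_def]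
          by (simp only:) (intro tendsto_power has_derivative_directional_LIMSEQ)
      qed
    qed
    show "AE x in lborel. norm (q n x) \<le> indicator K x * (L * norm z)\<^sup>2" for n
    proof (rule AE_I2)
      fix x
      let ?z = "(1 / real (Suc n)) *\<^sub>R z"
      show "norm (q n x) \<le> indicator K x * (L * norm z)\<^sup>2"
      proof (cases "x \<in> K")
        case True
        have "\<bar>real (Suc n) * (v (x + ?z) - v x)\<bar> \<le> real (Suc n) * (L * norm ?z)"
          unfolding abs_mult using L(2)[of "x + ?z" x] by (intro mult_mono) auto
        also have "\<dots> = L * norm z" by simp
        finally have "(real (Suc n) * (v (x + ?z) - v x))\<^sup>2 \<le> (L * norm z)\<^sup>2"
          using L(1) by (subst abs_le_square_iff[symmetric]) (simp add: abs_mult)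
        then show ?thesis using True by (simp add: q_def)
      next
        case False
        have nz: "norm ?z \<le> norm z" by (simp add: field_simps mult_le_cancel_left1)
        have "x \<notin> cball 0 R" using False norm_ge_zero[of z] unfolding K_def mem_cball_0 by linarith
        moreover have "x + ?z \<notin> cball 0 R"
          using False nz norm_triangle_ineq4[of "x + ?z" ?z] by (auto simp: K_def)
        ultimately have "v x = 0" "v (x + ?z) = 0" using V_zero[OF v] R closure_subset by blast+
        then show ?thesis by (simp add: q_def)
      qed
    qed
  qed (use qm in auto)
  moreover have "(LINT x|lborel. (v (x + z) - v x)\<^sup>2) \<le> (LINT x|lborel. q n x)" for n
  proof -
    have "(LINT x|lborel. q n x) = (real (Suc n))\<^sup>2 * (LINT x|lborel. (v (x + (1 / real (Suc n)) *\<^sub>R z) - v x)\<^sup>2)"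
      unfolding q_def power_mult_distrib by simp
    then show ?thesis using translate_diff_subdivide[OF v, of "Suc n" "(1 / real (Suc n)) *\<^sub>R z"]
      by simp
  qed
  ultimately have "(LINT x|lborel. (v (x + z) - v x)\<^sup>2) \<le> (LINT x|lborel. g x)"
    by (intro LIMSEQ_le_const) auto
  also have "\<dots> = (\<Sum>T\<in>TT. measure lborel (interior T) * (slope v T \<bullet> z)\<^sup>2)"
    unfolding g_def using emK by (subst Bochner_Integration.integral_sum) (auto simp: integrable_indicator_iff)
  also have "\<dots> \<le> (\<Sum>T\<in>TT. measure lborel T * ((norm z)\<^sup>2 * (norm (slope v T))\<^sup>2))"
  proof (intro sum_mono mult_mono)
    fix T assume T: "T \<in> TT"
    show "measure lborel (interior T) \<le> measure lborel T"
      by (rule measure_mono_fmeasurable)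
        (use T TT_compact interior_subset in \<open>auto intro: fmeasurable_compact\<close>)
    have "\<bar>slope v T \<bullet> z\<bar> \<le> \<bar>norm (slope v T) * norm z\<bar>" using Cauchy_Schwarz_ineq2 by simp
    then have "(slope v T \<bullet> z)\<^sup>2 \<le> (norm (slope v T) * norm z)\<^sup>2" by (simp only: abs_le_square_iff)
    then show "(slope v T \<bullet> z)\<^sup>2 \<le> (norm z)\<^sup>2 * (norm (slope v T))\<^sup>2" by (simp add: power_mult_distrib mult.commute)
  qed auto
  also have "\<dots> = (norm z)\<^sup>2 * energy v" by (simp add: energy_def sum_distrib_left algebra_simps)
  finally show ?thesis .
qed

end

section \<open>Inscribed balls of mesh elements and nested finite element spaces\<close>

lemma fe_mesh_ball:
  fixes T :: "'a::euclidean_space set"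
  assumes mesh: "fe_mesh \<sigma> \<rho> A h TT" and T: "T \<in> TT" and h: "0 < h"
  shows "0 < \<sigma> \<and> 0 < \<rho> \<and> interior T \<noteq> {} \<and> (\<exists>x0. cball x0 (h / (2 * \<sigma> * \<rho>)) \<subseteq> T)"
proof -
  have fin: "finite TT" and simp: "int DIM('a) simplex T" and mx: "Max (diameter ` TT) = h"
    and sig: "diameter T / inradius T \<le> \<sigma>" and rho: "Max (diameter ` TT) / Min (diameter ` TT) \<le> \<rho>"
    using mesh T by (auto simp: fe_mesh_def simplicial_subdivision_def triangulation_def)
  have bT: "bounded T" and cT: "convex T"
    using compact_imp_bounded[OF compact_simplex[OF simp]] convex_simplex[OF simp] by auto
  have "affine hull T = UNIV" using aff_dim_simplex[OF simp] by (simp add: aff_dim_eq_full)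
  moreover have "T \<noteq> {}" using simp by force
  ultimately have int: "interior T \<noteq> {}"
    using rel_interior_interior rel_interior_eq_empty[OF cT] by metis
  define S where "S = {r. 0 \<le> r \<and> (\<exists>x. cball x r \<subseteq> T)}"
  obtain x e where e: "0 < e" "cball x e \<subseteq> T" using int mem_interior_cball by blast
  \<comment> \<open>The supremum in \<open>inradius\<close> is meaningful only for a set that is
    bounded above; the centre of a ball and one point of its boundary sphere give the bound.\<close>
  have rd: "r \<le> diameter T" if "r \<in> S" for r
  proof -
    have "0 \<le> r \<and> (\<exists>x. cball x r \<subseteq> T)" using that unfolding S_def by simp
    then obtain y where y: "cball y r \<subseteq> T" "0 \<le> r" by blast
    obtain b :: 'a where b: "b \<in> Basis" using nonempty_Basis by blast
    have "y \<in> T" "y + r *\<^sub>R b \<in> T" using y b by (auto simp: dist_norm)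
    then have "dist y (y + r *\<^sub>R b) \<le> diameter T" using bT by (intro diameter_bounded_bound)
    then show ?thesis using b y by (simp add: dist_norm)
  qed
  have eS: "e \<in> S" using e by (auto simp: S_def)
  have inr: "inradius T = Sup S" by (simp add: inradius_def S_def)
  have "e \<le> Sup S" using eS rd by (intro cSup_upper bdd_aboveI) auto
  then have in0: "0 < inradius T" using e inr by simp
  have dpos: "0 < diameter T'" if "T' \<in> TT" for T'
  proof -
    have simp': "int DIM('a) simplex T'" using mesh that by (auto simp: fe_mesh_def simplicial_subdivision_def)
    have "\<not> (\<exists>a. T' = {a})" "T' \<noteq> {}" using aff_dim_simplex[OF simp'] by auto
    then obtain a b where "a \<in> T'" "b \<in> T'" "a \<noteq> b" by blast
    then have "dist a b \<le> diameter T'" "0 < dist a b"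
      using diameter_bounded_bound[of T' a b] compact_imp_bounded[OF compact_simplex[OF simp']] by auto
    then show ?thesis by linarith
  qed
  have "Min (diameter ` TT) \<in> diameter ` TT" using fin T by (intro Min_in) auto
  then have Mpos: "0 < Min (diameter ` TT)" using dpos by auto
  \<comment> \<open>\<sigma> and \<rho> are arbitrary reals; the existence of an element makes them
    positive.\<close>
  have rpos: "0 < \<rho>" using rho divide_pos_pos[OF h Mpos] unfolding mx by (rule less_le_trans[rotated])
  have spos: "0 < \<sigma>" using sig divide_pos_pos[OF dpos[OF T] in0] by (rule less_le_trans[rotated])
  have "h / \<rho> \<le> Min (diameter ` TT)" using rho Mpos mx rpos by (simp add: field_simps)
  also have "\<dots> \<le> diameter T" using fin T by simp
  also have "\<dots> \<le> \<sigma> * inradius T" using sig in0 by (simp add: field_simps)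
  \<comment> \<open>The factor 2 leaves room below the supremum, so that no largest ball has to be
    exhibited.\<close>
  finally have "h / (2 * \<sigma> * \<rho>) \<le> inradius T / 2" using spos rpos by (simp add: field_simps)
  moreover obtain r where "r \<in> S" "inradius T / 2 < r" using less_cSupE[of "inradius T / 2" S] in0 inr eS by auto
  moreover then obtain x0 where "cball x0 r \<subseteq> T" by (auto simp: S_def)
  ultimately have "h / (2 * \<sigma> * \<rho>) \<le> r" "cball x0 r \<subseteq> T" by linarith+
  then have "cball x0 (h / (2 * \<sigma> * \<rho>)) \<subseteq> T"
    using subset_cball order_trans by blast
  then show ?thesis using spos rpos int by blast
qed

text \<open>The intersection is a face of both simplices, and a face that meets the interior is the
  whole simplex.\<close>

lemma simplicial_interior_disjoint:
  fixes TT :: "'a::euclidean_space set set"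
  assumes "triangulation TT" "T \<in> TT" "T' \<in> TT" "T \<noteq> T'"
  shows "interior T \<inter> interior T' = {}"
proof (rule ccontr)
  assume *: "interior T \<inter> interior T' \<noteq> {}"
  have "(T \<inter> T') face_of T" "(T' \<inter> T) face_of T'"
    using assms by (auto simp: triangulation_def)
  moreover have "T \<inter> T' \<inter> interior T \<noteq> {}" "T' \<inter> T \<inter> interior T' \<noteq> {}" using * interior_subset by blast+
  ultimately have "T \<inter> T' = T" "T' \<inter> T = T'" using face_of_disjoint_interior by blast+
  then show False using assms(4) by blast
qed

lemma fe_mesh_fe_domain:
  assumes mesh: "fe_mesh \<sigma> \<rho> A h TT" and h: "0 < h"
    and A: "open A" "bounded A" "convex A"
  shows "fe_domain A TT"
proof
  have tri: "triangulation TT" and simp: "\<And>T. T \<in> TT \<Longrightarrow> int DIM('a) simplex T"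
    and U: "\<Union>TT = closure A"
    using mesh by (auto simp: fe_mesh_def simplicial_subdivision_def)
  show "finite TT" using tri by (simp add: triangulation_def)
  show "\<exists>C. finite C \<and> T = convex hull C" if "T \<in> TT" for T
    using simp[OF that] by (auto simp: simplex)
  show "interior T \<noteq> {}" if "T \<in> TT" for T using fe_mesh_ball[OF mesh that h] by blast
  show "negligible (frontier A)" using A negligible_convex_frontier by blast
qed (use A mesh simplicial_interior_disjoint in \<open>auto simp: fe_mesh_def simplicial_subdivision_def\<close>)

text \<open>An element of the larger mesh outside \<open>TD\<close> has interior disjoint from the
  closure of \<open>D\<close>. There \<open>v\<close> is zero, and by continuity on the whole
  element; this is where the nestedness of the meshes enters.\<close>

lemma fe_space_mono:
  assumes v: "v \<in> fe_space D TD" and D: "open D" "D \<subseteq> A" "\<Union>TD = closure D"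
    and dom: "fe_domain A TT" and sub: "TD \<subseteq> TT"
  shows "v \<in> fe_space A TT"
proof -
  interpret fe_domain A TT by (rule dom)
  have cont: "continuous_on UNIV v" by (rule fe_space_continuous[OF D(1) v])
  have v0: "v x = 0" if "x \<notin> D" for x using v that by (simp add: fe_space_def)
  have "\<exists>p b. \<forall>x\<in>T. v x = p \<bullet> x + b" if T: "T \<in> TT" for T
  proof (cases "T \<in> TD")
    case True then show ?thesis using v by (simp add: fe_space_def)
  next
    case False
    have "interior T \<inter> T' = {}" if T': "T' \<in> TD" for T'
    proof -
      have "interior T \<inter> interior T' = {}" using disjoint_TT[OF T, of T'] T' sub False by blast
      then have "interior T \<inter> closure (interior T') = {}" by (simp add: open_Int_closure_eq_empty)
      moreover have "closure (interior T') = T'"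
        using T' sub convex_closure_interior[OF TT_convex interior_TT] TT_compact
        by (metis closure_closed compact_imp_closed subsetD)
      ultimately show ?thesis by simp
    qed
    then have "interior T \<inter> D = {}" using D(3) closure_subset by blast
    then have "\<And>x. x \<in> interior T \<Longrightarrow> v x = 0" using v0 by blast
    then have "v x = 0" if "x \<in> closure (interior T)" for x
      using continuous_constant_on_closure[of "interior T" v 0 x] cont that
      by (metis continuous_on_subset subset_UNIV)
    moreover have "closure (interior T) = T"
      using convex_closure_interior[OF TT_convex[OF T] interior_TT[OF T]] TT_compact[OF T]
      by (simp add: closure_closed compact_imp_closed)
    ultimately have "\<forall>x\<in>T. v x = 0 \<bullet> x + 0" by simp
    then show ?thesis by blast
  qed
  then show ?thesis using cont v0 D(2) by (auto simp: fe_space_def intro: continuous_on_subset)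
qed

section \<open>The Gagliardo seminorm\<close>

definition gagliardo :: "real \<Rightarrow> ('a::euclidean_space \<Rightarrow> real) \<Rightarrow> ennreal" where
  "gagliardo r v = (\<integral>\<^sup>+ x. (\<integral>\<^sup>+ y. ennreal ((v x - v y)\<^sup>2 / norm (x - y) powr (real DIM('a) + 2 * r))
     \<partial>lebesgue) \<partial>lebesgue)"

text \<open>The squared L2 modulus of continuity. Extended nonnegative values let Tonelli's theorem
  apply to measurable \<open>v\<close> without integrability.\<close>

definition shift_modulus :: "('a::euclidean_space \<Rightarrow> real) \<Rightarrow> 'a \<Rightarrow> ennreal" where
  "shift_modulus v z = (\<integral>\<^sup>+ x. ennreal ((v (x + z) - v x)\<^sup>2) \<partial>lborel)"

definition unit_vol :: "'a::euclidean_space itself \<Rightarrow> real" where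
  "unit_vol _ = measure lborel (ball (0::'a) 1)"

lemma unit_vol_nonneg: "0 \<le> unit_vol TYPE('a::euclidean_space)"
  by (simp add: unit_vol_def)

text \<open>Substituting y = x + z and exchanging the integrals reduces the double integral to
  bounds that depend on the shift only.\<close>

lemma gagliardo_eq_shift_modulus:
  fixes v :: "'a::euclidean_space \<Rightarrow> real"
  assumes [measurable]: "v \<in> borel_measurable borel"
  shows "gagliardo r v = (\<integral>\<^sup>+ z. shift_modulus v z * ennreal (norm z powr - (real DIM('a) + 2 * r)) \<partial>lborel)"
proof -
  let ?b = "real DIM('a) + 2 * r"
  have "gagliardo r v = (\<integral>\<^sup>+ x. (\<integral>\<^sup>+ y. ennreal ((v x - v y)\<^sup>2 / norm (x - y) powr ?b) \<partial>lborel) \<partial>lborel)"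
    by (simp add: gagliardo_def nn_integral_completion)
  also have "\<dots> = (\<integral>\<^sup>+ x. (\<integral>\<^sup>+ z. ennreal ((v x - v (z + x))\<^sup>2 / norm (x - (z + x)) powr ?b) \<partial>lborel) \<partial>lborel)"
    by (intro nn_integral_cong nn_integral_lborel_translate[symmetric]) measurable
  also have "\<dots> = (\<integral>\<^sup>+ x. (\<integral>\<^sup>+ z. ennreal ((v (x + z) - v x)\<^sup>2) * ennreal (norm z powr - ?b) \<partial>lborel) \<partial>lborel)"
  proof (intro nn_integral_cong)
    fix x z :: 'a
    show "ennreal ((v x - v (z + x))\<^sup>2 / norm (x - (z + x)) powr ?b) =
        ennreal ((v (x + z) - v x)\<^sup>2) * ennreal (norm z powr - ?b)"
      unfolding powr_minus divide_inverse
      by (simp add: add.commute power2_commute flip: ennreal_mult)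
  qed
  also have "\<dots> = (\<integral>\<^sup>+ z. (\<integral>\<^sup>+ x. ennreal ((v (x + z) - v x)\<^sup>2) * ennreal (norm z powr - ?b) \<partial>lborel) \<partial>lborel)"
    by (rule lborel_pair.Fubini'[symmetric]) measurable
  also have "\<dots> = (\<integral>\<^sup>+ z. shift_modulus v z * ennreal (norm z powr - ?b) \<partial>lborel)"
    unfolding shift_modulus_def by (intro nn_integral_cong nn_integral_multc) measurable
  finally show ?thesis .
qed

lemma shift_modulus_measurable [measurable]:
  fixes v :: "'a::euclidean_space \<Rightarrow> real"
  assumes [measurable]: "v \<in> borel_measurable borel"
  shows "shift_modulus v \<in> borel_measurable borel"
  unfolding shift_modulus_def by measurable

text \<open>Half-open, so that shells with consecutive radii tile without overlap.\<close>

definition shell :: "real \<Rightarrow> real \<Rightarrow> 'a::real_normed_vector set" where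
  "shell a b = {z. a < norm z \<and> norm z \<le> b}"

lemma shell_measurable [measurable]: "shell a b \<in> sets borel"
  unfolding shell_def by measurable

lemma emeasure_shell:
  assumes "0 \<le> a" "a \<le> b"
  shows "emeasure lborel (shell a b :: 'a::euclidean_space set) =
    ennreal (unit_vol TYPE('a) * (b ^ DIM('a) - a ^ DIM('a)))"
proof -
  have c: "emeasure lborel (cball (0::'a) r) = ennreal (unit_vol TYPE('a) * r ^ DIM('a))" if "0 \<le> r" for r
    using emeasure_eq_ennreal_measure[of lborel "cball (0::'a) r"] emeasure_bounded_finite[of "cball (0::'a) r"]
      content_ball_conv_unit_ball[OF that, of "0::'a"]
    by (simp add: unit_vol_def mult.commute content_cball_conv_ball)
  have "shell a b = cball (0::'a) b - cball 0 a" by (auto simp: shell_def)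
  then have "emeasure lborel (shell a b :: 'a set) = emeasure lborel (cball (0::'a) b) - emeasure lborel (cball (0::'a) a)"
    using assms c[of a] by (subst emeasure_Diff[symmetric]) (auto intro!: subset_cball)
  then show ?thesis using assms c unit_vol_nonneg[where 'a='a]
    by (simp add: ennreal_minus right_diff_distrib)
qed

lemma ennreal_plus_sum:
  assumes "0 \<le> x" "0 \<le> y" "\<And>j. j \<in> J \<Longrightarrow> 0 \<le> f j"
  shows "ennreal x + ennreal y + (\<Sum>j\<in>J. ennreal (f j)) = ennreal (x + y + (\<Sum>j\<in>J. f j))"
  using assms by (simp add: sum_ennreal sum_nonneg)

section \<open>The Gagliardo integral over annuli of shifts\<close>

context
  fixes v :: "'a::euclidean_space \<Rightarrow> real" and r b \<omega> :: real
  assumes v [measurable]: "v \<in> borel_measurable borel" and r: "0 < r" "r < 1"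
  defines "b \<equiv> real DIM('a) + 2 * r" and "\<omega> \<equiv> unit_vol TYPE('a)"
begin

lemma vol_nonneg: "0 \<le> \<omega>"
  unfolding \<omega>_def by (rule unit_vol_nonneg)

definition "gint S = (\<integral>\<^sup>+ z. shift_modulus v z * ennreal (norm z powr - b) * indicator S z \<partial>lborel)"

lemma gint_shell:
  assumes ab: "0 < l" "l \<le> u" and B: "0 \<le> B" "\<And>z. l < norm z \<Longrightarrow> norm z \<le> u \<Longrightarrow> shift_modulus v z \<le> ennreal B"
  shows "gint (shell l u) \<le> ennreal (B * l powr - b * (\<omega> * (u ^ DIM('a) - l ^ DIM('a))))"
proof -
  have "b \<ge> 0" using r by (simp add: b_def)
  have "gint (shell l u) \<le> (\<integral>\<^sup>+ z. ennreal (B * l powr - b) * indicator (shell l u :: 'a set) z \<partial>lborel)"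
    unfolding gint_def
  proof (intro nn_integral_mono)
    fix z :: 'a
    show "shift_modulus v z * ennreal (norm z powr - b) * indicator (shell l u) z
        \<le> ennreal (B * l powr - b) * indicator (shell l u) z"
    proof (cases "z \<in> shell l u")
      case True
      then have "shift_modulus v z * ennreal (norm z powr - b) \<le> ennreal B * ennreal (l powr - b)"
        using B ab \<open>b \<ge> 0\<close> by (intro mult_mono ennreal_leI powr_mono2') (auto simp: shell_def)
      then show ?thesis using True B by (simp add: ennreal_mult)
    qed simp
  qed
  also have "\<dots> = ennreal (B * l powr - b) * emeasure lborel (shell l u :: 'a set)"
    by (rule nn_integral_cmult_indicator) simp
  also have "\<dots> = ennreal (B * l powr - b * (\<omega> * (u ^ DIM('a) - l ^ DIM('a))))"
    using ab B vol_nonneg by (simp add: emeasure_shell \<omega>_def[symmetric] power_mono flip: ennreal_mult)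
  finally show ?thesis .
qed

text \<open>The point 0 may be added to the cover because the integrand is 0 there. The lemma serves
  shells shrinking to 0 as well as shells growing to infinity.\<close>

lemma gint_geometric:
  assumes S: "S \<subseteq> insert 0 (\<Union>n. shell (l n) (u n))"
    and le: "\<And>n. gint (shell (l n) (u n)) \<le> ennreal (K * q ^ n)" and K: "0 \<le> K" "0 \<le> q" "q < 1"
  shows "gint S \<le> ennreal (K / (1 - q))"
proof -
  let ?f = "\<lambda>z. shift_modulus v z * ennreal (norm z powr - b)"
  have "gint S \<le> (\<integral>\<^sup>+ z. (\<Sum>n. ?f z * indicator (shell (l n) (u n)) z) \<partial>lborel)"
    unfolding gint_def
  proof (intro nn_integral_mono)
    fix z
    show "?f z * indicator S z \<le> (\<Sum>n. ?f z * indicator (shell (l n) (u n)) z)"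
    proof (cases "z \<in> S \<and> z \<noteq> 0")
      case True
      then obtain n where n: "z \<in> shell (l n) (u n)" using S by blast
      have "(\<Sum>i\<in>{n}. ?f z * indicator (shell (l i) (u i)) z) \<le> (\<Sum>n. ?f z * indicator (shell (l n) (u n)) z)"
        by (rule sum_le_suminf) auto
      then show ?thesis using n True by simp
    qed auto
  qed
  also have "\<dots> = (\<Sum>n. gint (shell (l n) (u n)))"
    unfolding gint_def by (rule nn_integral_suminf) measurable
  also have "\<dots> \<le> (\<Sum>n. ennreal (K * q ^ n))" by (intro suminf_le le) auto
  also have "\<dots> = ennreal (\<Sum>n. K * q ^ n)"
    using K by (intro suminf_ennreal2 summable_mult summable_geometric) auto
  also have "(\<Sum>n. K * q ^ n) = K / (1 - q)"
    using K by (subst suminf_mult) (auto simp: suminf_geometric summable_geometric)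
  finally show ?thesis .
qed

text \<open>On halving shells the factor |z|^2 reduces the kernel to |z|^(2 - b); with the volume
  this gives the ratio \<open>2 powr (2 * r - 2)\<close>, below 1 because r < 1.\<close>

lemma gint_cball_le:
  assumes t: "0 < t" and G: "0 \<le> G" "\<And>z. shift_modulus v z \<le> ennreal ((norm z)\<^sup>2 * G)"
  shows "gint (cball 0 t) \<le> ennreal (\<omega> * 2 powr b / (1 - 2 powr (2 * r - 2)) * (G * t powr (2 - 2 * r)))"
proof -
  define l where "l n = t / 2 ^ Suc n" for n
  define u where "u n = t / 2 ^ n" for n
  have "gint (cball 0 t) \<le> ennreal ((G * t powr (2 - 2 * r) * (\<omega> * 2 powr b)) / (1 - 2 powr (2 * r - 2)))"
  proof (rule gint_geometric[where l=l and u=u])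
    show "cball 0 t \<subseteq> insert (0::'a) (\<Union>n. shell (l n) (u n))"
    proof
      fix z :: 'a assume z: "z \<in> cball 0 t"
      show "z \<in> insert 0 (\<Union>n. shell (l n) (u n))"
      proof (cases "z = 0")
        case False
        then have "\<exists>n. (1/2) ^ n < norm z / t" using t by (intro real_arch_pow_inv) auto
        then obtain n0 where n0: "t * (1/2) ^ n0 < norm z" using t by (auto simp: field_simps)
        have "l n0 \<le> t * (1/2) ^ n0" using t by (simp add: l_def power_divide divide_simps)
        then have ex: "l n0 < norm z" using n0 by simp
        \<comment> \<open>Minimality gives the outer bound, since
          \<open>u (Suc m) = l m\<close>.\<close>
        define n where "n = (LEAST n. l n < norm z)"
        have "l n < norm z" unfolding n_def by (rule LeastI[of "\<lambda>n. l n < norm z", OF ex])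
        moreover have "norm z \<le> u n"
        proof (cases n)
          case 0 then show ?thesis using z by (simp add: u_def)
        next
          case (Suc m)
          then have "\<not> l m < norm z" using not_less_Least[of m "\<lambda>n. l n < norm z"] by (simp add: n_def)
          then show ?thesis using Suc by (simp add: l_def u_def)
        qed
        ultimately show ?thesis by (auto simp: shell_def)
      qed simp
    qed
    show "gint (shell (l n) (u n)) \<le> ennreal (G * t powr (2 - 2 * r) * (\<omega> * 2 powr b) * (2 powr (2 * r - 2)) ^ n)" for n
    proof -
      have un: "0 < u n" "l n = u n / 2" "0 < l n" using t by (auto simp: l_def u_def)
      have "gint (shell (l n) (u n)) \<le>
          ennreal ((u n)\<^sup>2 * G * l n powr - b * (\<omega> * (u n ^ DIM('a) - l n ^ DIM('a))))"
      proof (rule gint_shell)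
        show "shift_modulus v z \<le> ennreal ((u n)\<^sup>2 * G)" if "norm z \<le> u n" for z
          using G(2)[of z] by (rule order_trans) (use that G un in \<open>auto intro!: ennreal_leI mult_right_mono power_mono\<close>)
      qed (use un G in auto)
      also have "\<dots> \<le> ennreal ((u n)\<^sup>2 * G * l n powr - b * (\<omega> * u n ^ DIM('a)))"
        using un G vol_nonneg by (intro ennreal_leI mult_left_mono) auto
      also have "(u n)\<^sup>2 * G * l n powr - b * (\<omega> * u n ^ DIM('a)) =
          G * (\<omega> * 2 powr b) * (u n powr 2 * u n powr - b * u n powr DIM('a))"
      proof -
        have e: "u n = l n * 2" using un by simp
        have "u n powr b = l n powr b * 2 powr b" unfolding e using un(3) powr_mult by force
        then have lb: "l n powr - b = 2 powr b * u n powr - b"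
          by (simp add: powr_minus field_simps)
        show ?thesis unfolding lb using un(1) by (simp add: powr_realpow)
      qed
      also have "u n powr 2 * u n powr - b * u n powr DIM('a) = u n powr (2 - 2 * r)"
        by (simp add: b_def flip: powr_add)
      also have "u n powr (2 - 2 * r) = t powr (2 - 2 * r) * (2 powr (2 * r - 2)) ^ n"
      proof -
        have "u n powr (2 - 2 * r) = t powr (2 - 2 * r) / (2 ^ n) powr (2 - 2 * r)"
          using t by (simp add: u_def powr_divide)
        also have "((2::real) ^ n) powr (2 - 2 * r) = (2 powr (2 - 2 * r)) ^ n"
          by (simp add: powr_powr mult.commute flip: powr_realpow)
        also have "t powr (2 - 2 * r) / (2 powr (2 - 2 * r)) ^ n = t powr (2 - 2 * r) * (inverse (2 powr (2 - 2 * r))) ^ n"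
          by (simp add: divide_inverse power_inverse)
        also have "inverse ((2::real) powr (2 - 2 * r)) = 2 powr (2 * r - 2)"
          by (simp flip: powr_minus)
        finally show ?thesis .
      qed
      finally show ?thesis by (simp add: algebra_simps)
    qed
    show "(2::real) powr (2 * r - 2) < 1" using r by (simp add: powr_less_one)
  qed (use G vol_nonneg in auto)
  then show ?thesis by (simp add: algebra_simps)
qed

text \<open>Kernel and volume together decay on doubling shells with the ratio
  \<open>2 powr (- 2 * r)\<close>, below 1 because r > 0.\<close>

lemma gint_outside_le:
  assumes t: "0 < t" and M: "0 \<le> M" "\<And>z. shift_modulus v z \<le> ennreal M"
  shows "gint (- cball 0 t) \<le> ennreal (\<omega> * 2 ^ DIM('a) / (1 - 2 powr (- 2 * r)) * (M * t powr (- 2 * r)))"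
proof -
  define l where "l n = t * 2 ^ n" for n
  define u where "u n = t * 2 ^ Suc n" for n
  have "gint (- cball 0 t) \<le> ennreal ((M * t powr (- 2 * r) * (\<omega> * 2 ^ DIM('a))) / (1 - 2 powr (- 2 * r)))"
  proof (rule gint_geometric[where l=l and u=u])
    show "- cball 0 t \<subseteq> insert (0::'a) (\<Union>n. shell (l n) (u n))"
    proof
      fix z :: 'a assume z: "z \<in> - cball 0 t"
      have "\<exists>n. norm z / t < 2 ^ n" by (rule real_arch_pow) simp
      then obtain n0 where "norm z < t * 2 ^ n0" using t by (auto simp: field_simps)
      moreover have "t * 2 ^ n0 \<le> u n0" using t by (simp add: u_def)
      ultimately have ex: "norm z \<le> u n0" by simp
      define n where "n = (LEAST n. norm z \<le> u n)"
      have "norm z \<le> u n" unfolding n_def by (rule LeastI[of "\<lambda>n. norm z \<le> u n", OF ex])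
      moreover have "l n < norm z"
      proof (cases n)
        case 0 then show ?thesis using z by (simp add: l_def)
      next
        case (Suc m)
        then have "\<not> norm z \<le> u m" using not_less_Least[of m "\<lambda>n. norm z \<le> u n"] by (simp add: n_def)
        then show ?thesis using Suc by (simp add: l_def u_def)
      qed
      ultimately show "z \<in> insert 0 (\<Union>n. shell (l n) (u n))" by (auto simp: shell_def)
    qed
    show "gint (shell (l n) (u n)) \<le> ennreal (M * t powr (- 2 * r) * (\<omega> * 2 ^ DIM('a)) * (2 powr (- 2 * r)) ^ n)" for n
    proof -
      have ln: "0 < l n" "u n = 2 * l n" using t by (auto simp: l_def u_def)
      have "gint (shell (l n) (u n)) \<le>
          ennreal (M * l n powr - b * (\<omega> * (u n ^ DIM('a) - l n ^ DIM('a))))"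
        by (rule gint_shell) (use ln M in auto)
      also have "\<dots> \<le> ennreal (M * l n powr - b * (\<omega> * u n ^ DIM('a)))"
        using ln M vol_nonneg by (intro ennreal_leI mult_left_mono) auto
      also have "M * l n powr - b * (\<omega> * u n ^ DIM('a)) =
          M * (\<omega> * 2 ^ DIM('a)) * (l n powr - b * l n powr DIM('a))"
        using ln by (simp add: powr_realpow power_mult_distrib)
      also have "l n powr - b * l n powr DIM('a) = l n powr (- 2 * r)"
        by (simp add: b_def flip: powr_add)
      also have "l n powr (- 2 * r) = t powr (- 2 * r) * (2 powr (- 2 * r)) ^ n"
      proof -
        have "l n powr (- 2 * r) = t powr (- 2 * r) * (2 ^ n) powr (- 2 * r)"
          using t by (simp add: l_def powr_mult)
        also have "((2::real) ^ n) powr (- 2 * r) = (2 powr (- 2 * r)) ^ n"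
          by (simp add: powr_powr mult.commute flip: powr_realpow)
        finally show ?thesis .
      qed
      finally show ?thesis by (simp add: algebra_simps)
    qed
    show "(2::real) powr (- 2 * r) < 1" using r by (simp add: powr_less_one)
  qed (use M vol_nonneg in auto)
  then show ?thesis by (simp add: algebra_simps)
qed

lemma gagliardo_eq_gint: "gagliardo r v = gint UNIV"
  by (simp add: gagliardo_eq_shift_modulus gint_def b_def)

lemma gint_Un_le:
  assumes "S \<in> sets borel" "S' \<in> sets borel"
  shows "gint (S \<union> S') \<le> gint S + gint S'"
proof -
  note [measurable] = assms
  have "gint S + gint S' = (\<integral>\<^sup>+ z. shift_modulus v z * ennreal (norm z powr - b) * indicator S z +
       shift_modulus v z * ennreal (norm z powr - b) * indicator S' z \<partial>lborel)"
    unfolding gint_def by (rule nn_integral_add[symmetric]) measurable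
  moreover have "gint (S \<union> S') \<le> \<dots>"
    unfolding gint_def by (intro nn_integral_mono) (auto simp: indicator_def)
  ultimately show ?thesis by simp
qed

lemma gint_mono: "S \<subseteq> S' \<Longrightarrow> gint S \<le> gint S'"
  unfolding gint_def by (intro nn_integral_mono) (auto simp: indicator_def)

lemma gint_UN_le:
  assumes "finite J" "\<And>j. j \<in> J \<Longrightarrow> S j \<in> sets borel"
  shows "gint (\<Union>j\<in>J. S j) \<le> (\<Sum>j\<in>J. gint (S j))"
  using assms
proof (induction J rule: finite_induct)
  case empty then show ?case by (simp add: gint_def)
next
  case (insert j J)
  have "gint (S j \<union> (\<Union>j\<in>J. S j)) \<le> gint (S j) + gint (\<Union>j\<in>J. S j)"
    using insert by (intro gint_Un_le sets.finite_UN) auto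
  also have "\<dots> \<le> gint (S j) + (\<Sum>j\<in>J. gint (S j))" using insert by (intro add_left_mono) auto
  finally show ?case using insert by simp
qed

lemma gagliardo_finite:
  assumes "0 \<le> G" "\<And>z. shift_modulus v z \<le> ennreal ((norm z)\<^sup>2 * G)"
    and "0 \<le> M" "\<And>z. shift_modulus v z \<le> ennreal M"
  shows "gagliardo r v < \<infinity>"
proof -
  have "gagliardo r v \<le> gint (cball 0 1) + gint (- cball 0 1)"
    using gint_Un_le[of "cball 0 1" "- cball 0 1"] by (simp add: gagliardo_eq_gint)
  also have "\<dots> < \<infinity>"
    using gint_cball_le[of 1 G] gint_outside_le[of 1 M] assms
    by (simp add: ennreal_add_less_top) (meson ennreal_less_top le_less_trans)
  finally show ?thesis .
qed

text \<open>Cutting the shifts at the nodes turns each shell into one term of the quadrature sum.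
  The factor \<open>4 * DIM('a)\<close> is the 8 of the modulus bound times the
  \<open>DIM('a) / 2\<close> of the shell volume.\<close>

lemma gagliardo_node_bound:
  assumes k: "0 < k" "k \<le> k0" and N: "- Nm \<le> Np"
    and G: "0 \<le> G" "\<And>z. shift_modulus v z \<le> ennreal ((norm z)\<^sup>2 * G)"
    and M: "0 \<le> M" "\<And>z. shift_modulus v z \<le> ennreal M"
    and K: "\<And>j. j \<in> {- Nm..Np} \<Longrightarrow> 0 \<le> K j"
      "\<And>j z. j \<in> {- Nm..Np} \<Longrightarrow> norm z \<le> t_node k j \<Longrightarrow> shift_modulus v z \<le> ennreal (8 * K j)"
  shows "gagliardo r v \<le> ennreal (
      \<omega> * 2 powr b / (1 - 2 powr (2 * r - 2)) * (G * t_node k Np powr (2 - 2 * r))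
    + \<omega> * 2 ^ DIM('a) / (1 - 2 powr (- 2 * r)) * (M * t_node k (- Nm) powr (- 2 * r))
    + \<omega> * 4 * DIM('a) * exp (b * k0 / 2) * (k * (\<Sum>j\<in>{- Nm..Np}. exp (r * y_node k j) * K j)))"
proof -
  let ?x = "\<omega> * 2 powr b / (1 - 2 powr (2 * r - 2)) * (G * t_node k Np powr (2 - 2 * r))"
  let ?y = "\<omega> * 2 ^ DIM('a) / (1 - 2 powr (- 2 * r)) * (M * t_node k (- Nm) powr (- 2 * r))"
  let ?z = "\<lambda>j. \<omega> * 4 * DIM('a) * exp (b * k0 / 2) * (k * (exp (r * y_node k j) * K j))"
  let ?J = "{- Nm..Np}"
  \<comment> \<open>The shell of the last node overlaps the inner ball; keeping it lets the shells
    run over the index set of the quadrature sum.\<close>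
  let ?sh = "\<lambda>j. shell (t_node k (j + 1)) (t_node k j) :: 'a set"
  have b0: "0 \<le> b" using r by (simp add: b_def)
  have cover: "UNIV \<subseteq> cball (0::'a) (t_node k Np) \<union> - cball 0 (t_node k (- Nm)) \<union> (\<Union>j\<in>?J. ?sh j)"
  proof
    fix z :: 'a
    show "z \<in> cball (0::'a) (t_node k Np) \<union> - cball 0 (t_node k (- Nm)) \<union> (\<Union>j\<in>?J. ?sh j)"
    proof (cases "norm z \<le> t_node k Np \<or> t_node k (- Nm) < norm z")
      case False
      then have z: "t_node k Np < norm z" "norm z \<le> t_node k (- Nm)" by auto
      have z0: "0 < norm z" using z(1) unfolding t_node_def using exp_gt_zero less_trans by blast
      \<comment> \<open>Solving exp(-j k / 2) \<ge> |z| for j; the floor of the bound is the index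
        of the shell that contains z.\<close>
      have iff: "norm z \<le> t_node k j \<longleftrightarrow> j \<le> \<lfloor>- 2 * ln (norm z) / k\<rfloor>" for j
      proof -
        have "norm z \<le> t_node k j \<longleftrightarrow> ln (norm z) \<le> - (real_of_int j * k) / 2"
          using z0 by (subst ln_le_cancel_iff[symmetric]) (auto simp: t_node_def y_node_def)
        also have "\<dots> \<longleftrightarrow> real_of_int j \<le> - 2 * ln (norm z) / k"
          unfolding pos_le_divide_eq[OF k(1)] by (rule iffI; linarith)
        finally show ?thesis by (simp add: le_floor_iff)
      qed
      define j where "j = \<lfloor>- 2 * ln (norm z) / k\<rfloor>"
      have "- Nm \<le> j" using z(2) iff[of "- Nm"] unfolding j_def by blast
      moreover have "\<not> Np \<le> j" using z(1) iff[of Np] unfolding j_def by (meson not_le)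
      moreover have "norm z \<le> t_node k j" using iff[of j] by (simp add: j_def)
      moreover have "\<not> norm z \<le> t_node k (j + 1)" using iff[of "j + 1"] by (simp add: j_def)
      ultimately have "j \<in> ?J" "z \<in> ?sh j" by (auto simp: shell_def)
      then show ?thesis by blast
    qed auto
  qed
  have sh: "gint (?sh j) \<le> ennreal (?z j)"
    if j: "j \<in> ?J" for j
  proof -
    let ?yj = "y_node k j"
    have t1: "t_node k (j + 1) = exp (- (?yj + k) / 2)" by (simp add: t_node_def y_node_def algebra_simps)
    have le: "t_node k (j + 1) \<le> t_node k j" using k by (simp add: t1, simp add: t_node_def)
    have "gint (?sh j) \<le> ennreal (8 * K j * t_node k (j + 1) powr - b *
        (\<omega> * (t_node k j ^ DIM('a) - t_node k (j + 1) ^ DIM('a))))"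
      by (rule gint_shell) (use K[OF j] le in \<open>auto simp: t1\<close>)
    also have "\<dots> \<le> ennreal (?z j)"
    proof (rule ennreal_leI)
      \<comment> \<open>The relative volume 1 - exp(-d k / 2) is at most d k / 2, and this is where
        the quadrature weight \<open>k\<close> comes from.\<close>
      have "t_node k j ^ DIM('a) - t_node k (j + 1) ^ DIM('a) = exp (- DIM('a) * ?yj / 2) * (1 - exp (- DIM('a) * k / 2))"
        unfolding t1 by (simp add: t_node_def algebra_simps add_divide_distrib flip: exp_of_nat_mult exp_add)
      also have "\<dots> \<le> exp (- DIM('a) * ?yj / 2) * (DIM('a) * k / 2)"
        using exp_ge_add_one_self[of "- DIM('a) * k / 2"] by (intro mult_left_mono) auto
      finally have 1: "t_node k j ^ DIM('a) - t_node k (j + 1) ^ DIM('a) \<le> exp (- DIM('a) * ?yj / 2) * (DIM('a) * k / 2)" .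
      \<comment> \<open>Moving the kernel from the inner to the outer radius costs exp(b k / 2),
        uniformly bounded for k \<le> k0.\<close>
      have "t_node k (j + 1) powr - b = exp (b * (?yj + k) / 2)" unfolding t1 by (simp add: powr_def algebra_simps)
      also have "\<dots> = exp (b * ?yj / 2) * exp (b * k / 2)" by (simp add: algebra_simps add_divide_distrib flip: exp_add)
      also have "\<dots> \<le> exp (b * ?yj / 2) * exp (b * k0 / 2)"
        using k b0 by (intro mult_left_mono) (auto intro: mult_left_mono)
      finally have 2: "t_node k (j + 1) powr - b \<le> exp (b * ?yj / 2) * exp (b * k0 / 2)" .
      have "8 * K j * t_node k (j + 1) powr - b * (\<omega> * (t_node k j ^ DIM('a) - t_node k (j + 1) ^ DIM('a)))
         \<le> 8 * K j * (exp (b * ?yj / 2) * exp (b * k0 / 2)) * (\<omega> * (exp (- DIM('a) * ?yj / 2) * (DIM('a) * k / 2)))"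
        using 1 2 K(1)[OF j] vol_nonneg k
          power_mono[OF le, of "DIM('a)"]
        by (intro mult_mono mult_nonneg_nonneg) (auto simp: t_node_def)
      \<comment> \<open>As b = d + 2 r, the part with d cancels against the volume of the shell and
        leaves the quadrature factor exp(r y).\<close>
      also have "exp (b * ?yj / 2) * exp (b * k0 / 2) = exp (r * ?yj) * exp (b * k0 / 2) * exp (DIM('a) * ?yj / 2)"
        by (simp add: b_def algebra_simps add_divide_distrib flip: exp_add)
      also have "8 * K j * \<dots> * (\<omega> * (exp (- DIM('a) * ?yj / 2) * (DIM('a) * k / 2)))
         = 8 * K j * (exp (r * ?yj) * exp (b * k0 / 2)) * (\<omega> * (DIM('a) * k / 2)) * (exp (DIM('a) * ?yj / 2) * exp (- DIM('a) * ?yj / 2))"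
        by (simp only: mult_ac)
      also have "exp (DIM('a) * ?yj / 2) * exp (- DIM('a) * ?yj / 2) = 1" by (simp flip: exp_add)
      finally show "8 * K j * t_node k (j + 1) powr - b * (\<omega> * (t_node k j ^ DIM('a) - t_node k (j + 1) ^ DIM('a)))
          \<le> ?z j"
        by (simp add: mult_ac)
    qed
    finally show ?thesis .
  qed
  have "gagliardo r v \<le> gint (cball 0 (t_node k Np)) + gint (- cball 0 (t_node k (- Nm))) + (\<Sum>j\<in>?J. gint (?sh j))"
  proof -
    have "gagliardo r v \<le> gint (cball (0::'a) (t_node k Np) \<union> - cball 0 (t_node k (- Nm)) \<union> (\<Union>j\<in>?J. ?sh j))"
      unfolding gagliardo_eq_gint by (rule gint_mono[OF cover])
    also have "\<dots> \<le> gint (cball (0::'a) (t_node k Np) \<union> - cball 0 (t_node k (- Nm))) + gint (\<Union>j\<in>?J. ?sh j)"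
      by (intro gint_Un_le sets.finite_UN sets.Un) auto
    also have "\<dots> \<le> gint (cball (0::'a) (t_node k Np)) + gint (- cball 0 (t_node k (- Nm))) + (\<Sum>j\<in>?J. gint (?sh j))"
      by (intro add_mono gint_Un_le gint_UN_le) auto
    finally show ?thesis .
  qed
  also have "\<dots> \<le> ennreal (?x)
     + ennreal (?y)
     + (\<Sum>j\<in>?J. ennreal (?z j))"
    by (intro add_mono gint_cball_le gint_outside_le sum_mono sh G M) (auto simp: t_node_def)
  also have "\<dots> = ennreal (
      ?x
    + ?y
    + (\<Sum>j\<in>?J. ?z j))"
  proof -
    have "0 \<le> 1 - (2::real) powr (2 * r - 2)" "0 \<le> 1 - (2::real) powr (- 2 * r)"
      using powr_less_one[of 2 "2 * r - 2"] powr_less_one[of 2 "- 2 * r"] r by simp_all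
    then have nn: "0 \<le> ?x"
      "0 \<le> ?y"
      using G M vol_nonneg by simp_all
    have nn3: "0 \<le> ?z j" if "j \<in> ?J" for j
      using K(1)[OF that] k vol_nonneg by simp
    show ?thesis by (rule ennreal_plus_sum[OF nn nn3])
  qed
  finally show ?thesis by (simp add: sum_distrib_left)
qed

end

section \<open>The energy of the Galerkin solution\<close>

text \<open>The Galerkin solution \<open>v\<close> minimizes \<open>\<parallel>f + v\<parallel>\<^sup>2 + t\<^sup>2 \<parallel>\<nabla>v\<parallel>\<^sup>2\<close> over the finite element space, and
  the minimum is the contribution of the node \<open>t\<close> to the discrete form. It plays the role of the
  squared K-functional of interpolation between \<open>L\<^sup>2\<close> and \<open>H\<^sup>1\<close>.\<close>

context fe_domain begin

definition galerkin_energy :: "real \<Rightarrow> ('a \<Rightarrow> real) \<Rightarrow> real" where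
  "galerkin_energy t f = (LINT x|lborel. (f x + fe_solution A TT t f x)\<^sup>2)
     + t\<^sup>2 * energy (fe_solution A TT t f)"

lemma galerkin_energy_nonneg: "0 \<le> galerkin_energy t f"
  unfolding galerkin_energy_def by (intro add_nonneg_nonneg mult_nonneg_nonneg energy_nonneg) auto

lemma L2_inner_galerkin:
  assumes f: "f \<in> V" and D: "\<And>x. x \<notin> D \<Longrightarrow> f x = 0"
  shows "L2_inner D (\<lambda>x. f x + fe_solution A TT t f x) f = galerkin_energy t f"
proof -
  have "L2_inner D (\<lambda>x. f x + fe_solution A TT t f x) f = (LINT x|lborel. (f x + fe_solution A TT t f x) * f x)"
    by (rule L2_inner_eq[OF V_add[OF f fe_solution_mem[OF f]] f]) (use D in auto)
  then show ?thesis by (simp add: fe_solution_energy[OF f] galerkin_energy_def)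
qed

lemma shift_modulus_eq:
  assumes "f \<in> V"
  shows "shift_modulus f z = ennreal (LINT x|lborel. (f (x + z) - f x)\<^sup>2)"
  unfolding shift_modulus_def
  using V_translate_diff_integrable[OF assms, of z 0] by (intro nn_integral_eq_integral) auto

lemma shift_modulus_le_energy:
  assumes "f \<in> V"
  shows "shift_modulus f z \<le> ennreal ((norm z)\<^sup>2 * energy f)"
  unfolding shift_modulus_eq[OF assms] by (intro ennreal_leI translate_diff_le_energy assms)

lemma translate_diff_le_L2:
  assumes f: "f \<in> V"
  shows "(LINT x|lborel. (f (x + z) - f x)\<^sup>2) \<le> 4 * norm2_sq f"
proof -
  note [measurable] = V_measurable[OF f]
  have "(LINT x|lborel. (f (x + z) - f x)\<^sup>2) \<le> (LINT x|lborel. 2 * ((f (x + z))\<^sup>2 + (f x)\<^sup>2))"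
    using V_translate_diff_integrable[OF f, of z 0] V_integrable_sq[OF f]
      integrable_lborel_translate[OF V_integrable_sq[OF f], of z]
    by (intro integral_mono) (auto simp: power2_diff_le[simplified])
  also have "\<dots> = 4 * norm2_sq f"
    using V_integrable_sq[OF f] integrable_lborel_translate[OF V_integrable_sq[OF f], of z]
      integral_lborel_translate[of "\<lambda>x. (f x)\<^sup>2" z] by simp
  finally show ?thesis .
qed

text \<open>With w = f + v, split f = w - v: \<open>w\<close> is measured in L2, and
  \<open>v\<close> by its energy. In the range |z| \<le> 2 t both parts get the same factor 8; at t
  = 1 it admits a shift of length 2, which exceeds the diameter of \<open>D\<close>.\<close>

lemma translate_diff_le_galerkin:
  assumes f: "f \<in> V" and z: "norm z \<le> 2 * t"
  shows "(LINT x|lborel. (f (x + z) - f x)\<^sup>2) \<le> 8 * galerkin_energy t f"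
proof -
  define v where "v = fe_solution A TT t f"
  have v: "v \<in> V" unfolding v_def by (rule fe_solution_mem[OF f])
  define w where "w = (\<lambda>x. f x + v x)"
  have w: "w \<in> V" unfolding w_def by (rule V_add[OF f v])
  have "(LINT x|lborel. (f (x + z) - f x)\<^sup>2) \<le>
      (LINT x|lborel. 2 * ((w (x + z) - w x)\<^sup>2 + (v (x + z) - v x)\<^sup>2))"
  proof (rule integral_mono)
    fix x
    have "f (x + z) - f x = (w (x + z) - w x) - (v (x + z) - v x)" by (simp add: w_def)
    then show "(f (x + z) - f x)\<^sup>2 \<le> 2 * ((w (x + z) - w x)\<^sup>2 + (v (x + z) - v x)\<^sup>2)"
      by (simp only: power2_diff_le)
  qed (use V_translate_diff_integrable[of _ z 0] f v w in auto)
  also have "\<dots> = 2 * (LINT x|lborel. (w (x + z) - w x)\<^sup>2) + 2 * (LINT x|lborel. (v (x + z) - v x)\<^sup>2)"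
    using V_translate_diff_integrable[OF v, of z 0] V_translate_diff_integrable[OF w, of z 0] by simp
  also have "\<dots> \<le> 2 * (4 * norm2_sq w) + 2 * ((2 * t)\<^sup>2 * energy v)"
  proof -
    have "(norm z)\<^sup>2 * energy v \<le> (2 * t)\<^sup>2 * energy v"
      using z by (intro mult_right_mono power_mono energy_nonneg) auto
    then show ?thesis using translate_diff_le_L2[OF w, of z] translate_diff_le_energy[OF v, of z] by linarith
  qed
  also have "\<dots> = 8 * galerkin_energy t f" by (simp add: galerkin_energy_def v_def w_def power_mult_distrib)
  finally show ?thesis .
qed

lemma shift_modulus_le_galerkin:
  assumes "f \<in> V" "norm z \<le> t"
  shows "shift_modulus f z \<le> ennreal (8 * galerkin_energy t f)"
  unfolding shift_modulus_eq[OF assms(1)]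
  using norm_ge_zero[of z] assms by (intro ennreal_leI translate_diff_le_galerkin) linarith+

text \<open>The same splitting f = w - v: t^2 times the energy of \<open>v\<close> is part of the
  Galerkin energy already, and that of \<open>w\<close> falls under the inverse estimate because
  \<open>t\<close> is at most a multiple of the inradius.\<close>

lemma energy_le_galerkin:
  assumes f: "f \<in> V" and r: "0 < r" "\<And>T. T \<in> TT \<Longrightarrow> \<exists>x0. cball x0 r \<subseteq> T"
    and t: "0 \<le> t" "t \<le> C * r"
  shows "t\<^sup>2 * energy f \<le> (32 * 2 ^ DIM('a) * C\<^sup>2 + 2) * galerkin_energy t f"
proof -
  define v where "v = fe_solution A TT t f"
  have v: "v \<in> V" unfolding v_def by (rule fe_solution_mem[OF f])
  define w where "w = (\<lambda>x. f x + v x)"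
  have w: "w \<in> V" unfolding w_def by (rule V_add[OF f v])
  have "energy f \<le> 2 * energy w + 2 * energy v"
    using energy_diff_le[OF w v] by (simp add: w_def)
  then have "t\<^sup>2 * energy f \<le> t\<^sup>2 * (2 * energy w + 2 * energy v)" by (intro mult_left_mono) auto
  also have "\<dots> = 2 * (t\<^sup>2 * energy w) + 2 * (t\<^sup>2 * energy v)" by (simp add: algebra_simps)
  also have "t\<^sup>2 * energy w \<le> (C * r)\<^sup>2 * energy w"
    using t by (intro mult_right_mono power_mono energy_nonneg) auto
  also have "(C * r)\<^sup>2 * energy w = C\<^sup>2 * (r\<^sup>2 * energy w)" by (simp add: power_mult_distrib)
  also have "\<dots> \<le> C\<^sup>2 * (16 * 2 ^ DIM('a) * norm2_sq w)"
    using inverse_estimate[OF w r] by (intro mult_left_mono) auto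
  also have "2 * (C\<^sup>2 * (16 * 2 ^ DIM('a) * norm2_sq w)) + 2 * (t\<^sup>2 * energy v) \<le>
     (32 * 2 ^ DIM('a) * C\<^sup>2 + 2) * (norm2_sq w + t\<^sup>2 * energy v)"
    using energy_nonneg[of v] by (simp add: algebra_simps)
  finally show ?thesis by (simp add: galerkin_energy_def v_def w_def)
qed

lemma L2_le_galerkin:
  assumes f: "f \<in> V" and D: "\<And>x. x \<notin> D \<Longrightarrow> f x = 0" "\<And>x y. x \<in> D \<Longrightarrow> y \<in> D \<Longrightarrow> dist x y \<le> 1"
  shows "norm2_sq f \<le> 4 * galerkin_energy 1 f"
proof -
  obtain e :: 'a where e: "e \<in> Basis" using nonempty_Basis by blast
  \<comment> \<open>As \<open>z\<close> is longer than the diameter of \<open>D\<close>, \<open>f\<close> and its translate have disjoint supports.\<close>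
  define z where "z = 2 *\<^sub>R e"
  note [measurable] = V_measurable[OF f]
  have nz: "norm z = 2" using e by (simp add: z_def)
  have "(f (x + z) - f x)\<^sup>2 = (f (x + z))\<^sup>2 + (f x)\<^sup>2" for x
  proof -
    have "\<not> (x + z \<in> D \<and> x \<in> D)" using D(2)[of "x + z" x] nz by (auto simp: dist_norm)
    then show ?thesis using D(1) by (auto simp: power2_diff)
  qed
  then have "(LINT x|lborel. (f (x + z) - f x)\<^sup>2) = 2 * norm2_sq f"
    using V_integrable_sq[OF f] integrable_lborel_translate[OF V_integrable_sq[OF f], of z]
      integral_lborel_translate[of "\<lambda>x. (f x)\<^sup>2" z] by simp
  then show ?thesis using translate_diff_le_galerkin[OF f, of z 1] nz by simp
qed

end

section \<open>The discrete form of a fixed finite element function\<close>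

lemma truncated_domain_props:
  fixes Om :: "'a::euclidean_space set"
  assumes Om: "open Om" "bounded Om" "convex Om" "0 \<in> Om" and M: "0 < M" and t: "0 < t"
  shows "open (truncated_domain Om M t)" "bounded (truncated_domain Om M t)"
    "convex (truncated_domain Om M t)" "Om \<subseteq> truncated_domain Om M t"
proof -
  define c where "c = (if t \<ge> 1 then 1 + t * (1 + M) else 2 + M)"
  have c: "1 \<le> c" using M t by (auto simp: c_def)
  have eq: "truncated_domain Om M t = (\<lambda>x. c *\<^sub>R x) ` Om" by (simp add: truncated_domain_def c_def)
  show "open (truncated_domain Om M t)" "bounded (truncated_domain Om M t)" "convex (truncated_domain Om M t)"
    unfolding eq using c Om by (auto intro: open_scaling bounded_scaling convex_scaling)
  show "Om \<subseteq> truncated_domain Om M t"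
  proof
    fix x assume "x \<in> Om"
    then have "(1 / c) *\<^sub>R x + (1 - 1 / c) *\<^sub>R 0 \<in> Om" using Om c by (intro convexD) auto
    then have "c *\<^sub>R ((1 / c) *\<^sub>R x) \<in> truncated_domain Om M t" unfolding eq by (intro imageI) simp
    then show "x \<in> truncated_domain Om M t" using c by simp
  qed
qed

text \<open>One choice of spacing, meshes and function. The signs of \<open>Nm\<close> and
  \<open>Np\<close> guarantee that the node j = 0, that is t = 1, is present.\<close>

locale discrete_setting =
  fixes D Om :: "'a::euclidean_space set" and k M h \<sigma> \<rho> :: real and Nm Np :: int
    and TD :: "'a set set" and TO :: "int \<Rightarrow> 'a set set" and \<eta> :: "'a \<Rightarrow> real"
  assumes open_D: "open D" and D_Om: "D \<subseteq> Om"
    and Om: "open Om" "bounded Om" "convex Om" "0 \<in> Om" "diameter Om = 1"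
    and k: "0 < k" and M: "0 < M" and h: "0 < h" and N: "0 \<le> Nm" "0 \<le> Np"
    and mesh_D: "fe_mesh \<sigma> \<rho> D h TD"
    and mesh_TO: "\<And>j. j \<in> {- Nm..Np} \<Longrightarrow> fe_mesh \<sigma> \<rho> (truncated_domain Om M (t_node k j)) h (TO j)"
    and TD_TO: "\<And>j. j \<in> {- Nm..Np} \<Longrightarrow> TD \<subseteq> TO j"
    and eta: "\<eta> \<in> fe_space D TD"
begin

abbreviation "A j \<equiv> truncated_domain Om M (t_node k j)"
abbreviation "J \<equiv> {- Nm..Np}"

lemma t_node_pos: "0 < t_node k j" by (simp add: t_node_def)

lemma fe_domain_A: "j \<in> J \<Longrightarrow> fe_domain (A j) (TO j)"
  using fe_mesh_fe_domain[OF mesh_TO h] truncated_domain_props[OF Om(1-4) M t_node_pos] by blast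

lemma eta_zero: "x \<notin> D \<Longrightarrow> \<eta> x = 0" using eta by (simp add: fe_space_def)

lemma zext_eta: "zext D \<eta> = \<eta>" using eta_zero by (auto simp: zext_def)

lemma eta_A:
  assumes "j \<in> J"
  shows "\<eta> \<in> fe_space (A j) (TO j)"
proof (rule fe_space_mono[OF eta open_D])
  show "D \<subseteq> A j" using D_Om truncated_domain_props(4)[OF Om(1-4) M t_node_pos] by blast
  show "\<Union>TD = closure D" using mesh_D by (simp add: fe_mesh_def simplicial_subdivision_def)
qed (use fe_domain_A TD_TO assms in auto)

lemma eta_measurable: "\<eta> \<in> borel_measurable borel"
  using fe_space_continuous[OF open_D eta] borel_measurable_continuous_onI by blast

lemma zero_J: "0 \<in> J" using N by simp

text \<open>\<open>K j\<close> is already the square of the K-functional at the node.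
  \<open>G\<close> is taken over the whole space, so that it equals the energy of \<eta> on each of
  the meshes. \<open>S s\<close> is the discrete form without the factor
  \<open>c_quad s / 2\<close>.\<close>

definition "K j = fe_domain.galerkin_energy (A j) (TO j) (t_node k j) \<eta>"
definition "G = dirichlet_form UNIV \<eta> \<eta>"
definition "S s = k * (\<Sum>j\<in>J. exp (s * y_node k j) * K j)"

lemma energy_eta: "j \<in> J \<Longrightarrow> fe_domain.energy (TO j) \<eta> = G"
  unfolding G_def by (rule fe_domain.energy_UNIV[OF fe_domain_A eta_A])

lemma K_nonneg: "j \<in> J \<Longrightarrow> 0 \<le> K j"
  unfolding K_def by (rule fe_domain.galerkin_energy_nonneg[OF fe_domain_A])

lemma G_nonneg: "0 \<le> G"
  using energy_eta[OF zero_J] fe_domain.energy_nonneg[OF fe_domain_A[OF zero_J]] by metis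

lemma form_ah_eq: "form_ah s k Nm Np D Om M TO \<eta> \<eta> = c_quad s / 2 * S s"
proof -
  have "L2_inner D (\<lambda>x. \<eta> x + fe_solution (A j) (TO j) (t_node k j) \<eta> x) \<eta> = K j" if "j \<in> J" for j
    unfolding K_def by (rule fe_domain.L2_inner_galerkin[OF fe_domain_A[OF that] eta_A[OF that] eta_zero])
  then show ?thesis by (simp add: form_ah_def zext_eta S_def)
qed

lemma S_nonneg: "0 \<le> S s"
  unfolding S_def using k K_nonneg by (intro mult_nonneg_nonneg sum_nonneg) auto

lemma Htilde_norm_sq:
  assumes "0 < r" "r < 1"
  shows "(Htilde_norm D r \<eta>)\<^sup>2 = frac_const DIM('a) r / 2 * enn2real (gagliardo r \<eta>)"
    and "0 < frac_const DIM('a) r"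
proof -
  show "0 < frac_const DIM('a) r"
    using assms by (auto simp: frac_const_def intro!: divide_pos_pos mult_pos_pos Gamma_real_pos add_nonneg_pos)
  then show "(Htilde_norm D r \<eta>)\<^sup>2 = frac_const DIM('a) r / 2 * enn2real (gagliardo r \<eta>)"
    using assms by (simp add: Htilde_norm_def zext_eta gagliardo_def)
qed

lemma modulus_le_G: "shift_modulus \<eta> z \<le> ennreal ((norm z)\<^sup>2 * G)"
  using fe_domain.shift_modulus_le_energy[OF fe_domain_A[OF zero_J] eta_A[OF zero_J]]
    energy_eta[OF zero_J] by metis

text \<open>The node j = 0 has t = 1, which matches \<open>diameter Om = 1\<close> in
  \<open>L2_le_galerkin\<close>; 16 is the product of the 4 there and the 4 of the trivial bound for
  translates.\<close>

lemma modulus_le_K0: "shift_modulus \<eta> z \<le> ennreal (16 * K 0)"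
proof -
  interpret fe_domain "A 0" "TO 0" by (rule fe_domain_A[OF zero_J])
  have e: "\<eta> \<in> V" by (rule eta_A[OF zero_J])
  have "dist x y \<le> 1" if "x \<in> D" "y \<in> D" for x y
    using diameter_bounded_bound[of Om x y] that D_Om Om by auto
  then have "norm2_sq \<eta> \<le> 4 * galerkin_energy 1 \<eta>"
    using L2_le_galerkin[OF e eta_zero] by blast
  moreover have "t_node k 0 = 1" by (simp add: t_node_def y_node_def)
  ultimately have "4 * norm2_sq \<eta> \<le> 16 * K 0" by (simp add: K_def)
  then show ?thesis unfolding shift_modulus_eq[OF e]
    by (intro ennreal_leI order_trans[OF translate_diff_le_L2[OF e]])
qed

lemma modulus_le_K: "j \<in> J \<Longrightarrow> norm z \<le> t_node k j \<Longrightarrow> shift_modulus \<eta> z \<le> ennreal (8 * K j)"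
  unfolding K_def by (rule fe_domain.shift_modulus_le_galerkin[OF fe_domain_A eta_A])

text \<open>The exponential factor is 1 at j = 0, but the weight \<open>k\<close> remains. Any use
  of \<open>K 0\<close> against \<open>S s\<close> therefore has to supply a factor
  \<open>k\<close>.\<close>

lemma K0_le_S: "k * K 0 \<le> S s"
proof -
  have "(\<Sum>j\<in>{0}. exp (s * y_node k j) * K j) \<le> (\<Sum>j\<in>J. exp (s * y_node k j) * K j)"
    using zero_J K_nonneg by (intro sum_mono2) auto
  then show ?thesis unfolding S_def using k by (intro mult_left_mono) (auto simp: y_node_def)
qed

lemma G_le_K:
  assumes j: "j \<in> J" and t: "t_node k j \<le> C * h"
  shows "(t_node k j)\<^sup>2 * G \<le> (32 * 2 ^ DIM('a) * (2 * C * \<sigma> * \<rho>)\<^sup>2 + 2) * K j"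
proof -
  interpret fe_domain "A j" "TO j" by (rule fe_domain_A[OF j])
  \<comment> \<open>The mesh has at least one element, from which the signs of \<sigma> and \<rho>
    are read off.\<close>
  have "0 \<in> \<Union>(TO j)" unfolding Union_TT
    using truncated_domain_props(4)[OF Om(1-4) M t_node_pos, of j] Om(4) closure_subset by blast
  then have "TO j \<noteq> {}" by auto
  then obtain T where "T \<in> TO j" by blast
  then have pos: "0 < \<sigma>" "0 < \<rho>" using fe_mesh_ball[OF mesh_TO[OF j] _ h] by blast+
  have "(t_node k j)\<^sup>2 * energy \<eta> \<le> (32 * 2 ^ DIM('a) * (2 * C * \<sigma> * \<rho>)\<^sup>2 + 2) * galerkin_energy (t_node k j) \<eta>"
  proof (rule energy_le_galerkin[OF eta_A[OF j], where r="h / (2 * \<sigma> * \<rho>)"])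
    show "\<exists>x0. cball x0 (h / (2 * \<sigma> * \<rho>)) \<subseteq> T" if "T \<in> TO j" for T
      using fe_mesh_ball[OF mesh_TO[OF j] that h] by blast
    show "t_node k j \<le> 2 * C * \<sigma> * \<rho> * (h / (2 * \<sigma> * \<rho>))" using t pos by simp
    show "0 \<le> t_node k j" using t_node_pos[of j] by simp
  qed (use h pos in auto)
  then show ?thesis by (simp add: energy_eta[OF j] K_def)
qed

text \<open>About \<open>b / k\<close> nodes lie within a factor \<open>exp (b / 2)\<close> of the smallest one. Their number
  compensates the quadrature weight \<open>k\<close>.\<close>

lemma G_le_S:
  assumes s: "0 < s" "s < 1" and b: "0 \<le> b" "b / k \<le> Np"
    and t: "t_node k Np * exp (b / 2) \<le> C * h"
  shows "b * (G * t_node k Np powr (2 - 2 * s)) \<le> (32 * 2 ^ DIM('a) * (2 * C * \<sigma> * \<rho>)\<^sup>2 + 2) * S s"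
proof -
  define m where "m = \<lfloor>b / k\<rfloor>"
  define J' where "J' = {Np - m..Np}"
  define Ci where "Ci = 32 * 2 ^ DIM('a) * (2 * C * \<sigma> * \<rho>)\<^sup>2 + 2"
  let ?\<tau> = "t_node k Np"
  have m0: "0 \<le> m" using b k by (simp add: m_def)
  have mNp: "m \<le> Np" unfolding m_def using b(2) by linarith
  have sub: "J' \<subseteq> J" using mNp N by (auto simp: J'_def)
  have mk: "of_int m * k \<le> b"
    using of_int_floor_le[of "b / k"] unfolding m_def pos_le_divide_eq[OF k] .
  have key: "G * ?\<tau> powr (2 - 2 * s) \<le> Ci * (exp (s * y_node k j) * K j)" if j: "j \<in> J'" for j
  proof -
    have jN: "Np - m \<le> j" "j \<le> Np" using j by (auto simp: J'_def)
    have lo: "?\<tau> \<le> t_node k j" using jN k by (simp add: t_node_def y_node_def)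
    have "real_of_int (Np - j) * k \<le> of_int m * k" using jN k by (intro mult_right_mono) auto
    then have "real_of_int (Np - j) * k \<le> b" using mk by linarith
    then have "t_node k j \<le> ?\<tau> * exp (b / 2)"
      by (simp add: t_node_def y_node_def algebra_simps flip: exp_add)
    then have "t_node k j \<le> C * h" using t by linarith
    then have 1: "(t_node k j)\<^sup>2 * G \<le> Ci * K j" unfolding Ci_def using G_le_K j sub by blast
    have e: "exp (s * y_node k j) = t_node k j powr (- 2 * s)" by (simp add: t_node_def powr_def)
    \<comment> \<open>The exponent 2 - 2 s is positive, so the smallest node may be replaced by
      \<open>t_node k j\<close>; then t^(-2 s) is the quadrature factor and t^2 is absorbed by
      \<open>G_le_K\<close>.\<close>
    have "G * ?\<tau> powr (2 - 2 * s) \<le> G * t_node k j powr (2 - 2 * s)"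
      using lo s t_node_pos[of Np] by (intro mult_left_mono powr_mono2 G_nonneg) auto
    also have "t_node k j powr (2 - 2 * s) = t_node k j powr 2 * t_node k j powr (- 2 * s)"
      by (simp flip: powr_add)
    also have "G * (t_node k j powr 2 * t_node k j powr (- 2 * s)) = ((t_node k j)\<^sup>2 * G) * exp (s * y_node k j)"
      using t_node_pos[of j] by (simp add: e powr_numeral)
    also have "\<dots> \<le> (Ci * K j) * exp (s * y_node k j)" using 1 by (intro mult_right_mono) auto
    finally show ?thesis by (simp add: mult_ac)
  qed
  have "b \<le> k * real (card J')"
  proof -
    \<comment> \<open>Both end points count, so there are at least \<open>b / k\<close> nodes even
      when b < k.\<close>
    have "b / k \<le> of_int m + 1" unfolding m_def by linarith
    moreover have "real (card J') = of_int m + 1" using m0 by (simp add: J'_def)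
    ultimately have "b / k \<le> real (card J')" by simp
    then show ?thesis using k by (simp add: field_simps)
  qed
  then have "b * (G * ?\<tau> powr (2 - 2 * s)) \<le> k * real (card J') * (G * ?\<tau> powr (2 - 2 * s))"
    by (intro mult_right_mono mult_nonneg_nonneg G_nonneg) auto
  also have "\<dots> = k * (\<Sum>j\<in>J'. G * ?\<tau> powr (2 - 2 * s))" by simp
  also have "\<dots> \<le> k * (\<Sum>j\<in>J'. Ci * (exp (s * y_node k j) * K j))"
    using k key by (intro mult_left_mono sum_mono) auto
  also have "\<dots> \<le> k * (\<Sum>j\<in>J. Ci * (exp (s * y_node k j) * K j))"
    using k sub K_nonneg by (intro mult_left_mono sum_mono2) (auto simp: Ci_def)
  also have "\<dots> = Ci * S s" by (simp add: S_def sum_distrib_left mult_ac)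
  finally show ?thesis by (simp add: Ci_def)
qed

text \<open>\<open>enn2real\<close> sends infinity to 0, so a vanishing norm is informative only
  together with finiteness.\<close>

lemma gagliardo_finite_eta: "0 < r \<Longrightarrow> r < 1 \<Longrightarrow> gagliardo r \<eta> < \<infinity>"
  using gagliardo_finite[OF eta_measurable _ _ G_nonneg modulus_le_G _ modulus_le_K0] K_nonneg[OF zero_J] by auto

end

section \<open>The Fourier transform of Lipschitz functions with compact support\<close>

lemma integral_lborel_scale:
  fixes f :: "'a::euclidean_space \<Rightarrow> 'b::{banach, second_countable_topology}"
  assumes [measurable]: "f \<in> borel_measurable borel" and c: "0 < c"
  shows "(LINT x|lborel. f x) = (c ^ DIM('a)) *\<^sub>R (LINT x|lborel. f (t + c *\<^sub>R x))"
proof -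
  have "(LINT x|lborel. f x) = (LINT x|density (distr lborel borel (\<lambda>x. t + c *\<^sub>R x)) (\<lambda>_. \<bar>c\<bar>^DIM('a)). f x)"
    using lborel_affine[of c t] c by simp
  also have "\<dots> = (c ^ DIM('a)) *\<^sub>R (LINT x|distr lborel borel (\<lambda>x. t + c *\<^sub>R x). f x)"
    using c by (subst integral_density) auto
  also have "(LINT x|distr lborel borel (\<lambda>x. t + c *\<^sub>R x). f x) = (LINT x|lborel. f (t + c *\<^sub>R x))"
    by (subst integral_distr) auto
  finally show ?thesis .
qed

lemma integrable_lborel_scale:
  fixes f :: "'a::euclidean_space \<Rightarrow> 'b::{banach, second_countable_topology}"
  assumes f: "integrable lborel f" and c: "0 < c"
  shows "integrable lborel (\<lambda>x. f (c *\<^sub>R x))"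
proof -
  have m: "f \<in> borel_measurable borel" using f by (auto dest: borel_measurable_integrable)
  have "integrable (density (distr lborel borel (\<lambda>x. 0 + c *\<^sub>R x)) (\<lambda>_. \<bar>c\<bar>^DIM('a))) f"
    using f lborel_affine[of c "0::'a"] c by simp
  then have "integrable (distr lborel borel (\<lambda>x. 0 + c *\<^sub>R x)) (\<lambda>x. (\<bar>c\<bar>^DIM('a)) *\<^sub>R f x)"
    using m by (subst (asm) integrable_density) auto
  then have "integrable lborel (\<lambda>x. (\<bar>c\<bar>^DIM('a)) *\<^sub>R f (c *\<^sub>R x))"
    using m by (subst (asm) integrable_distr_eq) auto
  then have "integrable lborel (\<lambda>x. (1 / c ^ DIM('a)) *\<^sub>R (\<bar>c\<bar>^DIM('a)) *\<^sub>R f (c *\<^sub>R x))"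
    by (rule integrable_scaleR_right)
  then show ?thesis using c by simp
qed

lemma
  fixes \<phi> :: "'a::euclidean_space \<Rightarrow> real \<Rightarrow> 'b::{real_normed_field, banach, second_countable_topology}"
  assumes \<phi>: "\<And>b. b \<in> Basis \<Longrightarrow> integrable lborel (\<phi> b)"
  shows integrable_lborel_Basis_prod: "integrable lborel (\<lambda>x::'a. \<Prod>b\<in>Basis. \<phi> b (x \<bullet> b))"
    and integral_lborel_Basis_prod:
      "(LINT x|lborel. (\<Prod>b\<in>Basis. \<phi> b (x \<bullet> b))) = (\<Prod>b\<in>Basis. LINT t|lborel. \<phi> b t)"
proof -
  let ?P = "\<Pi>\<^sub>M b\<in>(Basis::'a set). (lborel :: real measure)"
  let ?g = "\<lambda>f. \<Sum>b\<in>(Basis::'a set). f b *\<^sub>R b"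
  interpret product_sigma_finite "\<lambda>b::'a. lborel :: real measure" ..
  have m: "(\<lambda>x::'a. \<Prod>b\<in>Basis. \<phi> b (x \<bullet> b)) \<in> borel_measurable borel"
  proof (rule borel_measurable_prod)
    fix b :: 'a assume b: "b \<in> Basis"
    have [measurable]: "\<phi> b \<in> borel_measurable borel" using \<phi>[OF b] by (auto dest: borel_measurable_integrable)
    show "(\<lambda>x. \<phi> b (x \<bullet> b)) \<in> borel_measurable borel" by measurable
  qed
  have g: "?g \<in> measurable ?P borel" by measurable
  have eq: "(\<lambda>f. \<Prod>b\<in>(Basis::'a set). \<phi> b (?g f \<bullet> b)) = (\<lambda>f. \<Prod>b\<in>Basis. \<phi> b (f b))"
    by (intro ext prod.cong refl) (simp add: inner_sum_left inner_Basis if_distrib cong: if_cong)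
  have "integrable ?P (\<lambda>f. \<Prod>b\<in>(Basis::'a set). \<phi> b (?g f \<bullet> b))"
    unfolding eq by (rule product_integrable_prod) (use \<phi> in auto)
  then show "integrable lborel (\<lambda>x::'a. \<Prod>b\<in>Basis. \<phi> b (x \<bullet> b))"
    by (subst lborel_eq) (subst integrable_distr_eq[OF g m])
  have "(LINT x|lborel. (\<Prod>b\<in>Basis. \<phi> b (x \<bullet> b))) = (LINT f|?P. (\<Prod>b\<in>(Basis::'a set). \<phi> b (?g f \<bullet> b)))"
    by (subst lborel_eq) (rule integral_distr[OF g m])
  also have "\<dots> = (\<Prod>b\<in>(Basis::'a set). LINT t|lborel. \<phi> b t)"
    unfolding eq by (rule product_integral_prod) (use \<phi> in auto)
  finally show "(LINT x|lborel. (\<Prod>b\<in>Basis. \<phi> b (x \<bullet> b))) = (\<Prod>b\<in>Basis. LINT t|lborel. \<phi> b t)" .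
qed

section \<open>Gaussian integrals\<close>

definition gauss :: "'a::euclidean_space \<Rightarrow> real" where
  "gauss u = exp (- (norm u)\<^sup>2 / 2)"

text \<open>Up to the factor sqrt(2 pi), the integral is the characteristic function of the standard
  normal distribution.\<close>

lemma gauss_1d:
  shows "integrable lborel (\<lambda>t. complex_of_real (exp (- t\<^sup>2 / 2)) * cis (t * s))" (is ?A)
    and "(LINT t|lborel. complex_of_real (exp (- t\<^sup>2 / 2)) * cis (t * s)) =
           complex_of_real (sqrt (2 * pi) * exp (- s\<^sup>2 / 2))" (is ?B)
proof -
  have eq: "complex_of_real (exp (- t\<^sup>2 / 2)) * cis (t * s) =
      complex_of_real (sqrt (2 * pi)) * (std_normal_density t *\<^sub>R iexp (s * t))" for t
    by (simp add: std_normal_density_def cis_conv_exp scaleR_conv_of_real mult_ac)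
  have int: "integrable lborel (\<lambda>t. std_normal_density t *\<^sub>R iexp (s * t))"
  proof (rule Bochner_Integration.integrable_bound)
    show "integrable lborel std_normal_density" using integrable_std_normal_moment[of 0] by simp
  qed (auto simp: normal_density_nonneg norm_exp_i_times)
  have "char std_normal_distribution s = (LINT t|lborel. std_normal_density t *\<^sub>R iexp (s * t))"
    unfolding char_def by (subst integral_density) (auto simp: normal_density_nonneg)
  then have B: "(LINT t|lborel. std_normal_density t *\<^sub>R iexp (s * t)) = complex_of_real (exp (- s\<^sup>2 / 2))"
    by (simp only: char_std_normal_distribution)
  show ?A unfolding eq by (rule Bochner_Integration.integrable_mult_right[OF int])
  show ?B unfolding eq Bochner_Integration.integral_mult_right_zero B by simp
qed

lemma gauss_cis_prod:
  fixes u w :: "'a::euclidean_space"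
  shows "complex_of_real (gauss u) * cis (u \<bullet> w) =
    (\<Prod>b\<in>Basis. complex_of_real (exp (- (u \<bullet> b)\<^sup>2 / 2)) * cis ((u \<bullet> b) * (w \<bullet> b)))"
proof -
  have "complex_of_real (gauss u) * cis (u \<bullet> w) =
      exp (complex_of_real (- (norm u)\<^sup>2 / 2) + \<i> * complex_of_real (u \<bullet> w))"
    by (simp add: gauss_def cis_conv_exp mult_exp_exp algebra_simps flip: exp_of_real)
  also have "complex_of_real (- (norm u)\<^sup>2 / 2) + \<i> * complex_of_real (u \<bullet> w) =
      (\<Sum>b\<in>Basis. complex_of_real (- (u \<bullet> b)\<^sup>2 / 2) + \<i> * complex_of_real ((u \<bullet> b) * (w \<bullet> b)))"
  proof -
    have "(norm u)\<^sup>2 = (\<Sum>b\<in>Basis. (u \<bullet> b)\<^sup>2)"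
      unfolding power2_norm_eq_inner euclidean_inner[of u u] by (simp add: power2_eq_square)
    then show ?thesis
      by (subst euclidean_inner[of u w]) (simp add: sum.distrib sum_subtractf sum_distrib_left sum_negf sum_divide_distrib)
  qed
  also have "exp \<dots> = (\<Prod>b\<in>Basis. exp (complex_of_real (- (u \<bullet> b)\<^sup>2 / 2) + \<i> * complex_of_real ((u \<bullet> b) * (w \<bullet> b))))"
    by (rule exp_sum) simp
  also have "\<dots> = (\<Prod>b\<in>Basis. complex_of_real (exp (- (u \<bullet> b)\<^sup>2 / 2)) * cis ((u \<bullet> b) * (w \<bullet> b)))"
    by (intro prod.cong refl) (simp add: cis_conv_exp mult_exp_exp algebra_simps flip: exp_of_real)
  finally show ?thesis .
qed

lemma gauss_cis_integral:
  fixes w :: "'a::euclidean_space"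
  shows "integrable lborel (\<lambda>u::'a. complex_of_real (gauss u) * cis (u \<bullet> w))"
    and "(LINT u|lborel. complex_of_real (gauss u) * cis (u \<bullet> w)) =
          complex_of_real (sqrt (2 * pi) ^ DIM('a) * gauss w)"
proof -
  show "integrable lborel (\<lambda>u::'a. complex_of_real (gauss u) * cis (u \<bullet> w))"
    unfolding gauss_cis_prod
    by (rule integrable_lborel_Basis_prod[where \<phi>="\<lambda>b t. complex_of_real (exp (- t\<^sup>2 / 2)) * cis (t * (w \<bullet> b))"])
      (rule gauss_1d)
  have "(LINT u|lborel. complex_of_real (gauss u) * cis (u \<bullet> w)) =
      (\<Prod>b\<in>(Basis::'a set). LINT t|lborel. complex_of_real (exp (- t\<^sup>2 / 2)) * cis (t * (w \<bullet> b)))"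
    unfolding gauss_cis_prod
    by (rule integral_lborel_Basis_prod[where \<phi>="\<lambda>b t. complex_of_real (exp (- t\<^sup>2 / 2)) * cis (t * (w \<bullet> b))"])
      (rule gauss_1d)
  also have "\<dots> = (\<Prod>b\<in>(Basis::'a set). complex_of_real (sqrt (2 * pi)) * complex_of_real (exp (- (w \<bullet> b)\<^sup>2 / 2)))"
    by (simp only: gauss_1d(2) of_real_mult)
  also have "\<dots> = complex_of_real (sqrt (2 * pi)) ^ DIM('a) * (\<Prod>b\<in>(Basis::'a set). complex_of_real (exp (- (w \<bullet> b)\<^sup>2 / 2)))"
    by (simp add: prod.distrib)
  also have "(\<Prod>b\<in>(Basis::'a set). complex_of_real (exp (- (w \<bullet> b)\<^sup>2 / 2))) = complex_of_real (gauss w)"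
    using gauss_cis_prod[of w 0] by simp
  finally show "(LINT u|lborel. complex_of_real (gauss u) * cis (u \<bullet> w)) =
      complex_of_real (sqrt (2 * pi) ^ DIM('a) * gauss w)" by simp
qed

lemma gauss_measurable [measurable]: "gauss \<in> borel_measurable borel"
  unfolding gauss_def by measurable

lemma cis_measurable [measurable]: "cis \<in> borel_measurable borel"
  by (intro borel_measurable_continuous_onI continuous_intros)

lemma gauss_pos: "0 < gauss u" by (simp add: gauss_def)

lemma gauss_nonneg [simp]: "0 \<le> gauss u" and abs_gauss [simp]: "\<bar>gauss u\<bar> = gauss u"
  by (simp_all add: gauss_def)

lemma gauss_integrable: "integrable lborel (gauss :: 'a::euclidean_space \<Rightarrow> real)"
  and gauss_integral: "(LINT u|lborel. gauss (u::'a)) = sqrt (2 * pi) ^ DIM('a)"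
proof -
  have "integrable lborel (\<lambda>u::'a. complex_of_real (gauss u))"
    using gauss_cis_integral(1)[of "0::'a"] by simp
  then show 1: "integrable lborel (gauss :: 'a \<Rightarrow> real)" by (simp add: complex_of_real_integrable_eq)
  have "complex_of_real (LINT u|lborel. gauss (u::'a)) = complex_of_real (sqrt (2 * pi) ^ DIM('a))"
    using gauss_cis_integral(2)[of "0::'a"] by (simp add: gauss_def)
  then show "(LINT u|lborel. gauss (u::'a)) = sqrt (2 * pi) ^ DIM('a)" by (simp only: of_real_eq_iff)
qed

text \<open>The product of \<open>p\<close> and \<open>q\<close> is integrable on the product space
  and dominates the integrand, so Fubini's theorem applies.\<close>

lemma integral_swap_bounded_kernel:
  fixes p q :: "'a::euclidean_space \<Rightarrow> complex" and \<kappa> :: "'a \<Rightarrow> 'a \<Rightarrow> complex"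
  assumes p: "integrable lborel p" and q: "integrable lborel q"
    and \<kappa> [measurable]: "(\<lambda>(x, y). \<kappa> x y) \<in> borel_measurable (borel \<Otimes>\<^sub>M borel)" and le: "\<And>x y. norm (\<kappa> x y) \<le> 1"
  shows "(LINT x|lborel. p x * (LINT y|lborel. q y * \<kappa> x y)) = (LINT y|lborel. q y * (LINT x|lborel. p x * \<kappa> x y))"
proof -
  have [measurable]: "p \<in> borel_measurable borel" "q \<in> borel_measurable borel"
    using p q by (auto dest: borel_measurable_integrable)
  have kx: "\<kappa> x \<in> borel_measurable borel" for x by measurable
  have ky: "(\<lambda>x. \<kappa> x y) \<in> borel_measurable borel" for y by measurable
  have qk: "integrable lborel (\<lambda>y. q y * \<kappa> x y)" for x
    by (rule Bochner_Integration.integrable_bound[OF q])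
      (use kx le in \<open>auto simp: norm_mult intro!: mult_left_le\<close>)
  have pk: "integrable lborel (\<lambda>x. p x * \<kappa> x y)" for y
    by (rule Bochner_Integration.integrable_bound[OF p])
      (use ky le in \<open>auto simp: norm_mult intro!: mult_left_le\<close>)
  have "integrable (lborel \<Otimes>\<^sub>M lborel) (\<lambda>(x, y). p x * (q y * \<kappa> x y))"
  proof (rule Bochner_Integration.integrable_bound[where f="\<lambda>(x, y). p x * q y"])
    show "integrable (lborel \<Otimes>\<^sub>M lborel) (\<lambda>(x, y). p x * q y)"
    proof (rule lborel_pair.Fubini_integrable)
      show "integrable lborel (\<lambda>x. LINT y|lborel. norm (case (x, y) of (x, y) \<Rightarrow> p x * q y))"
        using integrable_norm[OF p] by (simp add: norm_mult)
    qed (use q in \<open>auto\<close>)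
    show "AE z in lborel \<Otimes>\<^sub>M lborel. norm (case z of (x, y) \<Rightarrow> p x * (q y * \<kappa> x y)) \<le> norm (case z of (x, y) \<Rightarrow> p x * q y)"
      using le by (intro AE_I2) (auto simp: norm_mult intro!: mult_left_mono mult_left_le)
  qed measurable
  from lborel_pair.Fubini_integral[OF this]
  have "(LINT y|lborel. LINT x|lborel. p x * (q y * \<kappa> x y)) = (LINT x|lborel. LINT y|lborel. p x * (q y * \<kappa> x y))" .
  moreover have "(LINT x|lborel. p x * (q y * \<kappa> x y)) = q y * (LINT x|lborel. p x * \<kappa> x y)" for y
    using pk[of y] by (simp add: mult.left_commute[of _ "q y"])
  moreover have "(LINT y|lborel. p x * (q y * \<kappa> x y)) = p x * (LINT y|lborel. q y * \<kappa> x y)" for x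
    using qk[of x] by simp
  ultimately show ?thesis by simp
qed

text \<open>Without the normalizing factor of \<^const>\<open>fourier_L1\<close>.\<close>

definition FT :: "('a::euclidean_space \<Rightarrow> real) \<Rightarrow> 'a \<Rightarrow> complex" where
  "FT f z = (LINT x|lborel. complex_of_real (f x) * cis (- (z \<bullet> x)))"

text \<open>This class contains the finite element functions, is closed under translations and
  linear combinations, and its members have absolutely convergent Fourier integrals.\<close>

definition Lip_cpt :: "('a::euclidean_space \<Rightarrow> real) \<Rightarrow> bool" where
  "Lip_cpt f \<longleftrightarrow> (\<exists>L R. 0 \<le> L \<and> (\<forall>x y. \<bar>f x - f y\<bar> \<le> L * norm (x - y)) \<and> (\<forall>x. R < norm x \<longrightarrow> f x = 0))"

lemma Lip_cpt_continuous:
  assumes "Lip_cpt f" shows "continuous_on UNIV f"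
proof -
  obtain L where "0 \<le> L" "\<And>x y. \<bar>f x - f y\<bar> \<le> L * norm (x - y)" using assms by (auto simp: Lip_cpt_def)
  then have "L-lipschitz_on UNIV f" by (intro lipschitz_onI) (auto simp: dist_real_def dist_norm)
  then show ?thesis by (rule lipschitz_on_continuous_on)
qed

lemma Lip_cpt_measurable [measurable]: "Lip_cpt f \<Longrightarrow> f \<in> borel_measurable borel"
  using Lip_cpt_continuous borel_measurable_continuous_onI by blast

lemma Lip_cpt_integrable_mult:
  assumes f: "Lip_cpt f" and g: "continuous_on UNIV g"
  shows "integrable lborel (\<lambda>x. f x * g x)"
proof -
  obtain R where R: "\<And>x. R < norm x \<Longrightarrow> f x = 0" using f by (auto simp: Lip_cpt_def)
  have "integrable lborel (\<lambda>x. indicator (cball 0 R) x *\<^sub>R (f x * g x))"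
    by (intro borel_integrable_compact continuous_intros continuous_on_subset[OF g]
        continuous_on_subset[OF Lip_cpt_continuous[OF f]]) auto
  moreover have "(\<lambda>x. indicator (cball 0 R) x *\<^sub>R (f x * g x)) = (\<lambda>x. f x * g x)"
    using R by (force simp: indicator_def)
  ultimately show ?thesis by simp
qed

lemma Lip_cpt_integrable: "Lip_cpt f \<Longrightarrow> integrable lborel f"
  using Lip_cpt_integrable_mult[of f "\<lambda>_. 1"] by simp

lemma Lip_cpt_integrable_sq: "Lip_cpt f \<Longrightarrow> integrable lborel (\<lambda>x. (f x)\<^sup>2)"
  using Lip_cpt_integrable_mult[of f f] Lip_cpt_continuous[of f] by (simp add: power2_eq_square)

lemma FT_integrand:
  assumes f: "Lip_cpt f"
  shows "integrable lborel (\<lambda>x. complex_of_real (f x) * cis (z \<bullet> x))"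
proof -
  note [measurable] = Lip_cpt_measurable[OF f]
  show ?thesis
    by (rule Bochner_Integration.integrable_bound[OF Lip_cpt_integrable[OF f]]) (auto simp: norm_mult)
qed

lemma FT_measurable [measurable]:
  assumes f: "Lip_cpt f" shows "FT f \<in> borel_measurable borel"
proof -
  note [measurable] = Lip_cpt_measurable[OF f]
  show ?thesis unfolding FT_def by measurable
qed

lemma FT_bounded:
  assumes "Lip_cpt f" shows "norm (FT f z) \<le> (LINT x|lborel. \<bar>f x\<bar>)"
proof -
  have "norm (FT f z) \<le> (LINT x|lborel. norm (complex_of_real (f x) * cis (- (z \<bullet> x))))"
    unfolding FT_def by (rule integral_norm_bound)
  then show ?thesis by (simp add: norm_mult)
qed

section \<open>Plancherel's identity by Gaussian regularization\<close>

definition autocorrelation :: "('a::euclidean_space \<Rightarrow> real) \<Rightarrow> 'a \<Rightarrow> real" where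
  "autocorrelation f w = (LINT y|lborel. f y * f (y + w))"

text \<open>The Gaussian damping makes the triple integral in x, y and z absolutely convergent.
  Integrating over z first gives another Gaussian in y - x, and x = y + e u produces the
  autocorrelation.\<close>

lemma FT_gauss_identity:
  fixes f :: "'a::euclidean_space \<Rightarrow> real"
  assumes f: "Lip_cpt f" and e: "0 < e"
  shows "(LINT z|lborel. (norm (FT f z))\<^sup>2 * gauss (e *\<^sub>R z)) =
           sqrt (2 * pi) ^ DIM('a) * (LINT u|lborel. gauss u * autocorrelation f (e *\<^sub>R u))"
proof -
  let ?c = "sqrt (2 * pi) ^ DIM('a)"
  let ?F = "\<lambda>x. complex_of_real (f x)"
  note [measurable] = Lip_cpt_measurable[OF f] FT_measurable[OF f]
  have fi: "integrable lborel ?F" using Lip_cpt_integrable[OF f] by (simp add: complex_of_real_integrable_eq)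
  have gi: "integrable lborel (\<lambda>z::'a. gauss (e *\<^sub>R z))"
    using gauss_integrable[where 'a='a] e
    by (intro integrable_lborel_scale) auto
  have gic: "integrable lborel (\<lambda>z::'a. complex_of_real (gauss (e *\<^sub>R z)) * FT f z)"
  proof (rule Bochner_Integration.integrable_bound)
    show "integrable lborel (\<lambda>z::'a. gauss (e *\<^sub>R z) * (LINT x|lborel. \<bar>f x\<bar>))" using gi by simp
    show "AE z in lborel. norm (complex_of_real (gauss (e *\<^sub>R z)) * FT f z) \<le> norm (gauss (e *\<^sub>R z) * (LINT x|lborel. \<bar>f x\<bar>))"
      using FT_bounded[OF f] gauss_pos by (intro AE_I2) (auto simp: norm_mult abs_mult less_imp_le intro!: mult_left_mono)
  qed measurable
  have gic2: "integrable lborel (\<lambda>z::'a. complex_of_real (gauss (e *\<^sub>R z)) * cis (z \<bullet> y))" for y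
    by (rule Bochner_Integration.integrable_bound[OF gi]) (auto simp: norm_mult)
  \<comment> \<open>The rescaled Gaussian on the right is an approximate identity as e tends to 0,
    up to its total mass (2 pi)^d.\<close>
  have inner: "(LINT z|lborel. complex_of_real (gauss (e *\<^sub>R z)) * cis (z \<bullet> w)) = complex_of_real (?c / e ^ DIM('a) * gauss ((1 / e) *\<^sub>R w))" for w :: 'a
  proof -
    have "complex_of_real (?c * gauss ((1 / e) *\<^sub>R w))
        = (e ^ DIM('a)) *\<^sub>R (LINT z|lborel. complex_of_real (gauss (e *\<^sub>R z)) * cis ((e *\<^sub>R z) \<bullet> ((1 / e) *\<^sub>R w)))"
      unfolding gauss_cis_integral(2)[symmetric]
      using integral_lborel_scale[of "\<lambda>z. complex_of_real (gauss z) * cis (z \<bullet> ((1 / e) *\<^sub>R w))" e 0] e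
      by (simp only: add_0) measurable
    moreover have "(e *\<^sub>R z) \<bullet> ((1 / e) *\<^sub>R w) = z \<bullet> w" for z using e by simp
    ultimately have "complex_of_real (?c * gauss ((1 / e) *\<^sub>R w))
        = complex_of_real (e ^ DIM('a)) * (LINT z|lborel. complex_of_real (gauss (e *\<^sub>R z)) * cis (z \<bullet> w))"
      by (simp only: scaleR_conv_of_real)
    then show ?thesis using e by (simp add: nonzero_eq_divide_eq mult.commute)
  qed
  have "complex_of_real (LINT z|lborel. (norm (FT f z))\<^sup>2 * gauss (e *\<^sub>R z)) =
      (LINT z|lborel. complex_of_real (gauss (e *\<^sub>R z)) * FT f z * (LINT y|lborel. ?F y * cis (z \<bullet> y)))"
  proof -
    have "(LINT y|lborel. ?F y * cis (z \<bullet> y)) = cnj (FT f z)" for z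
    proof -
      have "cnj (FT f z) = (LINT y|lborel. cnj (?F y * cis (- (z \<bullet> y))))"
        unfolding FT_def by (rule Bochner_Integration.integral_cnj[symmetric])
      then show ?thesis by (simp add: cis_cnj)
    qed
    then have "complex_of_real (gauss (e *\<^sub>R z)) * FT f z * (LINT y|lborel. ?F y * cis (z \<bullet> y)) =
        complex_of_real ((norm (FT f z))\<^sup>2 * gauss (e *\<^sub>R z))" for z
      using complex_norm_square[of "FT f z"] by (simp add: mult_ac)
    then show ?thesis by (simp only: integral_complex_of_real)
  qed
  also have "\<dots> = (LINT y|lborel. ?F y * (LINT z|lborel. complex_of_real (gauss (e *\<^sub>R z)) * FT f z * cis (z \<bullet> y)))"
    by (rule integral_swap_bounded_kernel[OF gic fi]) (auto simp: split_beta')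
  also have "\<dots> = (LINT y|lborel. ?F y * (LINT x|lborel. ?F x * complex_of_real (?c / e ^ DIM('a) * gauss ((1 / e) *\<^sub>R (y - x)))))"
  proof (rule Bochner_Integration.integral_cong[OF refl])
    fix y :: 'a
    have "(LINT z|lborel. complex_of_real (gauss (e *\<^sub>R z)) * FT f z * cis (z \<bullet> y)) =
       (LINT z|lborel. complex_of_real (gauss (e *\<^sub>R z)) * cis (z \<bullet> y) * (LINT x|lborel. ?F x * cis (- (z \<bullet> x))))"
      by (simp add: FT_def mult_ac)
    also have "\<dots> = (LINT x|lborel. ?F x * (LINT z|lborel. complex_of_real (gauss (e *\<^sub>R z)) * cis (z \<bullet> y) * cis (- (z \<bullet> x))))"
      by (rule integral_swap_bounded_kernel[OF gic2 fi]) (auto simp: split_beta')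
    also have "\<dots> = (LINT x|lborel. ?F x * (LINT z|lborel. complex_of_real (gauss (e *\<^sub>R z)) * cis (z \<bullet> (y - x))))"
      by (simp add: mult.assoc cis_mult inner_diff_right)
    finally show "?F y * (LINT z|lborel. complex_of_real (gauss (e *\<^sub>R z)) * FT f z * cis (z \<bullet> y)) =
        ?F y * (LINT x|lborel. ?F x * complex_of_real (?c / e ^ DIM('a) * gauss ((1 / e) *\<^sub>R (y - x))))"
      by (simp only: inner)
  qed
  also have "\<dots> = complex_of_real (?c * (LINT y|lborel. f y * (LINT u|lborel. gauss u * f (y + e *\<^sub>R u))))"
  proof -
    have "(LINT x|lborel. f x * (?c / e ^ DIM('a) * gauss ((1 / e) *\<^sub>R (y - x)))) = ?c * (LINT u|lborel. gauss u * f (y + e *\<^sub>R u))" for y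
    proof -
      have "(LINT x|lborel. f x * (?c / e ^ DIM('a) * gauss ((1 / e) *\<^sub>R (y - x)))) =
        e ^ DIM('a) * (LINT u|lborel. f (y + e *\<^sub>R u) * (?c / e ^ DIM('a) * gauss ((1 / e) *\<^sub>R (y - (y + e *\<^sub>R u)))))"
        by (subst integral_lborel_scale[OF _ e, of _ y]) (simp_all)
      also have "\<dots> = e ^ DIM('a) * (LINT u|lborel. (?c / e ^ DIM('a)) * (gauss u * f (y + e *\<^sub>R u)))"
        using e by (simp add: gauss_def mult_ac)
      finally show ?thesis using e by simp
    qed
    then have "(LINT x|lborel. ?F x * complex_of_real (?c / e ^ DIM('a) * gauss ((1 / e) *\<^sub>R (y - x)))) =
        complex_of_real (?c * (LINT u|lborel. gauss u * f (y + e *\<^sub>R u)))" for y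
      by (simp only: integral_complex_of_real flip: of_real_mult)
    then have "(LINT y|lborel. ?F y * (LINT x|lborel. ?F x * complex_of_real (?c / e ^ DIM('a) * gauss ((1 / e) *\<^sub>R (y - x)))))
       = complex_of_real (LINT y|lborel. f y * (?c * (LINT u|lborel. gauss u * f (y + e *\<^sub>R u))))"
      by (simp only: integral_complex_of_real flip: of_real_mult)
    also have "(LINT y|lborel. f y * (?c * (LINT u|lborel. gauss u * f (y + e *\<^sub>R u)))) =
        (LINT y|lborel. ?c * (f y * (LINT u|lborel. gauss u * f (y + e *\<^sub>R u))))"
      by (simp only: mult.left_commute)
    finally show ?thesis by (simp only: Bochner_Integration.integral_mult_right_zero)
  qed
  also have "(LINT y|lborel. f y * (LINT u|lborel. gauss u * f (y + e *\<^sub>R u))) = (LINT u|lborel. gauss u * autocorrelation f (e *\<^sub>R u))"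
  proof -
    obtain L R where LR: "0 \<le> L" "\<And>x y. \<bar>f x - f y\<bar> \<le> L * norm (x - y)" "\<And>x. R < norm x \<Longrightarrow> f x = 0"
      using f by (auto simp: Lip_cpt_def)
    have "bounded (f ` cball 0 R)"
      using compact_continuous_image[OF continuous_on_subset[OF Lip_cpt_continuous[OF f]], of "cball 0 R"] compact_imp_bounded by auto
    then obtain B0 where B0: "\<forall>x\<in>cball 0 R. \<bar>f x\<bar> \<le> B0" by (auto simp: bounded_iff)
    define B where "B = \<bar>B0\<bar> + 1"
    have B: "0 < B" "\<bar>f x\<bar> \<le> B" for x
    proof -
      show "0 < B" by (simp add: B_def)
      show "\<bar>f x\<bar> \<le> B"
      proof (cases "norm x \<le> R")
        case True
        then have "\<bar>f x\<bar> \<le> B0" using B0 by simp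
        then show ?thesis by (simp add: B_def)
      qed (use LR(3) \<open>0 < B\<close> in auto)
    qed
    \<comment> \<open>\<open>integral_swap_bounded_kernel\<close> takes a kernel bounded by 1; the
      bound \<open>B\<close> of \<open>f\<close> is moved to the other factor.\<close>
    have "(LINT u|lborel. complex_of_real (gauss u) * (LINT y|lborel. complex_of_real (B * f y) * complex_of_real (f (y + e *\<^sub>R u) / B))) =
      (LINT y|lborel. complex_of_real (B * f y) * (LINT u|lborel. complex_of_real (gauss u) * complex_of_real (f (y + e *\<^sub>R u) / B)))"
    proof (rule integral_swap_bounded_kernel)
      show "integrable lborel (\<lambda>u::'a. complex_of_real (gauss u))"
        using gauss_integrable by (simp add: complex_of_real_integrable_eq)
      show "integrable lborel (\<lambda>y. complex_of_real (B * f y))"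
        using Lip_cpt_integrable[OF f] by (simp only: complex_of_real_integrable_eq) simp
      show "norm (complex_of_real (f (y + e *\<^sub>R u) / B)) \<le> 1" for y u
        using B(1) B(2)[of "y + e *\<^sub>R u"] by (simp add: norm_divide)
    qed measurable
    then have "(LINT u|lborel. gauss u * (LINT y|lborel. B * f y * (f (y + e *\<^sub>R u) / B))) =
      (LINT y|lborel. B * f y * (LINT u|lborel. gauss u * (f (y + e *\<^sub>R u) / B)))"
      by (simp only: integral_complex_of_real of_real_eq_iff flip: of_real_mult)
    moreover have "(LINT y|lborel. B * f y * (f (y + e *\<^sub>R u) / B)) = autocorrelation f (e *\<^sub>R u)" for u
      using B(1) by (simp add: autocorrelation_def)
    moreover have "B * f y * (LINT u|lborel. gauss u * (f (y + e *\<^sub>R u) / B)) = f y * (LINT u|lborel. gauss u * f (y + e *\<^sub>R u))" for y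
      using B(1) by simp
    ultimately show ?thesis by simp
  qed
  finally show ?thesis by (simp only: of_real_eq_iff)
qed

lemma autocorrelation_0: "autocorrelation f 0 = norm2_sq f"
  by (simp add: autocorrelation_def power2_eq_square)

lemma autocorrelation_bound:
  assumes f: "Lip_cpt f"
  shows "\<bar>autocorrelation f w\<bar> \<le> norm2_sq f"
proof -
  note [measurable] = Lip_cpt_measurable[OF f]
  have i: "integrable lborel (\<lambda>y. (f (y + w))\<^sup>2)"
    by (rule integrable_lborel_translate[OF Lip_cpt_integrable_sq[OF f]])
  have "\<bar>autocorrelation f w\<bar> \<le> (LINT y|lborel. norm (f y * f (y + w)))"
    unfolding autocorrelation_def using integral_norm_bound[of lborel "\<lambda>y. f y * f (y + w)"] by simp
  also have "\<dots> \<le> (LINT y|lborel. ((f y)\<^sup>2 + (f (y + w))\<^sup>2) / 2)"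
  proof (rule integral_mono')
    show "norm (f y * f (y + w)) \<le> ((f y)\<^sup>2 + (f (y + w))\<^sup>2) / 2" for y
      using sum_squares_bound[of "\<bar>f y\<bar>" "\<bar>f (y + w)\<bar>"] by (simp add: abs_mult)
  qed (use Lip_cpt_integrable_sq[OF f] i in auto)
  also have "\<dots> = norm2_sq f"
    using Lip_cpt_integrable_sq[OF f] i integral_lborel_translate[of "\<lambda>x. (f x)\<^sup>2" w] by simp
  finally show ?thesis .
qed

lemma autocorrelation_tendsto:
  assumes f: "Lip_cpt f" and w: "w \<longlonglongrightarrow> 0"
  shows "(\<lambda>n. autocorrelation f (w n)) \<longlonglongrightarrow> autocorrelation f 0"
proof -
  obtain L where L: "0 \<le> L" "\<And>x y. \<bar>f x - f y\<bar> \<le> L * norm (x - y)" using f by (auto simp: Lip_cpt_def)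
  note cf = Lip_cpt_continuous[OF f]
  have ct: "continuous_on UNIV (\<lambda>y. f (y + w n))" for n
    by (intro continuous_on_compose2[OF cf] continuous_intros) auto
  have le: "norm (autocorrelation f (w n) - autocorrelation f 0) \<le> norm (w n) * (L * (LINT y|lborel. \<bar>f y\<bar>))" for n
  proof -
    have "autocorrelation f (w n) - autocorrelation f 0 = (LINT y|lborel. f y * (f (y + w n) - f y))"
      using Lip_cpt_integrable_mult[OF f ct, of n] Lip_cpt_integrable_mult[OF f cf]
      by (simp add: autocorrelation_def right_diff_distrib)
    also have "norm \<dots> \<le> (LINT y|lborel. norm (f y * (f (y + w n) - f y)))" by (rule integral_norm_bound)
    also have "\<dots> \<le> (LINT y|lborel. \<bar>f y\<bar> * (L * norm (w n)))"
    proof (rule integral_mono')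
      show "norm (f y * (f (y + w n) - f y)) \<le> \<bar>f y\<bar> * (L * norm (w n))" for y
        using L(2)[of "y + w n" y] by (auto simp: abs_mult intro!: mult_left_mono)
    qed (use Lip_cpt_integrable[OF f] L(1) in auto)
    finally show ?thesis by (simp add: mult_ac)
  qed
  have lim: "(\<lambda>n. norm (w n) * (L * (LINT y|lborel. \<bar>f y\<bar>))) \<longlonglongrightarrow> 0"
    using tendsto_mult_left_zero[OF tendsto_norm_zero[OF w]] by simp
  have "(\<lambda>n. autocorrelation f (w n) - autocorrelation f 0) \<longlonglongrightarrow> 0"
    by (rule Lim_null_comparison[OF _ lim]) (rule always_eventually, rule allI, rule le)
  then show ?thesis by (simp add: LIM_zero_iff)
qed

text \<open>The damping is removed along e = 1 / (n + 1): by monotone convergence in frequency,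
  which also yields square integrability of the transform, and by dominated convergence for the
  autocorrelation, whose value at 0 is the squared norm.\<close>

theorem FT_Plancherel:
  fixes f :: "'a::euclidean_space \<Rightarrow> real"
  assumes f: "Lip_cpt f"
  shows "(\<integral>\<^sup>+z. ennreal ((norm (FT f z))\<^sup>2) \<partial>lborel) = ennreal ((2 * pi) ^ DIM('a) * norm2_sq f)"
proof -
  define e where "e n = 1 / real (Suc n)" for n
  have e: "0 < e n" for n by (simp add: e_def)
  have e0: "e \<longlonglongrightarrow> 0" unfolding e_def using LIMSEQ_inverse_real_of_nat by (simp add: inverse_eq_divide)
  let ?c = "sqrt (2 * pi) ^ DIM('a)" and ?N = "LINT x|lborel. (f x)\<^sup>2"
  note [measurable] = Lip_cpt_measurable[OF f] FT_measurable[OF f]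
  define g where "g n z = (norm (FT f z))\<^sup>2 * gauss (e n *\<^sub>R z)" for n z
  have gm [measurable]: "g n \<in> borel_measurable borel" for n unfolding g_def[abs_def] by measurable
  have gi: "integrable lborel (g n)" for n
  proof (rule Bochner_Integration.integrable_bound)
    show "integrable lborel (\<lambda>z::'a. (LINT x|lborel. \<bar>f x\<bar>)\<^sup>2 * gauss (e n *\<^sub>R z))"
      using integrable_lborel_scale[OF gauss_integrable[where 'a='a] e[of n]] by simp
    show "AE z in lborel. norm (g n z) \<le> norm ((LINT x|lborel. \<bar>f x\<bar>)\<^sup>2 * gauss (e n *\<^sub>R z))"
      using FT_bounded[OF f] gauss_pos
      by (intro AE_I2) (auto simp: g_def abs_mult less_imp_le intro!: mult_right_mono power_mono)
  qed simp
  have g0: "0 \<le> g n z" for n z using gauss_pos[of "e n *\<^sub>R z"] by (simp add: g_def)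
  have lim1: "(\<lambda>n. \<integral>\<^sup>+z. ennreal (g n z) \<partial>lborel) \<longlonglongrightarrow> (\<integral>\<^sup>+z. ennreal ((norm (FT f z))\<^sup>2) \<partial>lborel)"
  proof (rule nn_integral_LIMSEQ)
    show "incseq (\<lambda>n z. ennreal (g n z))"
    proof (intro incseq_SucI le_funI ennreal_leI)
      fix n and z :: 'a
      have "e (Suc n) \<le> e n" by (simp add: e_def frac_le)
      then have "(norm (e (Suc n) *\<^sub>R z))\<^sup>2 \<le> (norm (e n *\<^sub>R z))\<^sup>2"
        using e[of "Suc n"] e[of n] by (intro power_mono) (auto intro!: mult_right_mono)
      then have "gauss (e n *\<^sub>R z) \<le> gauss (e (Suc n) *\<^sub>R z)" by (simp add: gauss_def)
      then show "g n z \<le> g (Suc n) z" unfolding g_def by (intro mult_left_mono) auto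
    qed
    show "(\<lambda>n. ennreal (g n z)) \<longlonglongrightarrow> ennreal ((norm (FT f z))\<^sup>2)" for z
    proof (rule tendsto_ennrealI)
      have "(\<lambda>n. (norm (FT f z))\<^sup>2 * exp (- (norm (e n *\<^sub>R z))\<^sup>2 / 2)) \<longlonglongrightarrow> (norm (FT f z))\<^sup>2 * exp (- (norm (0 *\<^sub>R z))\<^sup>2 / 2)"
        by (intro tendsto_intros e0) auto
      then show "(\<lambda>n. g n z) \<longlonglongrightarrow> (norm (FT f z))\<^sup>2" by (simp add: g_def gauss_def)
    qed
  qed simp
  have "(\<lambda>n. LINT u|lborel. gauss (u::'a) * autocorrelation f (e n *\<^sub>R u)) \<longlonglongrightarrow> (LINT u|lborel. gauss (u::'a) * autocorrelation f 0)"
  proof (rule integral_dominated_convergence[where w="\<lambda>u. gauss u * ?N"])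
    show "integrable lborel (\<lambda>u::'a. gauss u * ?N)" using gauss_integrable[where 'a='a] by simp
    show "AE u::'a in lborel. (\<lambda>n. gauss u * autocorrelation f (e n *\<^sub>R u)) \<longlonglongrightarrow> gauss u * autocorrelation f 0"
      using tendsto_scaleR[OF e0 tendsto_const]
      by (intro AE_I2 tendsto_mult_left autocorrelation_tendsto[OF f]) simp
    show "AE u::'a in lborel. norm (gauss u * autocorrelation f (e n *\<^sub>R u)) \<le> gauss u * ?N" for n
      using autocorrelation_bound[OF f] by (intro AE_I2) (auto simp: abs_mult intro!: mult_left_mono)
  qed (simp_all add: autocorrelation_def)
  then have "(\<lambda>n. ?c * (LINT u|lborel. gauss (u::'a) * autocorrelation f (e n *\<^sub>R u))) \<longlonglongrightarrow> ?c * (?c * ?N)"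
    by (intro tendsto_mult_left) (simp add: autocorrelation_0 gauss_integral)
  moreover have "?c * (?c * ?N) = (2 * pi) ^ DIM('a) * ?N"
  proof -
    have "?c * ?c = (2 * pi) ^ DIM('a)"
      unfolding power_mult_distrib[symmetric] by simp
    then show ?thesis by (simp only: mult.assoc[symmetric])
  qed
  moreover have "?c * (LINT u|lborel. gauss (u::'a) * autocorrelation f (e n *\<^sub>R u)) = (LINT z|lborel. g n z)" for n
    unfolding g_def by (rule FT_gauss_identity[OF f e, symmetric])
  ultimately have "(\<lambda>n. ennreal (LINT z|lborel. g n z)) \<longlonglongrightarrow> ennreal ((2 * pi) ^ DIM('a) * ?N)"
    by (intro tendsto_ennrealI) simp
  moreover have "(\<integral>\<^sup>+z. ennreal (g n z) \<partial>lborel) = ennreal (LINT z|lborel. g n z)" for n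
    by (rule nn_integral_eq_integral[OF gi]) (use g0 in auto)
  ultimately show ?thesis using lim1 LIMSEQ_unique by simp
qed

section \<open>The Plancherel transform and the Sobolev energy\<close>

lemma fourier_L1_eq_FT:
  fixes f :: "'a::euclidean_space \<Rightarrow> real"
  assumes f: "f \<in> borel_measurable borel"
  shows "fourier_L1 f z = of_real ((2 * pi) powr (- real DIM('a) / 2)) * FT f z"
proof -
  note [measurable] = f
  have "(LINT x|lebesgue. complex_of_real (f x) * cis (- (z \<bullet> x))) = FT f z"
    unfolding FT_def by (rule integral_completion) measurable
  then show ?thesis by (simp add: fourier_L1_def)
qed

lemma zext_ball_eventually_eq:
  assumes f: "Lip_cpt f"
  shows "\<exists>n0. \<forall>n\<ge>n0. zext (ball 0 (real n)) f = f"
proof -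
  obtain R where R: "\<And>x. R < norm x \<Longrightarrow> f x = 0" using f by (auto simp: Lip_cpt_def)
  obtain n0 where n0: "R < real n0" using reals_Archimedean2 by blast
  have "zext (ball 0 (real n)) f = f" if "n \<ge> n0" for n
  proof
    fix x
    have "real n0 \<le> real n" using that by simp
    then show "zext (ball 0 (real n)) f x = f x" using R[of x] n0 by (cases "norm x < real n") (auto simp: zext_def)
  qed
  then show ?thesis by blast
qed

text \<open>The truncations of a compactly supported function are eventually the function itself, so
  the L2 limit defining \<open>fourier\<close> is the Fourier integral. As \<open>fourier\<close> is
  a choice among versions, equality holds only almost everywhere.\<close>

lemma fourier_AE_eq:
  fixes f :: "'a::euclidean_space \<Rightarrow> real"
  assumes f: "Lip_cpt f"
  shows "AE z in lebesgue. fourier f z = fourier_L1 f z"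
proof -
  obtain n0 where n0: "\<And>n. n \<ge> n0 \<Longrightarrow> zext (ball 0 (real n)) f = f" using zext_ball_eventually_eq[OF f] by blast
  note [measurable] = Lip_cpt_measurable[OF f] FT_measurable[OF f]
  have Fm: "fourier_L1 f \<in> borel_measurable borel"
    unfolding fourier_L1_eq_FT[OF Lip_cpt_measurable[OF f], abs_def] by measurable
  have L2: "L2_function f"
    using Lip_cpt_integrable_sq[OF f] measurable_completion[of f lborel borel]
    by (simp add: L2_function_def integrable_completion)
  have "is_fourier f (fourier_L1 f)"
  proof -
    have "\<forall>\<^sub>F n in sequentially. (\<integral>\<^sup>+ z. ennreal ((norm (fourier_L1 f z - fourier_L1 (zext (ball 0 (real n)) f) z))\<^sup>2) \<partial>lebesgue) = 0"
      using n0 by (intro eventually_sequentiallyI[of n0]) simp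
    then show ?thesis using L2 measurable_completion[of "fourier_L1 f" lborel borel] Fm
      by (simp add: is_fourier_def tendsto_eventually)
  qed
  then have F: "is_fourier f (fourier f)" unfolding fourier_def by (rule someI[of "is_fourier f"])
  let ?I = "\<integral>\<^sup>+ z. ennreal ((norm (fourier f z - fourier_L1 f z))\<^sup>2) \<partial>lebesgue"
  have "\<forall>\<^sub>F n in sequentially. (\<integral>\<^sup>+ z. ennreal ((norm (fourier f z - fourier_L1 (zext (ball 0 (real n)) f) z))\<^sup>2) \<partial>lebesgue) = ?I"
    using n0 by (intro eventually_sequentiallyI[of n0]) simp
  then have "(\<lambda>n. \<integral>\<^sup>+ z. ennreal ((norm (fourier f z - fourier_L1 (zext (ball 0 (real n)) f) z))\<^sup>2) \<partial>lebesgue) \<longlonglongrightarrow> ?I"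
    by (rule tendsto_eventually)
  then have I0: "?I = 0" using F LIMSEQ_unique unfolding is_fourier_def by blast
  have [measurable]: "fourier f \<in> borel_measurable lebesgue" "fourier_L1 f \<in> borel_measurable lebesgue"
    using F measurable_completion[of "fourier_L1 f" lborel borel] Fm by (simp_all add: is_fourier_def)
  have "AE z in lebesgue. ennreal ((norm (fourier f z - fourier_L1 f z))\<^sup>2) = 0"
    using I0 by (subst (asm) nn_integral_0_iff_AE) auto
  then show ?thesis by eventually_elim simp
qed

lemma sobolev_energy_eq:
  fixes f :: "'a::euclidean_space \<Rightarrow> real"
  assumes f: "Lip_cpt f"
  shows "sobolev_energy r f =
    (\<integral>\<^sup>+ z. ennreal ((1 + (norm z)\<^sup>2) powr r * ((2 * pi) powr (- real DIM('a)) * (norm (FT f z))\<^sup>2)) \<partial>lborel)"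
proof -
  have c: "((2 * pi) powr (- real DIM('a) / 2))\<^sup>2 = (2 * pi) powr (- real DIM('a))"
    by (simp add: power2_eq_square flip: powr_add)
  have "sobolev_energy r f =
    (\<integral>\<^sup>+ z. ennreal ((1 + (norm z)\<^sup>2) powr r * ((2 * pi) powr (- real DIM('a)) * (norm (FT f z))\<^sup>2)) \<partial>lebesgue)"
    unfolding sobolev_energy_def
  proof (rule nn_integral_cong_AE)
    show "AE z in lebesgue. ennreal ((1 + (norm z)\<^sup>2) powr r * (norm (fourier f z))\<^sup>2) =
      ennreal ((1 + (norm z)\<^sup>2) powr r * ((2 * pi) powr (- real DIM('a)) * (norm (FT f z))\<^sup>2))"
      using fourier_AE_eq[OF f]
    proof eventually_elim
      case (elim z)
      then show ?case
        by (simp add: fourier_L1_eq_FT[OF Lip_cpt_measurable[OF f]] norm_mult power_mult_distrib c[symmetric])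
    qed
  qed
  then show ?thesis by (simp only: nn_integral_completion)
qed

text \<open>First differences of a Lipschitz function have squared norm O(|a|^2), which gives
  regularity only below 1. Second differences annihilate affine functions and reach the exponents
  between 1 and 3/2.\<close>

definition second_difference :: "('a::real_vector \<Rightarrow> real) \<Rightarrow> 'a \<Rightarrow> 'a \<Rightarrow> real" where
  "second_difference f a x = f (x + 2 *\<^sub>R a) - 2 * f (x + a) + f x"

lemma Lip_cpt_translate:
  assumes "Lip_cpt f" shows "Lip_cpt (\<lambda>x. f (x + a))"
proof -
  obtain L R where LR: "0 \<le> L" "\<And>x y. \<bar>f x - f y\<bar> \<le> L * norm (x - y)" "\<And>x. R < norm x \<Longrightarrow> f x = 0"
    using assms by (auto simp: Lip_cpt_def)
  have "f (x + a) = 0" if "R + norm a < norm x" for x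
    using that norm_triangle_ineq4[of "x + a" a] by (intro LR(3)) simp
  moreover have "\<bar>f (x + a) - f (y + a)\<bar> \<le> L * norm (x - y)" for x y using LR(2)[of "x + a" "y + a"] by simp
  ultimately show ?thesis using LR(1) unfolding Lip_cpt_def by blast
qed

lemma Lip_cpt_lin:
  assumes "Lip_cpt f" "Lip_cpt g" shows "Lip_cpt (\<lambda>x. a * f x + b * g x)"
proof -
  obtain L R where LR: "0 \<le> L" "\<And>x y. \<bar>f x - f y\<bar> \<le> L * norm (x - y)" "\<And>x. R < norm x \<Longrightarrow> f x = 0"
    using assms by (auto simp: Lip_cpt_def)
  obtain L' R' where LR': "0 \<le> L'" "\<And>x y. \<bar>g x - g y\<bar> \<le> L' * norm (x - y)" "\<And>x. R' < norm x \<Longrightarrow> g x = 0"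
    using assms by (auto simp: Lip_cpt_def)
  have "\<bar>a * f x + b * g x - (a * f y + b * g y)\<bar> \<le> (\<bar>a\<bar> * L + \<bar>b\<bar> * L') * norm (x - y)" for x y
  proof -
    have "\<bar>a * f x + b * g x - (a * f y + b * g y)\<bar> \<le> \<bar>a * (f x - f y)\<bar> + \<bar>b * (g x - g y)\<bar>"
      by (simp add: algebra_simps)
    also have "\<dots> \<le> \<bar>a\<bar> * (L * norm (x - y)) + \<bar>b\<bar> * (L' * norm (x - y))"
      unfolding abs_mult by (intro add_mono mult_left_mono LR(2) LR'(2)) auto
    finally show ?thesis by (simp add: algebra_simps)
  qed
  then show ?thesis using LR LR' unfolding Lip_cpt_def
    by (intro exI[of _ "\<bar>a\<bar> * L + \<bar>b\<bar> * L'"] exI[of _ "max R R'"]) auto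
qed

lemma Lip_cpt_second_difference:
  assumes "Lip_cpt f" shows "Lip_cpt (second_difference f a)"
proof -
  have "Lip_cpt (\<lambda>x. 1 * (1 * f (x + 2 *\<^sub>R a) + (- 2) * f (x + a)) + 1 * f x)"
    by (intro Lip_cpt_lin Lip_cpt_translate assms)
  then show ?thesis by (simp add: second_difference_def[abs_def])
qed

lemma FT_translate:
  assumes f: "Lip_cpt f"
  shows "FT (\<lambda>x. f (x + a)) z = cis (z \<bullet> a) * FT f z"
proof -
  note [measurable] = Lip_cpt_measurable[OF f]
  have "FT (\<lambda>x. f (x + a)) z = (LINT x|lborel. complex_of_real (f (x + a)) * cis (z \<bullet> a - z \<bullet> (x + a)))"
    by (simp add: FT_def inner_add_right)
  also have "\<dots> = (LINT x|lborel. complex_of_real (f x) * cis (z \<bullet> a - z \<bullet> x))"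
    by (rule integral_lborel_translate) measurable
  also have "\<dots> = (LINT x|lborel. cis (z \<bullet> a) * (complex_of_real (f x) * cis (- (z \<bullet> x))))"
    by (simp add: mult.left_commute cis_mult)
  also have "\<dots> = cis (z \<bullet> a) * FT f z" by (simp add: FT_def)
  finally show ?thesis .
qed

lemma FT_lin:
  assumes f: "Lip_cpt f" and g: "Lip_cpt g"
  shows "FT (\<lambda>x. a * f x + b * g x) z = complex_of_real a * FT f z + complex_of_real b * FT g z"
  using FT_integrand[OF f, of "- z"] FT_integrand[OF g, of "- z"]
  by (simp add: FT_def distrib_right mult.assoc)

lemma FT_second_difference:
  assumes f: "Lip_cpt f"
  shows "FT (second_difference f a) z = (cis (z \<bullet> a) - 1)\<^sup>2 * FT f z"
proof -
  have eq: "second_difference f a = (\<lambda>x. 1 * (1 * f (x + 2 *\<^sub>R a) + (- 2) * f (x + a)) + 1 * f x)"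
    by (simp add: second_difference_def[abs_def])
  have "FT (second_difference f a) z = cis (z \<bullet> (2 *\<^sub>R a)) * FT f z - 2 * (cis (z \<bullet> a) * FT f z) + FT f z"
    unfolding eq by (simp only: FT_lin FT_translate Lip_cpt_lin Lip_cpt_translate f) simp
  also have "cis (z \<bullet> (2 *\<^sub>R a)) = (cis (z \<bullet> a))\<^sup>2" by (simp add: power2_eq_square cis_mult)
  finally show ?thesis by (simp add: power2_eq_square algebra_simps)
qed

text \<open>|cis t - 1|^2 = 2 - 2 cos t, and cos decreases on an interval containing [1, 2]. Thus
  the symbol of the second difference is bounded below on a whole dyadic band.\<close>

lemma norm_cis_diff_1_ge:
  assumes "1 \<le> \<bar>t\<bar>" "\<bar>t\<bar> \<le> 2"
  shows "(2 - 2 * cos 1)\<^sup>2 \<le> (norm ((cis t - 1)\<^sup>2))\<^sup>2"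
proof -
  have "(norm (cis t - 1))\<^sup>2 = (cos t - 1)\<^sup>2 + (sin t)\<^sup>2" by (simp add: cmod_power2)
  also have "\<dots> = 2 - 2 * cos t" using sin_cos_squared_add2[of t] by (simp add: power2_diff)
  finally have 1: "(norm (cis t - 1))\<^sup>2 = 2 - 2 * cos t" .
  have "cos \<bar>t\<bar> \<le> cos 1" using assms pi_gt3 by (intro cos_monotone_0_pi_le) auto
  then have "2 - 2 * cos 1 \<le> 2 - 2 * cos t" by simp
  then have "(2 - 2 * cos 1)\<^sup>2 \<le> (2 - 2 * cos t)\<^sup>2" by (intro power_mono) auto
  then show ?thesis by (simp add: norm_power 1)
qed

section \<open>Sobolev regularity of piecewise linear functions\<close>

text \<open>Continuous piecewise linear functions have second differences of size \<open>O(|a|)\<close>, supported on a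
  set of measure \<open>O(|a|)\<close>. On the Fourier side a step \<open>2\<^sup>-\<^sup>n\<close> controls the frequencies of size
  \<open>2\<^sup>n\<close>, which gives regularity below \<open>3/2\<close>.\<close>

lemma dyadic_FT_bound:
  fixes f :: "'a::euclidean_space \<Rightarrow> real"
  assumes f: "Lip_cpt f" and b: "b \<in> Basis" and r: "0 \<le> r" "r < 3 / 2"
    and C: "0 \<le> C" "\<And>a. norm2_sq (second_difference f a) \<le> C * norm a ^ 3"
  shows "(\<integral>\<^sup>+z. ennreal (\<bar>z \<bullet> b\<bar> powr (2 * r) * (norm (FT f z))\<^sup>2) \<partial>lborel) < \<infinity>"
proof -
  note [measurable] = FT_measurable[OF f] FT_measurable[OF Lip_cpt_second_difference[OF f]]
  define c0 where "c0 = (2 - 2 * cos (1::real))\<^sup>2"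
  have c0: "0 < c0" using cos_monotone_0_pi[of 0 1] pi_gt3 by (simp add: c0_def)
  \<comment> \<open>For 2^n \<le> |z \<bullet> b| < 2^(n + 1) the product with \<open>a n\<close>
    has modulus between 1 and 2, so \<open>D n z\<close> is at least \<open>c0 * N z\<close>. The
    coefficient \<open>q n\<close> is the largest value of the weight on this band divided by
    \<open>c0\<close>.\<close>
  define a where "a n = (1 / 2 ^ n) *\<^sub>R b" for n :: nat
  define q where "q n = 2 powr (2 * r * real (Suc n)) / c0" for n
  define N where "N z = (norm (FT f z))\<^sup>2" for z
  define D where "D n z = (norm (FT (second_difference f (a n)) z))\<^sup>2" for n z
  have q0: "0 \<le> q n" for n using c0 by (simp add: q_def)
  have pt: "ennreal (\<bar>z \<bullet> b\<bar> powr (2 * r) * N z) \<le> ennreal (N z) + (\<Sum>n. ennreal (q n * D n z))" for z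
  proof (cases "\<bar>z \<bullet> b\<bar> < 1")
    case True
    then have "\<bar>z \<bullet> b\<bar> powr (2 * r) \<le> 1" using r by (intro powr_le1) auto
    then have "\<bar>z \<bullet> b\<bar> powr (2 * r) * N z \<le> 1 * N z" by (intro mult_right_mono) (auto simp: N_def)
    then have "ennreal (\<bar>z \<bullet> b\<bar> powr (2 * r) * N z) \<le> ennreal (N z)" by (intro ennreal_leI) simp
    then show ?thesis by (rule order_trans) simp
  next
    case False
    define n where "n = nat \<lfloor>log 2 \<bar>z \<bullet> b\<bar>\<rfloor>"
    have l0: "0 \<le> log 2 \<bar>z \<bullet> b\<bar>" using False by simp
    have n: "real n \<le> log 2 \<bar>z \<bullet> b\<bar>" "log 2 \<bar>z \<bullet> b\<bar> < real (Suc n)"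
      using l0 unfolding n_def by linarith+
    have lo: "2 ^ n \<le> \<bar>z \<bullet> b\<bar>" and hi: "\<bar>z \<bullet> b\<bar> < 2 ^ Suc n"
      using n False by (simp_all add: le_log_iff log_less_iff powr_realpow del: power_Suc of_nat_Suc)
    have za: "\<bar>z \<bullet> a n\<bar> = \<bar>z \<bullet> b\<bar> / 2 ^ n" by (simp add: a_def abs_mult)
    have "1 \<le> \<bar>z \<bullet> a n\<bar>" "\<bar>z \<bullet> a n\<bar> \<le> 2" unfolding za using lo hi by (simp_all add: field_simps)
    then have "c0 \<le> (norm ((cis (z \<bullet> a n) - 1)\<^sup>2))\<^sup>2" unfolding c0_def by (rule norm_cis_diff_1_ge)
    then have cD: "c0 * N z \<le> D n z"
      unfolding D_def N_def FT_second_difference[OF f] norm_mult power_mult_distrib by (intro mult_right_mono) auto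
    have "\<bar>z \<bullet> b\<bar> powr (2 * r) \<le> (2 ^ Suc n) powr (2 * r)" using hi r by (intro powr_mono2) auto
    also have "((2::real) ^ Suc n) powr (2 * r) = 2 powr (2 * r * real (Suc n))"
      by (simp add: powr_powr mult.commute flip: powr_realpow del: power_Suc of_nat_Suc)
    finally have "\<bar>z \<bullet> b\<bar> powr (2 * r) * N z \<le> 2 powr (2 * r * real (Suc n)) * N z"
      by (intro mult_right_mono) (auto simp: N_def)
    also have "\<dots> = q n * (c0 * N z)" using c0 by (simp add: q_def)
    also have "\<dots> \<le> q n * D n z" by (rule mult_left_mono[OF cD q0])
    finally have "ennreal (\<bar>z \<bullet> b\<bar> powr (2 * r) * N z) \<le> (\<Sum>i\<in>{n}. ennreal (q i * D i z))"
      by (simp add: ennreal_leI)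
    also have "\<dots> \<le> (\<Sum>n. ennreal (q n * D n z))" by (rule sum_le_suminf) auto
    finally show ?thesis by (rule order_trans) simp
  qed
  define K where "K = 2 powr (2 * r) / c0 * ((2 * pi) ^ DIM('a) * C)"
  have term_le: "(\<integral>\<^sup>+z. ennreal (q n * D n z) \<partial>lborel) \<le> ennreal (K * (2 powr (2 * r - 3)) ^ n)" for n
  proof -
    have "(\<integral>\<^sup>+z. ennreal (q n * D n z) \<partial>lborel) = ennreal (q n) * (\<integral>\<^sup>+z. ennreal (D n z) \<partial>lborel)"
      using q0[of n] by (simp add: D_def ennreal_mult nn_integral_cmult)
    also have "(\<integral>\<^sup>+z. ennreal (D n z) \<partial>lborel) = ennreal ((2 * pi) ^ DIM('a) * norm2_sq (second_difference f (a n)))"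
      unfolding D_def by (rule FT_Plancherel[OF Lip_cpt_second_difference[OF f]])
    also have "ennreal (q n) * \<dots> = ennreal (q n * ((2 * pi) ^ DIM('a) * norm2_sq (second_difference f (a n))))"
      using q0[of n] by (intro ennreal_mult[symmetric]) auto
    also have "\<dots> \<le> ennreal (q n * ((2 * pi) ^ DIM('a) * (C * norm (a n) ^ 3)))"
      using q0[of n] C(2)[of "a n"] by (intro ennreal_leI mult_left_mono) auto
    also have "q n * ((2 * pi) ^ DIM('a) * (C * norm (a n) ^ 3)) = K * (2 powr (2 * r - 3)) ^ n"
    proof -
      have "norm (a n) ^ 3 = (1 / 2 ^ n) ^ 3" using b by (simp add: a_def)
      also have "\<dots> = 2 powr (- 3 * real n)"
      proof -
        have "(1 / 2 ^ n) ^ 3 = (2 powr - real n) powr (3::real)"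
          by (simp add: powr_minus powr_realpow divide_inverse power_inverse)
        then show ?thesis by (simp add: powr_powr mult.commute)
      qed
      finally have na: "norm (a n) ^ 3 = 2 powr (- 3 * real n)" .
      \<comment> \<open>The weight grows like 2^(2 r n) and the second differences decay like 2^(-3
        n); the ratio is below 1 exactly for r < 3/2.\<close>
      have "2 powr (2 * r * real (Suc n)) * 2 powr (- 3 * real n) = 2 powr (2 * r) * (2::real) powr ((2 * r - 3) * real n)"
        by (simp add: algebra_simps flip: powr_add)
      also have "(2::real) powr ((2 * r - 3) * real n) = (2 powr (2 * r - 3)) ^ n"
        by (simp add: powr_powr flip: powr_realpow)
      finally show ?thesis unfolding na q_def K_def using c0 by (simp add: field_simps)
    qed
    finally show ?thesis .
  qed
  have Nfin: "(\<integral>\<^sup>+z. ennreal (N z) \<partial>lborel) < \<infinity>" unfolding N_def FT_Plancherel[OF f] by simp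
  have K0: "0 \<le> K" using c0 C(1) by (simp add: K_def)
  have "(\<integral>\<^sup>+z. ennreal (\<bar>z \<bullet> b\<bar> powr (2 * r) * N z) \<partial>lborel) \<le>
      (\<integral>\<^sup>+z. ennreal (N z) + (\<Sum>n. ennreal (q n * D n z)) \<partial>lborel)"
    by (intro nn_integral_mono pt)
  also have "\<dots> = (\<integral>\<^sup>+z. ennreal (N z) \<partial>lborel) + (\<integral>\<^sup>+z. (\<Sum>n. ennreal (q n * D n z)) \<partial>lborel)"
    by (rule nn_integral_add) (simp_all add: N_def D_def)
  also have "(\<integral>\<^sup>+z. (\<Sum>n. ennreal (q n * D n z)) \<partial>lborel) = (\<Sum>n. \<integral>\<^sup>+z. ennreal (q n * D n z) \<partial>lborel)"
    by (rule nn_integral_suminf) (simp add: D_def)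
  also have "\<dots> \<le> (\<Sum>n. ennreal (K * (2 powr (2 * r - 3)) ^ n))" by (intro suminf_le term_le) auto
  also have "\<dots> = ennreal (\<Sum>n. K * (2 powr (2 * r - 3)) ^ n)"
    using K0 r powr_less_one[of 2 "2 * r - 3"]
    by (intro suminf_ennreal2 summable_mult summable_geometric) auto
  finally have "(\<integral>\<^sup>+z. ennreal (\<bar>z \<bullet> b\<bar> powr (2 * r) * N z) \<partial>lborel)
      \<le> (\<integral>\<^sup>+z. ennreal (N z) \<partial>lborel) + ennreal (\<Sum>n. K * (2 powr (2 * r - 3)) ^ n)" by (simp add: add_left_mono)
  also have "\<dots> < \<infinity>" using Nfin by simp
  finally show ?thesis by (simp add: N_def)
qed

text \<open>The largest coordinate controls the norm. Hence the bounds of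
  \<open>dyadic_FT_bound\<close> along the coordinate directions suffice for the full Sobolev
  weight.\<close>

lemma one_plus_norm_powr_le:
  fixes z :: "'a::euclidean_space"
  assumes r: "0 \<le> r"
  shows "(1 + (norm z)\<^sup>2) powr r \<le> (1 + real DIM('a)) powr r * (1 + (\<Sum>b\<in>Basis. \<bar>z \<bullet> b\<bar> powr (2 * r)))"
proof -
  obtain b where b: "b \<in> (Basis :: 'a set)" and mx: "\<And>b'. b' \<in> Basis \<Longrightarrow> \<bar>z \<bullet> b'\<bar> \<le> \<bar>z \<bullet> b\<bar>"
  proof -
    have "Max ((\<lambda>b. \<bar>z \<bullet> b\<bar>) ` Basis) \<in> (\<lambda>b. \<bar>z \<bullet> b\<bar>) ` Basis" by (intro Max_in) auto
    then obtain b where b: "b \<in> Basis" "Max ((\<lambda>b. \<bar>z \<bullet> b\<bar>) ` Basis) = \<bar>z \<bullet> b\<bar>" by (elim imageE)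
    have "\<bar>z \<bullet> b'\<bar> \<le> \<bar>z \<bullet> b\<bar>" if "b' \<in> Basis" for b'
      unfolding b(2)[symmetric] using that by (intro Max_ge) auto
    then show ?thesis using that b(1) by blast
  qed
  \<comment> \<open>The 1 covers frequencies all of whose coordinates are small.\<close>
  define m where "m = max 1 (\<bar>z \<bullet> b\<bar>\<^sup>2)"
  have "(norm z)\<^sup>2 = (\<Sum>b\<in>Basis. (z \<bullet> b)\<^sup>2)"
    unfolding power2_norm_eq_inner euclidean_inner[of z z] by (simp add: power2_eq_square)
  also have "\<dots> \<le> (\<Sum>b'\<in>(Basis::'a set). \<bar>z \<bullet> b\<bar>\<^sup>2)"
    by (intro sum_mono) (use mx in \<open>simp add: abs_le_square_iff[symmetric]\<close>)
  also have "\<dots> = real DIM('a) * \<bar>z \<bullet> b\<bar>\<^sup>2" by simp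
  also have "\<dots> \<le> real DIM('a) * m" by (intro mult_left_mono) (simp_all add: m_def)
  finally have "1 + (norm z)\<^sup>2 \<le> 1 * m + real DIM('a) * m"
    by (intro add_mono) (simp_all add: m_def)
  then have "1 + (norm z)\<^sup>2 \<le> (1 + real DIM('a)) * m" by (simp add: distrib_right)
  then have "(1 + (norm z)\<^sup>2) powr r \<le> ((1 + real DIM('a)) * m) powr r"
    using r by (intro powr_mono2) (auto simp: add_nonneg_nonneg)
  also have "\<dots> = (1 + real DIM('a)) powr r * m powr r" by (rule powr_mult)
  also have "m powr r \<le> 1 + \<bar>z \<bullet> b\<bar> powr (2 * r)"
  proof (cases "1 \<le> \<bar>z \<bullet> b\<bar>\<^sup>2")
    case True
    then have "m = \<bar>z \<bullet> b\<bar> powr 2" by (simp add: m_def powr_numeral)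
    then have "m powr r = \<bar>z \<bullet> b\<bar> powr (2 * r)" by (simp only: powr_powr)
    then show ?thesis by simp
  qed (simp add: m_def)
  also have "\<bar>z \<bullet> b\<bar> powr (2 * r) \<le> (\<Sum>b\<in>Basis. \<bar>z \<bullet> b\<bar> powr (2 * r))"
    by (rule member_le_sum[OF b]) auto
  finally show ?thesis by (simp add: mult_left_mono)
qed

lemma sobolev_energy_finite:
  fixes f :: "'a::euclidean_space \<Rightarrow> real"
  assumes f: "Lip_cpt f" and r: "0 \<le> r" "r < 3 / 2"
    and C: "0 \<le> C" "\<And>a. norm2_sq (second_difference f a) \<le> C * norm a ^ 3"
  shows "sobolev_energy r f < \<infinity>"
proof -
  note [measurable] = FT_measurable[OF f]
  define N where "N z = (norm (FT f z))\<^sup>2" for z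
  have [measurable]: "N \<in> borel_measurable borel" unfolding N_def[abs_def] by measurable
  define c where "c = (1 + real DIM('a)) powr r * (2 * pi) powr (- real DIM('a))"
  have c0: "0 \<le> c" by (simp add: c_def)
  have "sobolev_energy r f \<le> (\<integral>\<^sup>+ z. ennreal c * (ennreal (N z) + (\<Sum>b\<in>Basis. ennreal (\<bar>z \<bullet> b\<bar> powr (2 * r) * N z))) \<partial>lborel)"
    unfolding sobolev_energy_eq[OF f]
  proof (intro nn_integral_mono)
    fix z
    have "(1 + (norm z)\<^sup>2) powr r * ((2 * pi) powr (- real DIM('a)) * N z) \<le>
        (1 + real DIM('a)) powr r * (1 + (\<Sum>b\<in>Basis. \<bar>z \<bullet> b\<bar> powr (2 * r))) * ((2 * pi) powr (- real DIM('a)) * N z)"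
      by (intro mult_right_mono one_plus_norm_powr_le r) (auto simp: N_def)
    also have "\<dots> = c * (N z + (\<Sum>b\<in>Basis. \<bar>z \<bullet> b\<bar> powr (2 * r) * N z))"
      by (simp add: c_def algebra_simps sum_distrib_left sum_distrib_right)
    finally have "ennreal ((1 + (norm z)\<^sup>2) powr r * ((2 * pi) powr (- real DIM('a)) * N z)) \<le>
        ennreal (c * (N z + (\<Sum>b\<in>Basis. \<bar>z \<bullet> b\<bar> powr (2 * r) * N z)))" by (rule ennreal_leI)
    also have "\<dots> = ennreal c * (ennreal (N z) + (\<Sum>b\<in>Basis. ennreal (\<bar>z \<bullet> b\<bar> powr (2 * r) * N z)))"
    proof -
      have "(\<Sum>b\<in>Basis. ennreal (\<bar>z \<bullet> b\<bar> powr (2 * r) * N z)) = ennreal (\<Sum>b\<in>Basis. \<bar>z \<bullet> b\<bar> powr (2 * r) * N z)"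
        by (rule sum_ennreal) (simp add: N_def)
      then show ?thesis using c0 by (simp only:) (subst ennreal_mult, simp_all add: N_def sum_nonneg)
    qed
    finally show "ennreal ((1 + (norm z)\<^sup>2) powr r * ((2 * pi) powr (- real DIM('a)) * (norm (FT f z))\<^sup>2)) \<le>
        ennreal c * (ennreal (N z) + (\<Sum>b\<in>Basis. ennreal (\<bar>z \<bullet> b\<bar> powr (2 * r) * N z)))" by (simp add: N_def)
  qed
  also have "\<dots> = ennreal c * ((\<integral>\<^sup>+z. ennreal (N z) \<partial>lborel) +
      (\<Sum>b\<in>Basis. \<integral>\<^sup>+z. ennreal (\<bar>z \<bullet> b\<bar> powr (2 * r) * N z) \<partial>lborel))"
    by (simp add: nn_integral_cmult nn_integral_add nn_integral_sum del: sum_ennreal)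
  also have "\<dots> < \<infinity>"
  proof -
    have "(\<integral>\<^sup>+z. ennreal (N z) \<partial>lborel) < \<infinity>" unfolding N_def FT_Plancherel[OF f] by simp
    moreover have "(\<integral>\<^sup>+z. ennreal (\<bar>z \<bullet> b\<bar> powr (2 * r) * N z) \<partial>lborel) < \<infinity>" if "b \<in> Basis" for b
      unfolding N_def by (rule dyadic_FT_bound[OF f that r C])
    ultimately show ?thesis by (simp add: ennreal_mult_less_top)
  qed
  finally show ?thesis .
qed

text \<open>The energy is finite, so a zero norm means zero energy and not infinite energy. The
  weight is positive, hence the transform vanishes almost everywhere, and Plancherel's identity
  applies.\<close>

lemma sobolev_norm_eq_0D:
  fixes f :: "'a::euclidean_space \<Rightarrow> real"
  assumes f: "Lip_cpt f" and r: "0 \<le> r" "r < 3 / 2"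
    and C: "0 \<le> C" "\<And>a. norm2_sq (second_difference f a) \<le> C * norm a ^ 3"
    and 0: "sobolev_norm r f = 0"
  shows "norm2_sq f = 0"
proof -
  note [measurable] = FT_measurable[OF f]
  have "sobolev_energy r f = 0"
    using 0 sobolev_energy_finite[OF f r C] by (auto simp: sobolev_norm_def enn2real_eq_0_iff)
  then have "AE z in lborel. ennreal ((1 + (norm z)\<^sup>2) powr r * ((2 * pi) powr (- real DIM('a)) * (norm (FT f z))\<^sup>2)) = 0"
    unfolding sobolev_energy_eq[OF f] by (subst (asm) nn_integral_0_iff_AE) auto
  then have "AE z in lborel. ennreal ((norm (FT f z))\<^sup>2) = 0"
  proof eventually_elim
    case (elim z)
    have "1 + (norm z)\<^sup>2 \<noteq> 0" using zero_le_power2[of "norm z"] by linarith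
    then have "0 < (1 + (norm z)\<^sup>2) powr r * (2 * pi) powr (- real DIM('a))" by simp
    moreover have "(1 + (norm z)\<^sup>2) powr r * (2 * pi) powr (- real DIM('a)) * (norm (FT f z))\<^sup>2 \<le> 0"
      using elim by (simp add: mult.assoc ennreal_eq_0_iff)
    ultimately have "(norm (FT f z))\<^sup>2 \<le> 0" by (simp only: mult_le_0_iff) auto
    then show ?case by simp
  qed
  then have "(\<integral>\<^sup>+z. ennreal ((norm (FT f z))\<^sup>2) \<partial>lborel) = 0"
    by (subst nn_integral_0_iff_AE) auto
  then have "(2 * pi) ^ DIM('a) * norm2_sq f \<le> 0"
    unfolding FT_Plancherel[OF f] by (simp only: ennreal_eq_0_iff)
  then have "norm2_sq f \<le> 0"
    using mult_le_cancel_left_pos[of "(2 * pi) ^ DIM('a)" "LINT x|lborel. (f x)\<^sup>2" 0] by simp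
  moreover have "0 \<le> norm2_sq f" by simp
  ultimately show ?thesis by linarith
qed

context fe_domain begin

lemma V_Lip_cpt:
  assumes v: "v \<in> V"
  shows "Lip_cpt v"
proof -
  obtain L where "0 \<le> L" "\<And>x y. \<bar>v x - v y\<bar> \<le> L * norm (x - y)" using V_Lipschitz[OF v] by blast
  moreover obtain R where R: "A \<subseteq> ball 0 R" using bounded_subset_ballD[OF bounded_A, of 0] by blast
  moreover have "v x = 0" if "R < norm x" for x
  proof (rule V_zero[OF v])
    show "x \<notin> A" using subsetD[OF R, of x] that by auto
  qed
  ultimately show ?thesis unfolding Lip_cpt_def by blast
qed

text \<open>Either one element holds all three points, and \<open>v\<close> is affine on it, or none
  of them meets the mesh, and all three values are zero.\<close>

lemma V_second_difference_eq_0: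
  assumes v: "v \<in> V" and bad: "\<And>T. T \<in> TT \<Longrightarrow> x \<in> T \<or> x + a \<in> T \<or> x + 2 *\<^sub>R a \<in> T \<Longrightarrow> x \<in> T \<and> x + a \<in> T \<and> x + 2 *\<^sub>R a \<in> T"
  shows "second_difference v a x = 0"
proof (cases "\<exists>T\<in>TT. x \<in> T \<or> x + a \<in> T \<or> x + 2 *\<^sub>R a \<in> T")
  case True
  then obtain T where T: "T \<in> TT" "x \<in> T" "x + a \<in> T" "x + 2 *\<^sub>R a \<in> T" using bad by blast
  obtain b where b: "\<And>x. x \<in> T \<Longrightarrow> v x = slope v T \<bullet> x + b" using V_slope[OF v T(1)] by blast
  show ?thesis unfolding second_difference_def b[OF T(2)] b[OF T(3)] b[OF T(4)] by (simp add: inner_add_right)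
next
  case False
  have "v y = 0" if "y \<in> {x, x + a, x + 2 *\<^sub>R a}" for y
  proof (rule V_zero[OF v])
    have "y \<notin> \<Union>TT" using False that by blast
    then show "y \<notin> A" unfolding Union_TT using closure_subset by blast
  qed
  then show ?thesis by (simp add: second_difference_def)
qed

text \<open>A nonzero second difference needs an element that contains some but not all of the three
  points. Such x lie in translates of strips along the element boundaries of measure O(|a|), and
  there the value is at most 2 L |a|. The constant is 48 = 4 * 6 * 2: the square of 2, the six pairs
  of points, and shifts of length up to 2 |a|.\<close>

lemma V_second_difference_L2:
  assumes v: "v \<in> V"
  obtains C where "0 \<le> C" "\<And>a. norm2_sq (second_difference v a) \<le> C * norm a ^ 3"
proof -
  obtain L where L: "0 \<le> L" "\<And>x y. \<bar>v x - v y\<bar> \<le> L * norm (x - y)" using V_Lipschitz[OF v] by blast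
  have "\<exists>c\<ge>0. \<forall>w. measure lborel {x \<in> T. x + w \<notin> T} \<le> c * norm w" if T: "T \<in> TT" for T
  proof -
    obtain x0 r where "0 < r" "cball x0 r \<subseteq> T"
      using interior_TT[OF T] mem_interior_cball by (metis ex_in_conv)
    then show ?thesis
      using measure_convex_Diff_translate_le[OF TT_convex[OF T] TT_compact[OF T], of x0 r]
      by (intro exI[of _ "DIM('a) / r * measure lborel T"]) (simp add: mult_ac)
  qed
  then obtain c where c: "\<And>T. T \<in> TT \<Longrightarrow> 0 \<le> c T"
    "\<And>T w. T \<in> TT \<Longrightarrow> measure lborel {x \<in> T. x + w \<notin> T} \<le> c T * norm w" by metis
  define E where "E T w = {x \<in> T. x + w \<notin> T}" for T :: "'a set" and w
  have Em: "E T w \<in> sets borel" and Ei: "integrable lborel (indicator (E T w) :: 'a \<Rightarrow> real)" if T: "T \<in> TT" for T w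
  proof -
    have [measurable]: "T \<in> sets borel" using TT_compact[OF T] by (simp add: borel_compact)
    show m: "E T w \<in> sets borel" unfolding E_def by measurable
    have "bounded (E T w)"
      by (rule bounded_subset[OF compact_imp_bounded[OF TT_compact[OF T]]]) (auto simp: E_def)
    then have "emeasure lborel (E T w) < \<infinity>" by (rule emeasure_bounded_finite)
    then show "integrable lborel (indicator (E T w) :: 'a \<Rightarrow> real)" using m by (simp add: integrable_indicator_iff)
  qed
  have "norm2_sq (second_difference v a) \<le> (48 * L\<^sup>2 * sum c TT) * norm a ^ 3" for a
  proof -
    \<comment> \<open>A pair \<open>(w, u)\<close> says that \<open>x + u\<close> lies in the
      element while \<open>x + u + w\<close> does not; the six pairs are the ordered pairs of
      distinct points among the three.\<close>
    define P where "P = {(a, 0), (2 *\<^sub>R a, 0), (a, a), (- a, a), (- a, 2 *\<^sub>R a), (- 2 *\<^sub>R a, 2 *\<^sub>R a)}"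
    define e :: "'a set \<times> 'a \<times> 'a \<Rightarrow> 'a \<Rightarrow> real"
      where "e q x = indicator (E (fst q) (fst (snd q))) (x + snd (snd q))" for q x
    define g where "g x = (2 * L * norm a)\<^sup>2 * (\<Sum>q\<in>TT \<times> P. e q x)" for x
    have fin: "finite (TT \<times> P)" using finite_TT by (simp add: P_def)
    have pt: "(second_difference v a x)\<^sup>2 \<le> g x" for x
    proof (cases "second_difference v a x = 0")
      case True then show ?thesis by (simp add: g_def e_def sum_nonneg)
    next
      case False
      then obtain T where T: "T \<in> TT" "x \<in> T \<or> x + a \<in> T \<or> x + 2 *\<^sub>R a \<in> T"
          "\<not> (x \<in> T \<and> x + a \<in> T \<and> x + 2 *\<^sub>R a \<in> T)"
        using V_second_difference_eq_0[OF v] by blast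
      have p: "x + 2 *\<^sub>R a + - a = x + a" "x + 2 *\<^sub>R a + - 2 *\<^sub>R a = x" "x + a + a = x + 2 *\<^sub>R a"
          "x + a + - a = x"
        by (simp_all add: scaleR_2 algebra_simps)
      have "x \<in> E T a \<or> x \<in> E T (2 *\<^sub>R a) \<or> x + a \<in> E T a \<or> x + a \<in> E T (- a) \<or>
          x + 2 *\<^sub>R a \<in> E T (- a) \<or> x + 2 *\<^sub>R a \<in> E T (- 2 *\<^sub>R a)"
        using T unfolding E_def mem_Collect_eq p by blast
      then have "\<exists>q\<in>P. x + snd q \<in> E T (fst q)" by (simp add: P_def)
      then obtain w u where wu: "(w, u) \<in> P" "x + u \<in> E T w" by auto
      have "1 = e (T, w, u) x" using wu(2) by (simp add: e_def)
      also have "\<dots> \<le> (\<Sum>q\<in>TT \<times> P. e q x)"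
        by (rule member_le_sum[OF _ _ fin]) (use T wu in \<open>auto simp: e_def\<close>)
      finally have 1: "1 \<le> (\<Sum>q\<in>TT \<times> P. e q x)" .
      have "\<bar>second_difference v a x\<bar> \<le> \<bar>v (x + 2 *\<^sub>R a) - v (x + a)\<bar> + \<bar>v (x + a) - v x\<bar>"
        by (simp add: second_difference_def)
      also have "\<dots> \<le> L * norm a + L * norm a"
        using L(2)[of "x + 2 *\<^sub>R a" "x + a"] L(2)[of "x + a" x] by (intro add_mono) (simp_all add: scaleR_2)
      finally have "(second_difference v a x)\<^sup>2 \<le> (2 * L * norm a)\<^sup>2"
        using L(1) by (subst abs_le_square_iff[symmetric]) simp
      also have "\<dots> \<le> g x" unfolding g_def using mult_left_mono[OF 1, of "(2 * L * norm a)\<^sup>2"] by simp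
      finally show ?thesis .
    qed
    have ei: "integrable lborel (e q)" and ev: "(LINT x|lborel. e q x) \<le> c (fst q) * (2 * norm a)"
      if q: "q \<in> TT \<times> P" for q
    proof -
      obtain T w u where Twu: "q = (T, w, u)" "T \<in> TT" "(w, u) \<in> P" using q by auto
      have eq: "e q = (\<lambda>x. indicator (E T w) (x + u))" by (auto simp: e_def Twu(1))
      show "integrable lborel (e q)" unfolding eq by (rule integrable_lborel_translate[OF Ei[OF Twu(2)]])
      have "(LINT x|lborel. e q x) = measure lborel (E T w)"
        unfolding eq using integral_lborel_translate[of "indicator (E T w) :: 'a \<Rightarrow> real" u] Em[OF Twu(2)] by simp
      also have "\<dots> \<le> c T * norm w" unfolding E_def by (rule c(2)[OF Twu(2)])
      also have "\<dots> \<le> c T * (2 * norm a)"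
        using Twu(3) by (intro mult_left_mono c(1)[OF Twu(2)]) (auto simp: P_def)
      finally show "(LINT x|lborel. e q x) \<le> c (fst q) * (2 * norm a)" by (simp add: Twu(1))
    qed
    \<comment> \<open>Only an inequality, since the pairs coincide for \<open>a = 0\<close>.\<close>
    have cP: "real (card P) \<le> 6" by (simp add: P_def card_insert_if)
    have "norm2_sq (second_difference v a) \<le> (LINT x|lborel. g x)"
      by (rule integral_mono[OF Lip_cpt_integrable_sq[OF Lip_cpt_second_difference[OF V_Lip_cpt[OF v]]] _ pt])
        (use ei in \<open>simp add: g_def[abs_def]\<close>)
    also have "\<dots> = (2 * L * norm a)\<^sup>2 * (\<Sum>q\<in>TT \<times> P. LINT x|lborel. e q x)"
      unfolding g_def using ei by simp
    also have "\<dots> \<le> (2 * L * norm a)\<^sup>2 * (\<Sum>q\<in>TT \<times> P. c (fst q) * (2 * norm a))"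
      by (intro mult_left_mono sum_mono ev) auto
    also have "(\<Sum>q\<in>TT \<times> P. c (fst q) * (2 * norm a)) = real (card P) * (sum c TT * (2 * norm a))"
      by (simp add: sum.cartesian_product' sum_distrib_left sum_distrib_right)
    also have "(2 * L * norm a)\<^sup>2 * \<dots> \<le> (2 * L * norm a)\<^sup>2 * (6 * (sum c TT * (2 * norm a)))"
      using cP c(1) by (intro mult_left_mono mult_right_mono) (auto intro!: mult_nonneg_nonneg sum_nonneg)
    finally show ?thesis by (simp add: power2_eq_square power3_eq_cube mult_ac)
  qed
  moreover have "0 \<le> 48 * L\<^sup>2 * sum c TT" using c(1) by (simp add: sum_nonneg)
  ultimately show ?thesis using that by blast
qed

end

section \<open>Coercivity\<close>

context discrete_setting begin

lemma Htilde_norm_nonneg: "0 < r \<Longrightarrow> 0 \<le> Htilde_norm D r \<eta>"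
  by (auto simp: Htilde_norm_def sobolev_norm_def frac_const_def
      intro!: mult_nonneg_nonneg divide_nonneg_nonneg Gamma_real_nonneg)

text \<open>For \<delta> < 1 the two Gagliardo integrands are the same modulus with different
  weights that are positive away from 0, so they vanish together. For \<delta> \<ge> 1 the norm is
  of Fourier type and forces \<eta> itself to be zero.\<close>

lemma Htilde_norm_0_transfer:
  assumes s: "0 < s" "s < 1" and \<delta>: "0 < \<delta>" "\<delta> < 3 / 2" and 0: "Htilde_norm D \<delta> \<eta> = 0"
  shows "Htilde_norm D s \<eta> = 0"
proof -
  have "gagliardo s \<eta> = 0"
  proof (cases "\<delta> < 1")
    case True
    note [measurable] = eta_measurable
    have "(frac_const DIM('a) \<delta> / 2) * enn2real (gagliardo \<delta> \<eta>) = 0"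
      using Htilde_norm_sq(1)[OF \<delta>(1) True] 0 by simp
    then have "gagliardo \<delta> \<eta> = 0"
      using Htilde_norm_sq(2)[OF \<delta>(1) True] gagliardo_finite_eta[OF \<delta>(1) True]
      by (auto simp: enn2real_eq_0_iff)
    then have "AE z in lborel. shift_modulus \<eta> z * ennreal (norm z powr - (real DIM('a) + 2 * \<delta>)) = 0"
      unfolding gagliardo_eq_shift_modulus[OF eta_measurable] by (subst (asm) nn_integral_0_iff_AE) auto
    then have "AE z in lborel. shift_modulus \<eta> z * ennreal (norm z powr - (real DIM('a) + 2 * s)) = 0"
    proof eventually_elim
      case (elim z)
      then show ?case by (cases "z = 0") (auto simp: ennreal_eq_0_iff)
    qed
    then show ?thesis
      unfolding gagliardo_eq_shift_modulus[OF eta_measurable] by (subst nn_integral_0_iff_AE) auto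
  next
    case False
    interpret fe_domain "A 0" "TO 0" by (rule fe_domain_A[OF zero_J])
    have e: "\<eta> \<in> V" by (rule eta_A[OF zero_J])
    obtain C where C: "0 \<le> C" "\<And>a. norm2_sq (second_difference \<eta> a) \<le> C * norm a ^ 3"
      using V_second_difference_L2[OF e] by blast
    have "sobolev_norm \<delta> \<eta> = 0" using 0 False by (simp add: Htilde_norm_def zext_eta)
    then have "norm2_sq \<eta> = 0"
      using sobolev_norm_eq_0D[OF V_Lip_cpt[OF e] _ \<delta>(2) C] \<delta>(1) by simp
    then have "\<eta> = (\<lambda>_. 0)" by (rule V_eq_0I[OF e])
    then show ?thesis by (simp add: gagliardo_def)
  qed
  then show ?thesis using Htilde_norm_sq(1)[OF s] by simp
qed

lemma form_ah_nonneg: "0 < s \<Longrightarrow> s < 1 \<Longrightarrow> 0 \<le> form_ah s k Nm Np D Om M TO \<eta> \<eta>"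
  unfolding form_ah_eq c_quad_def using S_nonneg[of s]
  by (intro mult_nonneg_nonneg divide_nonneg_nonneg sin_ge_zero) (auto simp: mult_left_le)

text \<open>All three parts are expressed by \<open>S s\<close>: the inner one by
  \<open>G_le_S\<close> at the price 1 / b, the outer one by \<open>K0_le_S\<close>, whose missing
  factor \<open>k\<close> is supplied by the assumption on \<open>d\<close>, and the middle one is
  \<open>S s\<close> itself. The constant is uniform when \<open>b\<close>, \<open>C\<close> and
  \<open>d\<close> do not depend on h, k and M.\<close>

lemma gagliardo_le_S:
  fixes s k0 b C d :: real
  assumes s: "0 < s" "s < 1" and k0: "k \<le> k0" and b: "0 < b" "b / k \<le> Np"
    and t: "t_node k Np * exp (b / 2) \<le> C * h"
    and d: "0 < d" "t_node k (- Nm) powr (- 2 * s) \<le> k / d"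
  shows "gagliardo s \<eta> \<le> ennreal ((
       unit_vol TYPE('a) * 2 powr (DIM('a) + 2 * s) / (1 - 2 powr (2 * s - 2))
         * ((32 * 2 ^ DIM('a) * (2 * C * \<sigma> * \<rho>)\<^sup>2 + 2) / b)
     + unit_vol TYPE('a) * 2 ^ DIM('a) / (1 - 2 powr (- 2 * s)) * (16 / d)
     + unit_vol TYPE('a) * 4 * DIM('a) * exp ((DIM('a) + 2 * s) * k0 / 2)) * S s)"
proof -
  have le1: "(2::real) powr (2 * s - 2) < 1" "(2::real) powr (- 2 * s) < 1"
    using powr_less_one[of 2 "2 * s - 2"] powr_less_one[of 2 "- 2 * s"] s by simp_all
  let ?c1 = "unit_vol TYPE('a) * 2 powr (DIM('a) + 2 * s) / (1 - 2 powr (2 * s - 2))"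
  let ?c2 = "unit_vol TYPE('a) * 2 ^ DIM('a) / (1 - 2 powr (- 2 * s))"
  let ?c3 = "unit_vol TYPE('a) * 4 * DIM('a) * exp ((DIM('a) + 2 * s) * k0 / 2)"
  have c1: "0 \<le> ?c1" and c2: "0 \<le> ?c2"
    using le1 unit_vol_nonneg[where 'a='a] by (auto intro!: divide_nonneg_nonneg mult_nonneg_nonneg)
  have K0: "0 \<le> K 0" by (rule K_nonneg[OF zero_J])
  have "gagliardo s \<eta> \<le> ennreal (
      ?c1 * (G * t_node k Np powr (2 - 2 * s)) + ?c2 * ((16 * K 0) * t_node k (- Nm) powr (- 2 * s))
    + ?c3 * (k * (\<Sum>j\<in>J. exp (s * y_node k j) * K j)))"
    by (rule gagliardo_node_bound[OF eta_measurable s k k0 _ G_nonneg modulus_le_G _ modulus_le_K0 K_nonneg modulus_le_K])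
      (use N K0 in auto)
  also have "\<dots> \<le> ennreal (?c1 * (((32 * 2 ^ DIM('a) * (2 * C * \<sigma> * \<rho>)\<^sup>2 + 2) / b) * S s) + ?c2 * (16 / d * S s) + ?c3 * S s)"
  proof (intro ennreal_leI add_mono mult_left_mono c1 c2)
    show "G * t_node k Np powr (2 - 2 * s) \<le> (32 * 2 ^ DIM('a) * (2 * C * \<sigma> * \<rho>)\<^sup>2 + 2) / b * S s"
      using G_le_S[OF s _ b(2) t] b(1) by (simp add: field_simps)
    have "16 * K 0 * t_node k (- Nm) powr (- 2 * s) \<le> 16 * K 0 * (k / d)"
      using d(2) K0 by (intro mult_left_mono) auto
    also have "\<dots> = 16 / d * (k * K 0)" by simp
    also have "\<dots> \<le> 16 / d * S s" using d(1) by (intro mult_left_mono K0_le_S) auto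
    finally show "16 * K 0 * t_node k (- Nm) powr (- 2 * s) \<le> 16 / d * S s" .
    show "k * (\<Sum>j\<in>J. exp (s * y_node k j) * K j) \<le> S s" by (simp add: S_def)
  qed (use unit_vol_nonneg[where 'a='a] in auto)
  finally show ?thesis by (simp only: distrib_right mult.assoc)
qed

end

text \<open>The smallness condition is solved for the exponential, and the power 1 / (\<delta> - s)
  then turns \<open>h powr (\<delta> - s)\<close> into \<open>h\<close>. The constant
  \<open>c\<close> stands for \<open>cI * C0\<close>.\<close>

lemma spacing_bound:
  assumes k: "0 < k" and s: "s < \<delta>" and h: "0 < h" and c: "0 < c"
    and le: "c * exp (- 2 * pi * dd / k) * h powr (s - \<delta>) < 1"
  shows "exp (- 2 * pi * dd / (k * (\<delta> - s))) \<le> c powr (- 1 / (\<delta> - s)) * h"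
proof -
  have p: "0 < 1 / (\<delta> - s)" using s by simp
  have "exp (- 2 * pi * dd / k) \<le> (1 / c) * h powr (\<delta> - s)"
  proof -
    have "h powr (s - \<delta>) * h powr (\<delta> - s) = 1" using h by (simp flip: powr_add)
    then have "exp (- 2 * pi * dd / k) = exp (- 2 * pi * dd / k) * (h powr (s - \<delta>) * h powr (\<delta> - s))"
      by (simp only: mult_1_right)
    also have "\<dots> = (c * exp (- 2 * pi * dd / k) * h powr (s - \<delta>)) * (1 / c * h powr (\<delta> - s))"
      using c by simp
    also have "\<dots> \<le> 1 * (1 / c * h powr (\<delta> - s))"
      using le c by (intro mult_right_mono) auto
    finally show ?thesis by simp
  qed
  then have "exp (- 2 * pi * dd / k) powr (1 / (\<delta> - s)) \<le> ((1 / c) * h powr (\<delta> - s)) powr (1 / (\<delta> - s))"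
    using p by (intro powr_mono2) auto
  also have "\<dots> = c powr (- 1 / (\<delta> - s)) * h"
    using s h c by (simp add: powr_mult powr_powr powr_divide powr_minus_divide)
  also have "exp (- 2 * pi * dd / k) powr (1 / (\<delta> - s)) = exp (- 2 * pi * dd / (k * (\<delta> - s)))"
    by (simp add: powr_def)
  finally show ?thesis .
qed

theorem theorem7p2:
  fixes D Om :: "'a::euclidean_space set"
    and s \<delta> k0 dd \<sigma> \<rho> C0 cI :: real
  assumes "polygonal_domain D" and "lipschitz_boundary D"
    and "polygonal_domain Om" and "convex Om" and "diameter Om = 1"
    and "D \<subseteq> Om" and "0 \<in> Om"
    and "0 < k0" and "0 < dd" and "dd < pi"
    and "0 < s" and "s < 1" and "s < \<delta>" and "\<delta> \<le> 2 - s" and "\<delta> < 3 / 2"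
    and "0 < C0"
    and consistency:
      "\<And>k \<eta> \<theta>. 0 < k \<Longrightarrow> k \<le> k0 \<Longrightarrow> \<eta> \<in> Htilde D \<delta> \<Longrightarrow> \<theta> \<in> Htilde D s \<Longrightarrow>
         \<bar>form_a s D \<eta> \<theta> - form_ak s k (N_minus s dd k) (N_plus s \<delta> dd k) D \<eta> \<theta>\<bar>
           \<le> gamma_quad C0 dd k * Htilde_norm D \<delta> \<eta> * Htilde_norm D s \<theta>"
  shows "\<exists>c>0. \<forall>h k M TD TO.
           0 < h \<and> h \<le> 1 \<and> 0 < k \<and> k \<le> k0 \<and> 0 < M \<and>
           fe_mesh \<sigma> \<rho> D h TD \<and>
           (\<forall>j\<in>{- N_minus s dd k..N_plus s \<delta> dd k}.
              fe_mesh \<sigma> \<rho> (truncated_domain Om M (t_node k j)) h (TO j) \<and> TD \<subseteq> TO j) \<and>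
           (\<forall>v\<in>fe_space D TD. Htilde_norm D \<delta> v \<le> cI * h powr (s - \<delta>) * Htilde_norm D s v) \<and>
           cI * gamma_quad C0 dd k * h powr (s - \<delta>) < 1
           \<longrightarrow> (\<forall>\<eta>\<in>fe_space D TD.
                  c * (Htilde_norm D s \<eta>)\<^sup>2
                    \<le> form_ah s k (N_minus s dd k) (N_plus s \<delta> dd k) D Om M TO \<eta> \<eta>)"
proof -
  note dd = \<open>0 < dd\<close> and s = \<open>0 < s\<close> \<open>s < 1\<close> and \<delta> = \<open>s < \<delta>\<close> \<open>\<delta> < 3 / 2\<close>
  have D: "open D" and Om: "open Om" "bounded Om" "convex Om" "0 \<in> Om" "diameter Om = 1"
    using assms by (auto simp: polygonal_domain_def)
  have N: "0 \<le> N_minus s dd k" "0 \<le> N_plus s \<delta> dd k" if "0 < k" for k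
  proof -
    have "0 \<le> 2 * pi * dd / (s * k\<^sup>2)" "0 \<le> 4 * pi * dd / (k\<^sup>2 * (\<delta> - s))"
      using dd s \<delta> by simp_all
    then show "0 \<le> N_minus s dd k" "0 \<le> N_plus s \<delta> dd k"
      unfolding N_minus_def N_plus_def zero_le_ceiling by linarith+
  qed
  have setting: "discrete_setting D Om k M h \<sigma> \<rho> (N_minus s dd k) (N_plus s \<delta> dd k) TD TO \<eta>"
    if "0 < h" "0 < k" "0 < M" "fe_mesh \<sigma> \<rho> D h TD"
      "\<forall>j\<in>{- N_minus s dd k..N_plus s \<delta> dd k}.
         fe_mesh \<sigma> \<rho> (truncated_domain Om M (t_node k j)) h (TO j) \<and> TD \<subseteq> TO j"
      "\<eta> \<in> fe_space D TD" for h k M TD TO \<eta>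
    by unfold_locales (use that D Om assms N[OF that(2)] in auto)
  show ?thesis
  proof (cases "0 < cI")
    case False
    \<comment> \<open>All norms vanish. For \<open>\<delta> \<ge> 1\<close> this uses that finite element functions have finite energy,
      since \<^const>\<open>sobolev_norm\<close> is also \<open>0\<close> if the energy is infinite.\<close>
    have main: "1 * (Htilde_norm D s \<eta>)\<^sup>2 \<le> form_ah s k (N_minus s dd k) (N_plus s \<delta> dd k) D Om M TO \<eta> \<eta>"
      if h: "0 < h" and "0 < k" "0 < M" "fe_mesh \<sigma> \<rho> D h TD"
      "\<forall>j\<in>{- N_minus s dd k..N_plus s \<delta> dd k}.
         fe_mesh \<sigma> \<rho> (truncated_domain Om M (t_node k j)) h (TO j) \<and> TD \<subseteq> TO j"
      and inv: "\<forall>v\<in>fe_space D TD. Htilde_norm D \<delta> v \<le> cI * h powr (s - \<delta>) * Htilde_norm D s v"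
      and e: "\<eta> \<in> fe_space D TD" for h k M TD TO \<eta>
    proof -
      interpret discrete_setting D Om k M h \<sigma> \<rho> "N_minus s dd k" "N_plus s \<delta> dd k" TD TO \<eta>
        by (rule setting) (use that in auto)
      have "Htilde_norm D \<delta> \<eta> \<le> cI * h powr (s - \<delta>) * Htilde_norm D s \<eta>" using inv e by blast
      also have "\<dots> \<le> 0" using False Htilde_norm_nonneg[of s] s
        by (intro mult_nonpos_nonneg) (auto simp: mult_le_0_iff)
      finally have "Htilde_norm D \<delta> \<eta> = 0" using Htilde_norm_nonneg[of \<delta>] s \<delta> by simp
      then have "Htilde_norm D s \<eta> = 0" using Htilde_norm_0_transfer[of s \<delta>] s \<delta> by simp
      then show ?thesis using form_ah_nonneg s by simp
    qed
    \<comment> \<open>The norm is zero, so the value 1 is arbitrary.\<close>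
    show ?thesis by (intro exI[of _ 1] conjI zero_less_one) (use main in blast)
  next
    case True
    \<comment> \<open>With \<open>k0\<close> in place of one factor \<open>k\<close>,
      \<open>b\<close> is independent of k and still \<open>b / k\<close> is at most
      \<open>N_plus\<close>. In \<open>C\<close>, the power comes from \<open>spacing_bound\<close>,
      and exp(b / 2) is the distance factor of the block of nodes near the smallest one.\<close>
    define b where "b = 4 * pi * dd / (k0 * (\<delta> - s))"
    define C where "C = (cI * C0) powr (- 1 / (\<delta> - s)) * exp (b / 2)"
    define d where "d = 2 * pi * dd"
    define Q where "Q = unit_vol TYPE('a) * 2 powr (DIM('a) + 2 * s) / (1 - 2 powr (2 * s - 2))
         * ((32 * 2 ^ DIM('a) * (2 * C * \<sigma> * \<rho>)\<^sup>2 + 2) / b)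
     + unit_vol TYPE('a) * 2 ^ DIM('a) / (1 - 2 powr (- 2 * s)) * (16 / d)
     + unit_vol TYPE('a) * 4 * DIM('a) * exp ((DIM('a) + 2 * s) * k0 / 2)"
    have b: "0 < b" using dd \<delta> \<open>0 < k0\<close> by (simp add: b_def)
    have d: "0 < d" using dd by (simp add: d_def)
    have cq: "0 < c_quad s" using s by (auto simp: c_quad_def intro!: sin_gt_zero mult_pos_pos divide_pos_pos)
    \<comment> \<open>\<open>\<bar>Q\<bar> + 1\<close> is positive without any discussion of the
      sign of \<open>Q\<close>. The other factors turn the bound for the squared norm into
      \<open>c_quad s / 2 * S s\<close>.\<close>
    define c where "c = c_quad s / (frac_const DIM('a) s * (\<bar>Q\<bar> + 1))"
    have fc: "0 < frac_const DIM('a) s"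
      using s by (auto simp: frac_const_def intro!: divide_pos_pos mult_pos_pos Gamma_real_pos add_nonneg_pos)
    have c: "0 < c" using cq fc by (simp add: c_def)
    have "c * (Htilde_norm D s \<eta>)\<^sup>2 \<le> form_ah s k (N_minus s dd k) (N_plus s \<delta> dd k) D Om M TO \<eta> \<eta>"
      if h: "0 < h" and kk: "0 < k" "k \<le> k0" and "0 < M" "fe_mesh \<sigma> \<rho> D h TD"
      "\<forall>j\<in>{- N_minus s dd k..N_plus s \<delta> dd k}.
         fe_mesh \<sigma> \<rho> (truncated_domain Om M (t_node k j)) h (TO j) \<and> TD \<subseteq> TO j"
      and small: "cI * gamma_quad C0 dd k * h powr (s - \<delta>) < 1"
      and e: "\<eta> \<in> fe_space D TD" for h k M TD TO \<eta>
    proof -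
      let ?Np = "N_plus s \<delta> dd k" and ?Nm = "N_minus s dd k"
      interpret discrete_setting D Om k M h \<sigma> \<rho> ?Nm ?Np TD TO \<eta>
        by (rule setting) (use that in auto)
      have Np: "4 * pi * dd / (k\<^sup>2 * (\<delta> - s)) \<le> of_int ?Np" by (simp add: N_plus_def)
      have "b / k = 4 * pi * dd / (k0 * k * (\<delta> - s))" by (simp add: b_def)
      also have "\<dots> \<le> 4 * pi * dd / (k\<^sup>2 * (\<delta> - s))"
        using kk \<delta> dd \<open>0 < k0\<close> by (intro divide_left_mono mult_right_mono mult_pos_pos) (auto simp: power2_eq_square)
      finally have bk: "b / k \<le> ?Np" using Np by linarith
      \<comment> \<open>The factor 1 / 2 in the exponent of \<open>t_node\<close> turns the 4 pi of
        \<open>N_plus\<close> into the 2 pi of \<open>gamma_quad\<close>.\<close>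
      have "t_node k ?Np \<le> exp (- 2 * pi * dd / (k * (\<delta> - s)))"
      proof -
        have "4 * pi * dd / (k\<^sup>2 * (\<delta> - s)) * k \<le> of_int ?Np * k" using Np k by (intro mult_right_mono) auto
        moreover have "4 * pi * dd / (k\<^sup>2 * (\<delta> - s)) * k = 2 * (2 * pi * dd / (k * (\<delta> - s)))"
          using k \<delta> by (simp add: power2_eq_square)
        ultimately show ?thesis by (simp add: t_node_def y_node_def)
      qed
      also have "\<dots> \<le> (cI * C0) powr (- 1 / (\<delta> - s)) * h"
        by (rule spacing_bound[OF kk(1) \<delta>(1) h]) (use small True \<open>0 < C0\<close> in \<open>auto simp: gamma_quad_def mult_ac\<close>)
      finally have "t_node k ?Np * exp (b / 2) \<le> (cI * C0) powr (- 1 / (\<delta> - s)) * h * exp (b / 2)"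
        by (intro mult_right_mono) auto
      then have t: "t_node k ?Np * exp (b / 2) \<le> C * h" by (simp add: C_def mult_ac)
      have tail: "t_node k (- ?Nm) powr (- 2 * s) \<le> k / d"
      proof -
        have "2 * pi * dd / (s * k\<^sup>2) \<le> of_int ?Nm" by (simp add: N_minus_def)
        then have "2 * pi * dd / (s * k\<^sup>2) * (s * k) \<le> of_int ?Nm * (s * k)" using k s by (intro mult_right_mono) auto
        moreover have "2 * pi * dd / (s * k\<^sup>2) * (s * k) = d / k" using k s by (simp add: d_def power2_eq_square)
        ultimately have le: "d / k \<le> of_int ?Nm * (s * k)" by simp
        have "t_node k (- ?Nm) powr (- 2 * s) = exp (- (of_int ?Nm * (s * k)))"
          by (simp add: t_node_def y_node_def powr_def mult_ac)
        also have "\<dots> \<le> exp (- (d / k))" using le by simp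
        also have "\<dots> = 1 / exp (d / k)" by (simp add: exp_minus divide_inverse)
        \<comment> \<open>The decay is exponential in 1 / k, but the single factor \<open>k\<close>
          that offsets the weight of the node t = 1 is enough.\<close>
        also have "\<dots> \<le> 1 / (d / k)"
        proof (rule divide_left_mono)
          show "d / k \<le> exp (d / k)" using exp_ge_add_one_self[of "d / k"] by linarith
        qed (use k d in auto)
        finally show ?thesis by simp
      qed
      have Sn: "0 \<le> S s" by (rule S_nonneg)
      have "gagliardo s \<eta> \<le> ennreal (Q * S s)"
        unfolding Q_def by (rule gagliardo_le_S[OF s kk(2) b bk t d tail])
      also have "\<dots> \<le> ennreal ((\<bar>Q\<bar> + 1) * S s)" using Sn by (intro ennreal_leI mult_right_mono) auto
      finally have "enn2real (gagliardo s \<eta>) \<le> (\<bar>Q\<bar> + 1) * S s"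
        using Sn by (intro enn2real_leI) auto
      then have "(Htilde_norm D s \<eta>)\<^sup>2 \<le> frac_const DIM('a) s / 2 * ((\<bar>Q\<bar> + 1) * S s)"
        unfolding Htilde_norm_sq(1)[OF s] using fc by (intro mult_left_mono) auto
      then have "c * (Htilde_norm D s \<eta>)\<^sup>2 \<le> c * (frac_const DIM('a) s / 2 * ((\<bar>Q\<bar> + 1) * S s))"
        using c by (intro mult_left_mono) auto
      also have "\<dots> = form_ah s k ?Nm ?Np D Om M TO \<eta> \<eta>"
      proof -
        have "\<bar>Q\<bar> + 1 \<noteq> 0" "frac_const DIM('a) s \<noteq> 0" using fc by linarith+
        moreover have "c_quad s / (f * q) * (f / 2 * (q * S s)) = c_quad s / 2 * S s"
          if "q \<noteq> 0" "f \<noteq> 0" for f q using that by simp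
        ultimately show ?thesis unfolding form_ah_eq c_def by blast
      qed
      finally show ?thesis .
    qed
    then show ?thesis using c by (intro exI[of _ c]) blast
  qed
qed

end
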